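(* Let $d\in\{2,3\}$ and let $\Omega\subset\mathbb{R}^d$ be an open, bounded and simply connected set. Suppose $n:\Omega\to\mathbb{S}^2$ is a map such that $n\otimes n\in W^{1,2}(\Omega,\mathbb{R}^{3\times3})$. Then there exists $m\in W^{1,2}(\Omega,\mathbb{S}^2)$ such that $m\otimes m=n\otimes n$ a.e. in $\Omega$.
   Context: A set is simply connected if it is path connected and any two continuous curves in it with the same endpoints are homotopic. No regularity of $\partial\Omega$ is assumed. *)

theory Defs
  imports "HOL-Analysis.Analysis"
begin

primrec Ck :: "nat \<Rightarrow> ('a::euclidean_space \<Rightarrow> real) \<Rightarrow> bool" where
  "Ck 0 f \<longleftrightarrow> continuous_on UNIV f"
| "Ck (Suc k) f \<longleftrightarrow>
     (\<forall>x. f differentiable at x) \<and> (\<forall>e\<in>Basis. Ck k (\<lambda>x. frechet_derivative f (at x) e))"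

definition test_function :: "'a::euclidean_space set \<Rightarrow> ('a \<Rightarrow> real) \<Rightarrow> bool" where
  "test_function \<Omega> \<phi> \<longleftrightarrow>
     (\<forall>k. Ck k \<phi>) \<and> compact (closure {x. \<phi> x \<noteq> 0}) \<and> closure {x. \<phi> x \<noteq> 0} \<subseteq> \<Omega>"

definition locally_integrable_on ::
    "('a::euclidean_space \<Rightarrow> 'b::euclidean_space) \<Rightarrow> 'a set \<Rightarrow> bool" where
  "locally_integrable_on f \<Omega> \<longleftrightarrow> (\<forall>K. compact K \<and> K \<subseteq> \<Omega> \<longrightarrow> f absolutely_integrable_on K)"

text \<open>\<open>weak_partial \<Omega> e f g\<close>: on the open set \<open>\<Omega>\<close>, \<open>g\<close> is the weak partial derivative of
  \<open>f\<close> in direction \<open>e\<close>. Local integrability is part of the definition, so both Bochner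
  integrals below exist and the convention that a non-integrable function has integral 0
  plays no role.\<close>

definition weak_partial ::
    "'a::euclidean_space set \<Rightarrow> 'a \<Rightarrow> ('a \<Rightarrow> 'b::euclidean_space) \<Rightarrow> ('a \<Rightarrow> 'b) \<Rightarrow> bool" where
  "weak_partial \<Omega> e f g \<longleftrightarrow>
     locally_integrable_on f \<Omega> \<and> locally_integrable_on g \<Omega> \<and>
     (\<forall>\<phi>. test_function \<Omega> \<phi> \<longrightarrow>
        (LINT x|lebesgue_on \<Omega>. frechet_derivative \<phi> (at x) e *\<^sub>R f x)
          = - (LINT x|lebesgue_on \<Omega>. \<phi> x *\<^sub>R g x))"

definition L2 :: "'a::euclidean_space set \<Rightarrow> ('a \<Rightarrow> 'b::euclidean_space) set" where
  "L2 \<Omega> = {f. f \<in> borel_measurable (lebesgue_on \<Omega>) \<and>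
               integrable (lebesgue_on \<Omega>) (\<lambda>x. (norm (f x))\<^sup>2)}"

text \<open>Elements of Sobolev spaces are represented by functions, not by classes modulo null sets.
  Only the values on \<open>\<Omega>\<close> matter, and only up to a null set. The codomain is the whole
  Euclidean space \<open>'b\<close>; for matrices \<open>real^'n^'m\<close> the norm is the Frobenius norm.\<close>

definition W12 :: "'a::euclidean_space set \<Rightarrow> ('a \<Rightarrow> 'b::euclidean_space) set" where
  "W12 \<Omega> = {f \<in> L2 \<Omega>. \<forall>e\<in>Basis. \<exists>g\<in>L2 \<Omega>. weak_partial \<Omega> e f g}"

text \<open>\<open>W12_into \<Omega> N\<close> is \<open>W\<^sup>1\<^sup>,\<^sup>2(\<Omega>, N)\<close> for a subset \<open>N\<close> of a Euclidean space: the Sobolev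
  functions with values in \<open>N\<close> almost everywhere.\<close>

definition W12_into ::
    "'a::euclidean_space set \<Rightarrow> 'b::euclidean_space set \<Rightarrow> ('a \<Rightarrow> 'b) set" where
  "W12_into \<Omega> N = {f \<in> W12 \<Omega>. AE x in lebesgue_on \<Omega>. f x \<in> N}"

definition tensor :: "real^'m \<Rightarrow> real^'n \<Rightarrow> real^'n^'m"  (infixl "\<otimes>" 70) where
  "a \<otimes> b = (\<chi> i j. a $ i * b $ j)"

end

theory Submission
  imports Defs
begin

text \<open>
  Choose a measurable unit field \<open>n\<^sub>0\<close> with \<open>n\<^sub>0 \<otimes> n\<^sub>0 = P := n \<otimes> n\<close>; it is Sobolev up to a sign \<open>\<tau>\<close> that has
  to be found. Along a segment the sign is transported by cutting the segment into \<open>2\<^sup>k\<close> pieces and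
  multiplying the signs of \<open>n\<^sub>0(x\<^sub>j) \<bullet> n\<^sub>0(x\<^sub>j\<^sub>+\<^sub>1)\<close>. Since \<open>\<nabla>P \<in> L\<^sup>2\<close>, the set of \<open>x\<close> with
  \<open>\<bar>P(x + t v) - P(x)\<bar> \<ge> 1/2\<close> has measure \<open>o(t\<^sup>2)\<close>. This beats the \<open>2\<^sup>k\<close> pieces of a segment, so by
  Borel-Cantelli the transport stabilises almost everywhere, and also the \<open>4\<^sup>k\<close> cells of a triangle, so the
  transport around almost every triangle is trivial. (This is where the exponent 2 is critical; the dimension
  plays no role.) On a box, transport from a generic base point therefore yields a sign, unique up to a global
  constant. The constants form a locally constant cocycle on a cover of \<open>\<Omega>\<close> by boxes, which is trivial because
  the associated double covering of the simply connected \<open>\<Omega>\<close> has a section. The resulting field \<open>m = \<tau> n\<^sub>0\<close>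
  satisfies \<open>m(x) \<bullet> m(x + h e) < 0\<close> only on a set of measure \<open>o(h)\<close> on compact sets, so its difference
  quotients converge to \<open>(\<partial>\<^sub>e P) m\<close>, which is thus its weak derivative.
\<close>

subsection \<open>Signs of unit fields\<close>

text \<open>Sobolev functions have no values on single segments or triangles, so no curve is ever
  fixed: a displacement \<open>v\<close> is fixed, the starting point varies, and translation
  invariance bounds the measure of bad starting points by the number of pieces times the measure of
  the bad points of one piece. Chebyshev with the full gradient only gives O(4^-k) for a piece of
  length 2^-k. That suffices to sum over segments, but not for the 4^k cells of a triangle. The
  missing gain comes from truncation: in a jump of size 1/2 over length t, slopes below 1/(4t)
  account for at most 1/4, so only the gradient energy above that level counts, and it tends to 0.
  The threshold 1/2 makes signs multiplicative: two unit vectors within 1/2 of a third have positive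
  inner product. The cocycle identity is proved for every fixed pair of displacements; Fubini later
  turns it into a statement about one generic base point. For the derivative, an increment of a unit
  field is the increment of its tensor square applied to the field, plus an error quadratic in the
  increment; this error is o(h) in L1 once sign flips are rare.\<close>

definition rel_sign :: "('a \<Rightarrow> 'c::real_inner) \<Rightarrow> 'a \<Rightarrow> 'a \<Rightarrow> real" where
  "rel_sign n x y = (if n x \<bullet> n y \<ge> 0 then 1 else - 1)"

text \<open>Depends on \<open>n\<close> only through its tensor square, hence not on the choice of
  signs. For unit fields it means that the squared inner product exceeds 7/8, by
  \<open>norm_tensor_diff_sq\<close>.\<close>

definition close_to :: "('a \<Rightarrow> real^'m) \<Rightarrow> 'a \<Rightarrow> 'a \<Rightarrow> bool" where
  "close_to n x y \<longleftrightarrow> norm (n x \<otimes> n x - n y \<otimes> n y) < 1/2"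

lemma inner_tensor: "(a \<otimes> b) \<bullet> (c \<otimes> d) = (a \<bullet> c) * (b \<bullet> d)"
  by (simp add: tensor_def inner_vec_def sum_product sum_distrib_left sum_distrib_right mult_ac)

lemma norm_tensor_diff_sq:
  fixes a b :: "real^'m"
  assumes "norm a = 1" "norm b = 1"
  shows "(norm (a \<otimes> a - b \<otimes> b))\<^sup>2 = 2 - 2 * (a \<bullet> b)\<^sup>2"
  using assms
  unfolding power2_norm_eq_inner
  by (simp add: inner_diff inner_tensor norm_eq_1 inner_commute[of b a] power2_eq_square algebra_simps)

lemma norm_diff_sq_unit:
  fixes a b :: "'c::real_inner"
  assumes "norm a = 1" "norm b = 1"
  shows "(norm (a - b))\<^sup>2 = 2 - 2 * (a \<bullet> b)"
  using assms by (simp add: power2_norm_eq_inner inner_diff norm_eq_1 inner_commute[of b a] algebra_simps)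

text \<open>The two squared norms are 2 - 2s and 2 - 2s^2 with s the inner product, and s^2 \<le> s
  for s in [0,1]. With the right sign, a lift oscillates no more than its tensor square.\<close>

lemma norm_diff_le_tensor:
  fixes a b :: "real^'m"
  assumes "norm a = 1" "norm b = 1" "a \<bullet> b \<ge> 0"
  shows "norm (a - b) \<le> norm (a \<otimes> a - b \<otimes> b)"
proof -
  have "a \<bullet> b \<le> 1" using norm_cauchy_schwarz[of a b] assms by simp
  then have "(a \<bullet> b)\<^sup>2 \<le> a \<bullet> b" using assms(3) by (simp add: power2_eq_square mult_left_le)
  then have "(norm (a - b))\<^sup>2 \<le> (norm (a \<otimes> a - b \<otimes> b))\<^sup>2"
    using assms by (simp add: norm_tensor_diff_sq norm_diff_sq_unit)
  then show ?thesis by (simp add: power2_le_iff_abs_le)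
qed

lemma tensor_scale_sign: "\<bar>s\<bar> = 1 \<Longrightarrow> (s *\<^sub>R a) \<otimes> (s *\<^sub>R a) = a \<otimes> (a::real^'m)"
  by (auto simp: tensor_def vec_eq_iff abs_if split: if_splits)

lemma abs_rel_sign [simp]: "\<bar>rel_sign n x y\<bar> = 1" by (simp add: rel_sign_def)

text \<open>Flip \<open>n x\<close> and \<open>n z\<close> into the half space of
  \<open>n y\<close>. Each is then within 1/2 of \<open>n y\<close>, so they are at distance less
  than 1 from each other and have positive inner product.\<close>

lemma rel_sign_mult:
  fixes n :: "'a \<Rightarrow> real^'m"
  assumes unit: "\<And>x. norm (n x) = 1" and xy: "close_to n x y" and yz: "close_to n y z"
  shows "rel_sign n x y * rel_sign n y z = rel_sign n x z"
proof -
  define a where "a = rel_sign n x y *\<^sub>R n x"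
  define b where "b = n y"
  define c where "c = rel_sign n y z *\<^sub>R n z"
  have u: "norm a = 1" "norm b = 1" "norm c = 1" by (simp_all add: a_def b_def c_def unit)
  have t: "a \<otimes> a = n x \<otimes> n x" "c \<otimes> c = n z \<otimes> n z"
    by (simp_all add: a_def c_def tensor_scale_sign)
  have "norm (a - b) \<le> norm (a \<otimes> a - b \<otimes> b)"
    by (intro norm_diff_le_tensor u) (simp add: a_def b_def rel_sign_def)
  also have "\<dots> < 1/2" using xy by (simp add: t b_def close_to_def)
  finally have ab: "norm (a - b) < 1/2" .
  have "norm (b - c) \<le> norm (b \<otimes> b - c \<otimes> c)"
    by (intro norm_diff_le_tensor u) (simp add: c_def b_def rel_sign_def)
  also have "\<dots> < 1/2" using yz by (simp add: t b_def close_to_def)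
  finally have "norm (a - c) < 1" using ab norm_triangle_ineq[of "a - b" "b - c"] by simp
  then have "(norm (a - c))\<^sup>2 < 1" by (simp add: power_less_one_iff abs_square_less_1)
  then have "a \<bullet> c > 0" using norm_diff_sq_unit[OF u(1,3)] by simp
  then have "rel_sign n x y * rel_sign n y z * (n x \<bullet> n z) > 0" by (simp add: a_def c_def mult_ac)
  then show ?thesis by (auto simp: rel_sign_def mult_less_0_iff zero_less_mult_iff split: if_splits)
qed

section \<open>Products of signs along discrete paths\<close>

definition chain :: "('p \<Rightarrow> 'p \<Rightarrow> real) \<Rightarrow> (nat \<Rightarrow> 'p) \<Rightarrow> nat \<Rightarrow> real" where
  "chain s f N = (\<Prod>j<N. s (f j) (f (Suc j)))"

lemma chain_0 [simp]: "chain s f 0 = 1" and chain_Suc [simp]: "chain s f (Suc N) = chain s f N * s (f N) (f (Suc N))"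
  by (simp_all add: chain_def)

lemma abs_chain_rel_sign [simp]: "\<bar>chain (rel_sign n) f N\<bar> = 1"
  by (induction N) (simp_all add: abs_mult)

text \<open>Each odd point is skipped by \<open>tri\<close>. This is the comparison of two
  consecutive dyadic scales.\<close>

lemma chain_double:
  assumes tri: "\<And>x y z. G x y \<Longrightarrow> G y z \<Longrightarrow> s x y * s y z = s x z"
    and G: "\<And>i. i < 2 * N \<Longrightarrow> G (f i) (f (Suc i))"
  shows "chain s f (2 * N) = chain s (\<lambda>j. f (2 * j)) N"
  using G
proof (induction N)
  case (Suc N)
  have "s (f (2*N)) (f (Suc (2*N))) * s (f (Suc (2*N))) (f (Suc (Suc (2*N)))) = s (f (2*N)) (f (Suc (Suc (2*N))))"
    by (intro tri Suc.prems) auto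
  with Suc show ?case by (simp add: mult.assoc)
qed simp

text \<open>A discrete Stokes formula: \<open>a i j\<close> with j \<le> i \<le> N is a triangulated
  triangle, and triviality on each small cell gives triviality around the boundary. The induction
  adds one column at a time.\<close>

lemma chain_triangle:
  assumes tri: "\<And>x y z. G x y \<Longrightarrow> G y z \<Longrightarrow> s x y * s y z = s x z"
    and hor: "\<And>i j. j \<le> i \<Longrightarrow> i < N \<Longrightarrow> G (a i j) (a (Suc i) j)"
    and ver: "\<And>i j. j < i \<Longrightarrow> i \<le> N \<Longrightarrow> G (a i j) (a i (Suc j))"
  shows "chain s (\<lambda>i. a i 0) N * chain s (a N) N = chain s (\<lambda>i. a i i) N"
  using hor ver
proof (induction N)
  case (Suc N)
  \<comment> \<open>Pushes a column to the next one. Each square between them is cut by the diagonal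
    from \<open>a N j\<close> to \<open>a (Suc N) (Suc j)\<close>, and both halves commute by
    \<open>tri\<close>.\<close>
  have ladder: "s (a N 0) (a (Suc N) 0) * chain s (a (Suc N)) j = chain s (a N) j * s (a N j) (a (Suc N) j)"
    if "j \<le> N" for j using that
  proof (induction j)
    case (Suc j)
    have "s (a N j) (a (Suc N) j) * s (a (Suc N) j) (a (Suc N) (Suc j)) = s (a N j) (a (Suc N) (Suc j))"
      using Suc.prems by (intro tri Suc.prems(1) \<open>\<And>i j. j \<le> i \<Longrightarrow> i < Suc N \<Longrightarrow> _\<close> \<open>\<And>i j. j < i \<Longrightarrow> i \<le> Suc N \<Longrightarrow> _\<close>) auto
    moreover have "s (a N j) (a N (Suc j)) * s (a N (Suc j)) (a (Suc N) (Suc j)) = s (a N j) (a (Suc N) (Suc j))"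
      using Suc.prems by (intro tri \<open>\<And>i j. j \<le> i \<Longrightarrow> i < Suc N \<Longrightarrow> _\<close> \<open>\<And>i j. j < i \<Longrightarrow> i \<le> Suc N \<Longrightarrow> _\<close>) auto
    ultimately show ?case using Suc by (simp add: mult.assoc) (simp add: mult.assoc[symmetric])
  qed simp
  \<comment> \<open>The last cell of the new column is a single triangle at the hypotenuse.\<close>
  have "s (a N N) (a (Suc N) N) * s (a (Suc N) N) (a (Suc N) (Suc N)) = s (a N N) (a (Suc N) (Suc N))"
    by (intro tri Suc.prems) auto
  moreover have "chain s (\<lambda>i. a i 0) N * chain s (a N) N = chain s (\<lambda>i. a i i) N"
    by (intro Suc.IH Suc.prems) auto
  ultimately show ?case using ladder[of N] by (simp add: mult.assoc) (simp add: mult.assoc[symmetric])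
qed simp

subsection \<open>Test functions\<close>

lemma Ck_continuous:
  assumes "Ck k f"
  shows "continuous_on UNIV f"
proof (cases k)
  case (Suc l)
  with assms have "f differentiable at x" for x by simp
  then show ?thesis by (intro continuous_at_imp_continuous_on ballI differentiable_imp_continuous_within)
qed (use assms in simp)

lemma Ck_Suc_imp: "Ck (Suc k) f \<Longrightarrow> Ck k f"
proof (induction k arbitrary: f)
  case 0
  then show ?case unfolding Ck.simps(1) by (rule Ck_continuous)
next
  case (Suc k)
  then show ?case unfolding Ck.simps(2)[of "Suc k"] Ck.simps(2)[of k] by blast
qed

lemma Ck_add: "Ck k f \<Longrightarrow> Ck k g \<Longrightarrow> Ck k (\<lambda>x. f x + g x)"
proof (induction k arbitrary: f g)
  case (Suc k)
  have "frechet_derivative (\<lambda>x. f x + g x) (at x) = (\<lambda>e. frechet_derivative f (at x) e + frechet_derivative g (at x) e)" for x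
    using Suc.prems by (intro frechet_derivative_at[symmetric] has_derivative_add)
      (auto simp: frechet_derivative_works[symmetric])
  then show ?case using Suc by auto
qed (auto intro: continuous_intros)

lemma Ck_mult: "Ck k f \<Longrightarrow> Ck k g \<Longrightarrow> Ck k (\<lambda>x. f x * g x)"
proof (induction k arbitrary: f g)
  case (Suc k)
  have *: "frechet_derivative (\<lambda>x. f x * g x) (at x) = (\<lambda>e. f x * frechet_derivative g (at x) e + frechet_derivative f (at x) e * g x)" for x
    using Suc.prems by (intro frechet_derivative_at[symmetric] has_derivative_mult)
      (auto simp: frechet_derivative_works[symmetric])
  show ?case unfolding Ck.simps(2) *
    using Suc.prems Ck_Suc_imp[OF Suc.prems(1)] Ck_Suc_imp[OF Suc.prems(2)]
    by (auto intro!: Ck_add Suc.IH differentiable_mult)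
qed (auto intro: continuous_intros)

lemma Ck_const: "Ck k (\<lambda>x. c)"
proof (induction k arbitrary: c)
  case (Suc k)
  then show ?case by (simp add: frechet_derivative_const)
qed auto

lemma Ck_prod: "(\<And>i. i \<in> I \<Longrightarrow> Ck k (f i)) \<Longrightarrow> Ck k (\<lambda>x. \<Prod>i\<in>I. f i x)"
  by (induction I rule: infinite_finite_induct) (auto intro: Ck_mult Ck_const)

text \<open>The class of functions \<open>p (1/t) exp (-1/t)\<close>, extended by \<open>0\<close> to \<open>t \<le> 0\<close>, is closed under
  differentiation.\<close>

definition flat :: "real poly \<Rightarrow> real \<Rightarrow> real" where
  "flat p t = (if t \<le> 0 then 0 else poly p (1 / t) * exp (- (1 / t)))"

text \<open>From the right, substitute x = 1/t: the exponential beats every polynomial at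
  infinity.\<close>

lemma flat_tendsto: "(flat p \<longlongrightarrow> 0) (at 0)"
proof (rule filterlim_split_at)
  have "eventually (\<lambda>t. flat p t = 0) (at_left 0)"
    by (auto simp: eventually_at_filter flat_def)
  then show "(flat p \<longlongrightarrow> 0) (at_left 0)" by (simp add: tendsto_eventually)
  have "((\<lambda>x. \<Sum>i\<le>degree p. coeff p i * (x ^ i / exp x)) \<longlongrightarrow> (\<Sum>i\<le>degree p. coeff p i * 0)) at_top"
    by (intro tendsto_intros tendsto_power_div_exp_0)
  then have "((\<lambda>x. poly p x * exp (- x)) \<longlongrightarrow> 0) (at_top :: real filter)"
    by (simp only: poly_altdef sum_distrib_right exp_minus divide_inverse mult.assoc mult_zero_right sum.neutral_const)
  from filterlim_compose[OF this filterlim_inverse_at_top_right]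
  have "((\<lambda>t. poly p (1 / t) * exp (- (1 / t))) \<longlongrightarrow> 0) (at_right 0)" by (simp add: inverse_eq_divide)
  moreover have "eventually (\<lambda>t. poly p (1 / t) * exp (- (1 / t)) = flat p t) (at_right 0)"
    by (auto simp: eventually_at_filter flat_def)
  ultimately show "(flat p \<longlongrightarrow> 0) (at_right 0)" by (rule Lim_transform_eventually)
qed

text \<open>For t > 0 the derivative of p(1/t) exp(-1/t) is t^-2 (p - p')(1/t) exp(-1/t), whence the
  polynomial X^2 (p - p').\<close>

lemma flat_deriv: "(flat p has_real_derivative flat (monom 1 2 * (p - pderiv p)) t) (at t)"
proof (rule linorder_cases[of t 0])
  assume t: "t < 0"
  have "((\<lambda>_. 0) has_real_derivative 0) (at t)" by simp
  then have "(flat p has_real_derivative 0) (at t)"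
    by (rule has_field_derivative_transform_within_open[where S = "{..<0}"]) (use t in \<open>auto simp: flat_def\<close>)
  then show ?thesis using t by (simp add: flat_def)
next
  assume t: "t = 0"
  \<comment> \<open>Dividing by h multiplies the polynomial by X, so the difference quotient at 0 is
    again a flat function.\<close>
  have "(flat (pCons 0 p) \<longlongrightarrow> 0) (at 0)" by (rule flat_tendsto)
  moreover have "eventually (\<lambda>h. flat (pCons 0 p) h = flat p h / h) (at 0)"
    by (auto simp: eventually_at_filter flat_def)
  ultimately have "((\<lambda>h. flat p h / h) \<longlongrightarrow> 0) (at 0)" by (rule Lim_transform_eventually)
  then show ?thesis using t by (simp add: has_field_derivative_iff flat_def)
next
  assume t: "t > 0"
  have "((\<lambda>t. poly p (1 / t) * exp (- (1 / t))) has_real_derivative flat (monom 1 2 * (p - pderiv p)) t) (at t)"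
    using t by (auto intro!: derivative_eq_intros DERIV_chain'[OF _ poly_DERIV] simp: flat_def poly_monom field_simps power2_eq_square)
  then show ?thesis
    by (rule has_field_derivative_transform_within_open[where S = "{0<..}"]) (use t in \<open>auto simp: flat_def\<close>)
qed

text \<open>Differentiating in direction \<open>e\<close> produces the factor
  \<open>u \<bullet> e\<close> and a new polynomial, so the induction must vary both
  \<open>c\<close> and \<open>p\<close>.\<close>

lemma Ck_flat: "Ck k (\<lambda>x. c * flat p (u \<bullet> x + d))"
proof (induction k arbitrary: c p)
  case 0
  have "continuous_on UNIV (flat p)"
    using flat_deriv by (meson DERIV_isCont continuous_at_imp_continuous_on)
  then show ?case by (auto intro!: continuous_intros intro: continuous_on_compose2)
next
  case (Suc k)
  define q where "q = monom 1 2 * (p - pderiv p)"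
  have *: "((\<lambda>x. c * flat p (u \<bullet> x + d)) has_derivative (\<lambda>e. (c * (u \<bullet> e)) * flat q (u \<bullet> x + d))) (at x)" for x
  proof -
    have 1: "(flat p has_derivative (*) (flat q (u \<bullet> x + d))) (at (u \<bullet> x + d))"
      using flat_deriv[of p "u \<bullet> x + d"] by (simp add: has_field_derivative_def q_def)
    have 2: "((\<lambda>x. u \<bullet> x + d) has_derivative (\<lambda>e. u \<bullet> e)) (at x)"
      by (auto intro!: derivative_eq_intros)
    have "((\<lambda>x. flat p (u \<bullet> x + d)) has_derivative (\<lambda>e. flat q (u \<bullet> x + d) * (u \<bullet> e))) (at x)"
      by (rule has_derivative_compose[OF 2 1])
    from has_derivative_mult_right[OF this, of c] show ?thesis by (simp add: mult_ac)
  qed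
  show ?case using * Suc by (auto simp: frechet_derivative_at[OF *, symmetric] differentiable_def)
qed

text \<open>The factor \<open>k\<close> pushes each exp(-1/(k s)) with s > 0 up to 1 as k grows, so
  these smooth functions stay in [0,1] and tend to the indicator of the open box. They take over the
  part of mollifiers.\<close>

definition bump :: "'a::euclidean_space \<Rightarrow> 'a \<Rightarrow> nat \<Rightarrow> 'a \<Rightarrow> real" where
  "bump a b k x = (\<Prod>i\<in>Basis. flat 1 (real k * (x \<bullet> i - a \<bullet> i)) * flat 1 (real k * (b \<bullet> i - x \<bullet> i)))"

lemma Ck_bump: "Ck l (bump a b k)"
proof -
  have "Ck l (\<lambda>x. flat 1 (real k * (x \<bullet> i - a \<bullet> i)) * flat 1 (real k * (b \<bullet> i - x \<bullet> i)))" for i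
    using Ck_mult[OF Ck_flat[of l 1 1 "real k *\<^sub>R i" "- real k * (a \<bullet> i)"] Ck_flat[of l 1 1 "- real k *\<^sub>R i" "real k * (b \<bullet> i)"]]
    by (simp add: algebra_simps inner_commute)
  then show ?thesis unfolding bump_def by (rule Ck_prod)
qed

lemma bump_outside: "x \<notin> box a b \<Longrightarrow> bump a b k x = 0"
  by (force simp: bump_def flat_def mem_box mult_le_0_iff not_less)

lemma bump_nonneg: "0 \<le> bump a b k x" and bump_le_1: "bump a b k x \<le> 1"
proof -
  have *: "0 \<le> flat 1 t \<and> flat 1 t \<le> 1" for t :: real by (simp add: flat_def)
  then show "0 \<le> bump a b k x" unfolding bump_def by (intro prod_nonneg) simp
  show "bump a b k x \<le> 1" unfolding bump_def using * by (intro prod_le_1) (auto intro: mult_le_one)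
qed

lemma bump_tendsto: "(\<lambda>k. bump a b k x) \<longlonglongrightarrow> indicator (box a b) x"
proof (cases "x \<in> box a b")
  case True
  have lim: "(\<lambda>k. flat 1 (real k * t)) \<longlonglongrightarrow> 1" if "t > 0" for t :: real
  proof -
    have "(\<lambda>k. exp (- (inverse (real k) * (1 / t)))) \<longlonglongrightarrow> exp (- (0 * (1 / t)))"
      by (intro tendsto_intros lim_inverse_n)
    moreover have "eventually (\<lambda>k. exp (- (inverse (real k) * (1 / t))) = flat 1 (real k * t)) sequentially"
      using eventually_gt_at_top[of 0] by eventually_elim (use that in \<open>auto simp: flat_def field_simps mult_le_0_iff\<close>)
    ultimately show ?thesis by (simp add: Lim_transform_eventually)
  qed
  have "(\<lambda>k. bump a b k x) \<longlonglongrightarrow> (\<Prod>i\<in>(Basis::'a set). 1 * 1)"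
    unfolding bump_def using True by (intro tendsto_prod tendsto_mult lim) (auto simp: mem_box)
  then show ?thesis using True by simp
qed (simp add: bump_outside)

lemma test_function_bump:
  assumes "cbox a b \<subseteq> \<Omega>"
  shows "test_function \<Omega> (bump a b k)"
proof -
  have "{x. bump a b k x \<noteq> 0} \<subseteq> cbox a b" using bump_outside[of _ a b k] box_subset_cbox by blast
  then have *: "closure {x. bump a b k x \<noteq> 0} \<subseteq> cbox a b" by (rule closure_minimal) (rule closed_cbox)
  then have "compact (closure {x. bump a b k x \<noteq> 0})"
    by (meson bounded_cbox bounded_subset closed_closure compact_eq_bounded_closed)
  with * assms Ck_bump show ?thesis unfolding test_function_def by blast
qed

text \<open>The fundamental lemma of the calculus of variations. Bumps converge to box indicators,
  so integrals over boxes vanish; boxes form an intersection-stable generator, so all integrals over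
  Borel sets vanish.\<close>

lemma AE_zero_of_box_integrals:
  fixes f :: "'a::euclidean_space \<Rightarrow> 'b::euclidean_space"
  assumes V: "open V" and [measurable]: "f \<in> borel_measurable borel"
    and int: "\<And>a b. cbox a b \<subseteq> V \<Longrightarrow> integrable lborel (\<lambda>x. indicator (cbox a b) x *\<^sub>R f x)"
    and zero: "\<And>a b k. cbox a b \<subseteq> V \<Longrightarrow> (LBINT x. bump a b k x *\<^sub>R f x) = 0"
  shows "AE x in lborel. x \<in> V \<longrightarrow> f x = 0"
proof -
  have box0: "(LBINT x. indicator (box a b) x *\<^sub>R f x) = 0" if ab: "cbox a b \<subseteq> V" for a b
  proof -
    have "(\<lambda>k. LINT x|lborel. bump a b k x *\<^sub>R f x) \<longlonglongrightarrow> (LBINT x. indicator (box a b) x *\<^sub>R f x)"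
    proof (rule integral_dominated_convergence)
      show "(\<lambda>x. bump a b k x *\<^sub>R f x) \<in> borel_measurable lborel" for k
        using Ck_continuous[OF Ck_bump] by (intro borel_measurable_scaleR) (auto intro: borel_measurable_continuous_onI)
      show "integrable lborel (\<lambda>x. norm (indicator (cbox a b) x *\<^sub>R f x))"
        using int[OF ab] by (rule integrable_norm)
      show "AE x in lborel. (\<lambda>k. bump a b k x *\<^sub>R f x) \<longlonglongrightarrow> indicator (box a b) x *\<^sub>R f x"
        by (intro AE_I2 tendsto_intros bump_tendsto)
      show "AE x in lborel. norm (bump a b k x *\<^sub>R f x) \<le> norm (indicator (cbox a b) x *\<^sub>R f x)" for k
      proof (rule AE_I2)
        fix x show "norm (bump a b k x *\<^sub>R f x) \<le> norm (indicator (cbox a b) x *\<^sub>R f x)"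
          using bump_nonneg[of a b k x] bump_le_1[of a b k x] bump_outside[of x a b k] box_subset_cbox[of a b]
          by (cases "x \<in> cbox a b"; cases "x \<in> box a b") (auto simp: mult_left_le_one_le)
      qed
    qed simp
    with zero[OF ab] show ?thesis by (simp add: LIMSEQ_const_iff)
  qed
  have AE_box: "AE x in lborel. x \<in> box a b \<longrightarrow> f x = 0" if ab: "cbox a b \<subseteq> V" for a b
  proof -
    \<comment> \<open>Restricting to one box makes \<open>F\<close> integrable with total integral
      0, which is what the complement case of the Dynkin argument uses.\<close>
    define F where "F x = indicator (box a b) x *\<^sub>R f x" for x
    have F: "integrable lborel F"
    proof (rule Bochner_Integration.integrable_bound[OF int[OF ab]])
      show "F \<in> borel_measurable lborel" unfolding F_def by measurable
      show "AE x in lborel. norm (F x) \<le> norm (indicator (cbox a b) x *\<^sub>R f x)"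
        using box_subset_cbox[of a b] by (auto simp: F_def indicator_def)
    qed
    have F0: "set_lebesgue_integral lborel A F = 0" if "A \<in> sets lborel" for A
    proof -
      have sets: "sets (lborel :: 'a measure) = sigma_sets UNIV (range (\<lambda>(a, b). box a b))"
        by (simp add: borel_eq_box)
      have stable: "Int_stable (range (\<lambda>(a, b). box a b :: 'a set))"
        unfolding Int_stable_def
      proof (intro ballI)
        fix S T :: "'a set" assume "S \<in> range (\<lambda>(a, b). box a b)" "T \<in> range (\<lambda>(a, b). box a b)"
        then obtain a b c d where "S = box a b" "T = box c d" by auto
        then obtain p q where "S \<inter> T = (\<lambda>(a, b). box a b) (p, q)" using box_Int_box[of a b c d] by simp
        then show "S \<inter> T \<in> range (\<lambda>(a, b). box a b)" by (rule range_eqI)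
      qed
      have subset_Pow_UNIV: "range (\<lambda>(a, b). box a b :: 'a set) \<subseteq> Pow UNIV" by simp
      have "A \<in> sigma_sets UNIV (range (\<lambda>(a, b). box a b))" using that unfolding sets .
      with stable subset_Pow_UNIV show ?thesis
      proof (induction rule: sigma_sets_induct_disjoint)
        case (basic A)
        then obtain c d where A: "A = box c d" by auto
        \<comment> \<open>\<open>box0\<close> wants the closed box inside \<open>V\<close>. For an
          empty intersection the corners given by \<open>box_Int_box\<close> may span a nonempty
          closed box elsewhere, so corners with an empty closed box are taken instead.\<close>
        obtain p q where pq: "box a b \<inter> box c d = box p q" and sub: "cbox p q \<subseteq> cbox a b"
        proof (cases "box a b \<inter> box c d = {}")
          case True
          obtain i :: 'a where i: "i \<in> Basis" using nonempty_Basis by blast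
          have "box 0 (- One) = ({}::'a set)" "cbox 0 (- One) = ({}::'a set)"
            unfolding box_eq_empty by (rule bexI[OF _ i], simp add: i)+
          then show thesis using that[of 0 "- One"] True by blast
        next
          case False
          obtain p q where pq: "box a b \<inter> box c d = box p q" using box_Int_box[of a b c d] by blast
          have "cbox p q = closure (box p q)" using False pq by simp
          also have "\<dots> \<subseteq> cbox a b"
            unfolding pq[symmetric] using box_subset_cbox[of a b] by (intro closure_minimal) auto
          finally show thesis using that[OF pq] by blast
        qed
        have "indicator A x *\<^sub>R F x = indicator (box p q) x *\<^sub>R f x" for x
          unfolding A pq[symmetric] F_def by (auto simp: indicator_def)
        then show ?case using box0[of p q] sub ab by (simp add: set_lebesgue_integral_def)
      next
        case (compl A)
        have A: "A \<in> sets lborel" using compl(1) unfolding sets .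
        have *: "set_integrable lborel B F" if "B \<in> sets lborel" for B
          unfolding set_integrable_def by (rule integrable_mult_indicator[OF that F])
        have "set_lebesgue_integral lborel (A \<union> (UNIV - A)) F = set_lebesgue_integral lborel A F + set_lebesgue_integral lborel (UNIV - A) F"
          using A by (intro set_integral_Un *) auto
        moreover have "set_lebesgue_integral lborel UNIV F = 0"
          using box0[OF ab] by (simp add: set_lebesgue_integral_def F_def)
        ultimately show ?case using compl.IH by simp
      next
        case (union A)
        then have A: "A i \<in> sets lborel" for i unfolding sets by blast
        have "set_lebesgue_integral lborel (\<Union>i. A i) F = (\<Sum>i. set_lebesgue_integral lborel (A i) F)"
        proof (rule lebesgue_integral_countable_add)
          show "set_integrable lborel (\<Union>i. A i) F"
            unfolding set_integrable_def using F A by (intro integrable_mult_indicator sets.countable_UN) auto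
          show "A i \<inter> A j = {}" if "i \<noteq> j" for i j
            using union(1) that unfolding disjoint_family_on_def by blast
        qed (rule A)
        with union.IH show ?case by simp
      qed (simp_all add: set_lebesgue_integral_def)
    qed
    have "AE x in lborel. F x = 0"
      by (rule sigma_finite_measure.density_zero[OF sigma_finite_lborel F]) (rule F0)
    then show ?thesis by eventually_elim (auto simp: F_def)
  qed
  define \<F> :: "'a set set" where "\<F> = (\<lambda>(a, b). box a b) ` {(a, b). cbox a b \<subseteq> V}"
  have op: "open X" if "X \<in> \<F>" for X using that by (auto simp: \<F>_def)
  \<comment> \<open>Countably many boxes suffice, so the exceptional null sets may be
    united.\<close>
  obtain D where D: "D \<subseteq> \<F>" "countable D" "\<Union>D = \<Union>\<F>"
    by (rule Lindelof[OF op])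
  have cov: "V \<subseteq> \<Union>D"
  proof
    fix x assume "x \<in> V"
    then obtain a b where "x \<in> box a b" "cbox a b \<subseteq> V" by (rule open_contains_cbox[OF V])
    then have "x \<in> \<Union>\<F>" unfolding \<F>_def by (intro UnionI[of "box a b"] image_eqI[of _ _ "(a, b)"]) auto
    then show "x \<in> \<Union>D" using D(3) by simp
  qed
  have "AE x in lborel. \<forall>X\<in>D. x \<in> X \<longrightarrow> f x = 0"
    unfolding AE_ball_countable[OF D(2)]
  proof
    fix X assume "X \<in> D"
    then have "X \<in> \<F>" using D(1) by blast
    then obtain a b where "X = box a b" "cbox a b \<subseteq> V" unfolding \<F>_def by auto
    then show "AE x in lborel. x \<in> X \<longrightarrow> f x = 0" using AE_box by simp
  qed
  then show ?thesis
  proof eventually_elim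
    case (elim x)
    with cov show ?case by blast
  qed
qed

subsection \<open>Increments of Sobolev functions\<close>

text \<open>Borel functions on the whole space, so that translates make sense without attention to
  domains; the equation itself is tested only inside \<Omega>. Integrability and square
  integrability of \<open>g e\<close> are both demanded because the whole space has infinite
  measure.\<close>

definition weak_gradient :: "'a::euclidean_space set \<Rightarrow> ('a \<Rightarrow> 'b::euclidean_space) \<Rightarrow> ('a \<Rightarrow> 'a \<Rightarrow> 'b) \<Rightarrow> bool" where
  "weak_gradient \<Omega> P g \<longleftrightarrow>
     P \<in> borel_measurable borel \<and> bounded (range P) \<and>
     (\<forall>e\<in>Basis. g e \<in> borel_measurable borel \<and> integrable lborel (g e) \<and>
        integrable lborel (\<lambda>x. (norm (g e x))\<^sup>2) \<and>
        (\<forall>\<phi>. test_function \<Omega> \<phi> \<longrightarrow>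
          (LBINT x. frechet_derivative \<phi> (at x) e *\<^sub>R P x) = - (LBINT x. \<phi> x *\<^sub>R g e x)))"

definition dir_deriv :: "('a::euclidean_space \<Rightarrow> 'a \<Rightarrow> 'b::euclidean_space) \<Rightarrow> 'a \<Rightarrow> 'a \<Rightarrow> 'b" where
  "dir_deriv g v x = (\<Sum>e\<in>Basis. (v \<bullet> e) *\<^sub>R g e x)"

section \<open>Translations and averages along segments\<close>

lemma lborel_integral_translate:
  fixes f :: "'a::euclidean_space \<Rightarrow> 'b::{banach, second_countable_topology}"
  assumes "f \<in> borel_measurable borel"
  shows "(LBINT x. f (x + c)) = (LBINT x. f x)"
proof -
  have "(LBINT x. f x) = (LINT x|distr lborel borel ((+) c). f x)" by (simp add: lborel_distr_plus)
  also have "\<dots> = (LBINT x. f (c + x))" using assms by (intro integral_distr) auto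
  finally show ?thesis by (simp add: add.commute)
qed

lemma lborel_integrable_translate:
  fixes f :: "'a::euclidean_space \<Rightarrow> 'b::{banach, second_countable_topology}"
  assumes "integrable lborel f"
  shows "integrable lborel (\<lambda>x. f (x + c))"
proof -
  have "integrable (distr lborel borel ((+) c)) f" using assms by (simp add: lborel_distr_plus)
  then have "integrable lborel (\<lambda>x. f (c + x))" by (rule integrable_distr[rotated]) auto
  then show ?thesis by (simp add: add.commute)
qed

lemma lborel_nn_integral_translate:
  fixes f :: "'a::euclidean_space \<Rightarrow> ennreal"
  assumes "f \<in> borel_measurable borel"
  shows "(\<integral>\<^sup>+x. f (x + c) \<partial>lborel) = (\<integral>\<^sup>+x. f x \<partial>lborel)"
proof -
  have "(\<integral>\<^sup>+x. f x \<partial>lborel) = (\<integral>\<^sup>+x. f x \<partial>distr lborel borel ((+) c))" by (simp add: lborel_distr_plus)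
  also have "\<dots> = (\<integral>\<^sup>+x. f (c + x) \<partial>lborel)" using assms by (intro nn_integral_distr) auto
  finally show ?thesis by (simp add: add.commute)
qed

lemma AE_lborel_translate:
  fixes c :: "'a::euclidean_space"
  assumes "AE x in lborel. Q x"
  shows "AE x in lborel. Q (x + c)"
proof -
  obtain N where N: "N \<in> null_sets lborel" "\<And>x. x \<notin> N \<Longrightarrow> Q x" using assms by (auto simp: eventually_ae_filter)
  have "{x. x + c \<in> N} \<in> null_sets lborel"
    using null_sets_translation[OF N(1), of "-c"] unfolding diff_minus_eq_add .
  then show ?thesis by (rule AE_I') (use N(2) in auto)
qed

abbreviation segment_integral :: "('a::euclidean_space \<Rightarrow> 'b::euclidean_space) \<Rightarrow> 'a \<Rightarrow> 'a \<Rightarrow> 'b" where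
  "segment_integral h v x \<equiv> LINT s|lborel. indicator {0..1::real} s *\<^sub>R h (x + s *\<^sub>R v)"

text \<open>Fubini's criterion applies because, for each s, the integral over x of the norm is that
  of \<open>h\<close>, by translation invariance.\<close>

lemma integrable_segment_average:
  fixes h :: "'a::euclidean_space \<Rightarrow> 'b::euclidean_space"
  assumes h: "integrable lborel h"
  shows "integrable (lborel \<Otimes>\<^sub>M lborel) (\<lambda>(s::real, x). indicator {0..1} s *\<^sub>R h (x + s *\<^sub>R v))"
proof (rule lborel_pair.Fubini_integrable)
  have [measurable]: "h \<in> borel_measurable borel" using borel_measurable_integrable[OF h] by simp
  show "(\<lambda>(s::real, x). indicator {0..1} s *\<^sub>R h (x + s *\<^sub>R v)) \<in> borel_measurable (lborel \<Otimes>\<^sub>M lborel)"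
    by measurable
  have "(LBINT x. norm (case (s, x) of (s, x) \<Rightarrow> indicator {0..1} s *\<^sub>R h (x + s *\<^sub>R v)))
    = indicator {0..1} s * (LBINT x. norm (h x))" for s :: real
    using lborel_integral_translate[of "\<lambda>x. norm (h x)" "s *\<^sub>R v"] by simp
  moreover have "integrable lborel (\<lambda>s::real. indicator {0..1} s * (LBINT x. norm (h x)))"
    by (intro integrable_mult_left) simp
  ultimately show "integrable lborel (\<lambda>s::real. LINT x|lborel. norm (case (s, x) of (s, x) \<Rightarrow> indicator {0..1} s *\<^sub>R h (x + s *\<^sub>R v)))"
    by (simp only:)
  show "AE s::real in lborel. integrable lborel (\<lambda>x. case (s, x) of (s, x) \<Rightarrow> indicator {0..1} s *\<^sub>R h (x + s *\<^sub>R v))"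
    using lborel_integrable_translate[OF h] by simp
qed

lemma frechet_derivative_scaled_linear:
  fixes \<phi> :: "'a::euclidean_space \<Rightarrow> real"
  assumes "\<phi> differentiable at x"
  shows "frechet_derivative \<phi> (at x) v = (\<Sum>e\<in>Basis. (v \<bullet> e) * frechet_derivative \<phi> (at x) e)"
proof -
  have lin: "linear (frechet_derivative \<phi> (at x))" using assms by (rule linear_frechet_derivative)
  have "frechet_derivative \<phi> (at x) (\<Sum>e\<in>Basis. (v \<bullet> e) *\<^sub>R e) = (\<Sum>e\<in>Basis. (v \<bullet> e) * frechet_derivative \<phi> (at x) e)"
    using lin by (simp add: linear_sum linear_cmul)
  then show ?thesis by (simp add: euclidean_representation)
qed

lemma test_functionD:
  assumes "test_function \<Omega> \<phi>"
  shows "continuous_on UNIV \<phi>" "\<phi> differentiable at x"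
    "compact (closure {x. \<phi> x \<noteq> 0})" "closure {x. \<phi> x \<noteq> 0} \<subseteq> \<Omega>"
    "continuous_on UNIV (\<lambda>x. frechet_derivative \<phi> (at x) v)"
    "x \<notin> closure {x. \<phi> x \<noteq> 0} \<Longrightarrow> \<phi> x = 0"
    "x \<notin> closure {x. \<phi> x \<noteq> 0} \<Longrightarrow> frechet_derivative \<phi> (at x) v = 0"
proof -
  have C: "Ck k \<phi>" for k using assms by (simp add: test_function_def)
  show "continuous_on UNIV \<phi>" using C by (rule Ck_continuous)
  have diff: "\<phi> differentiable at x" for x using C[of 1] by simp
  then show "\<phi> differentiable at x" .
  show "compact (closure {x. \<phi> x \<noteq> 0})" "closure {x. \<phi> x \<noteq> 0} \<subseteq> \<Omega>" using assms by (auto simp: test_function_def)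
  have "continuous_on UNIV (\<lambda>x. frechet_derivative \<phi> (at x) e)" if "e \<in> Basis" for e
    using C[of 1] that by simp
  then show "continuous_on UNIV (\<lambda>x. frechet_derivative \<phi> (at x) v)"
    unfolding frechet_derivative_scaled_linear[OF diff, of _ v] by (intro continuous_intros)
  have z: "\<phi> x = 0" if "x \<notin> closure {x. \<phi> x \<noteq> 0}" for x
    using that closure_subset[of "{x. \<phi> x \<noteq> 0}"] by auto
  then show "x \<notin> closure {x. \<phi> x \<noteq> 0} \<Longrightarrow> \<phi> x = 0" .
  assume x: "x \<notin> closure {x. \<phi> x \<noteq> 0}"
  have "(\<phi> has_derivative (\<lambda>_. 0)) (at x)"
  proof (rule has_derivative_transform_within_open[where f = "\<lambda>_. 0" and s = "- closure {x. \<phi> x \<noteq> 0}"])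
    show "0 = \<phi> y" if "y \<in> - closure {x. \<phi> x \<noteq> 0}" for y
      by (rule z[symmetric]) (use that in blast)
    show "x \<in> - closure {x. \<phi> x \<noteq> 0}" using x by (simp only: Compl_iff not_False_eq_True)
  qed (rule has_derivative_const, rule open_Compl[OF closed_closure])
  then have "(\<lambda>_. 0) = frechet_derivative \<phi> (at x)" by (rule frechet_derivative_at)
  then show "frechet_derivative \<phi> (at x) v = 0" by (rule fun_cong[symmetric])
qed

lemma continuous_compact_support_bounded:
  fixes f :: "'a::euclidean_space \<Rightarrow> real"
  assumes "continuous_on UNIV f" "compact K" "\<And>x. x \<notin> K \<Longrightarrow> f x = 0"
  obtains B where "B > 0" "\<And>x. \<bar>f x\<bar> \<le> B"
proof -
  have "continuous_on K f" using assms(1) continuous_on_subset by blast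
  then have "bounded (f ` K)" using assms(2) by (intro compact_imp_bounded compact_continuous_image)
  then obtain B where B: "\<And>x. x \<in> K \<Longrightarrow> \<bar>f x\<bar> \<le> B" by (auto simp: bounded_iff)
  show thesis
  proof (rule that[of "max 1 B"])
    show "\<bar>f x\<bar> \<le> max 1 B" for x using B[of x] assms(3)[of x] by (cases "x \<in> K") auto
  qed simp
qed

lemma integrable_indicator_compact: "compact K \<Longrightarrow> integrable lborel (indicator K :: 'a::euclidean_space \<Rightarrow> real)"
  using emeasure_compact_finite[of K] by (intro integrable_real_indicator) (auto simp: compact_imp_closed)

lemma integrable_compact_support:
  fixes f :: "'a::euclidean_space \<Rightarrow> real" and P :: "'a \<Rightarrow> 'b::euclidean_space"
  assumes f: "continuous_on UNIV f" "compact K" "\<And>x. x \<notin> K \<Longrightarrow> f x = 0"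
    and P: "P \<in> borel_measurable borel" "bounded (range P)"
  shows "integrable lborel (\<lambda>x. f x *\<^sub>R P x)"
proof -
  obtain B where B: "B > 0" "\<And>x. \<bar>f x\<bar> \<le> B" using continuous_compact_support_bounded[OF f] by blast
  obtain C where C: "\<And>x. norm (P x) \<le> C" using P(2) by (auto simp: bounded_iff)
  show ?thesis
  proof (rule Bochner_Integration.integrable_bound)
    show "integrable lborel (\<lambda>x. indicator K x *\<^sub>R (B * C))"
      by (intro integrable_scaleR_left integrable_indicator_compact f(2))
    show "(\<lambda>x. f x *\<^sub>R P x) \<in> borel_measurable lborel"
      using f(1) P(1) by (intro borel_measurable_scaleR) (auto intro: borel_measurable_continuous_onI)
    show "AE x in lborel. norm (f x *\<^sub>R P x) \<le> norm (indicator K x *\<^sub>R (B * C))"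
    proof (rule AE_I2)
      fix x
      have "0 \<le> C" using C[of x] norm_ge_zero order_trans by blast
      then show "norm (f x *\<^sub>R P x) \<le> norm (indicator K x *\<^sub>R (B * C))"
        using B(2)[of x] C[of x] f(3)[of x] B(1) by (cases "x \<in> K") (auto intro!: mult_mono)
    qed
  qed
qed

lemma integrable_bounded_mult:
  fixes f :: "'a::euclidean_space \<Rightarrow> real" and g :: "'a \<Rightarrow> 'b::euclidean_space"
  assumes "f \<in> borel_measurable borel" "\<And>x. \<bar>f x\<bar> \<le> B" "integrable lborel g"
  shows "integrable lborel (\<lambda>x. f x *\<^sub>R g x)"
proof (rule Bochner_Integration.integrable_bound)
  show "integrable lborel (\<lambda>x. B *\<^sub>R g x)" using assms by simp
  show "(\<lambda>x. f x *\<^sub>R g x) \<in> borel_measurable lborel" using assms(1) borel_measurable_integrable[OF assms(3)] by simp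
  have "0 \<le> B" using assms(2)[of undefined] by linarith
  then show "AE x in lborel. norm (f x *\<^sub>R g x) \<le> norm (B *\<^sub>R g x)"
    using assms(2) by (auto intro!: mult_right_mono)
qed

context
  fixes \<Omega> :: "'a::euclidean_space set" and P :: "'a \<Rightarrow> 'b::euclidean_space" and g
  assumes wg: "weak_gradient \<Omega> P g"
begin

lemma weak_gradientD:
  shows "P \<in> borel_measurable borel" "bounded (range P)"
    "e \<in> Basis \<Longrightarrow> g e \<in> borel_measurable borel" "e \<in> Basis \<Longrightarrow> integrable lborel (g e)"
    "e \<in> Basis \<Longrightarrow> integrable lborel (\<lambda>x. (norm (g e x))\<^sup>2)"
  using wg unfolding weak_gradient_def by auto

lemma dir_deriv_measurable: "dir_deriv g v \<in> borel_measurable borel"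
  unfolding dir_deriv_def using weak_gradientD(3) by (intro borel_measurable_sum borel_measurable_scaleR) auto

lemma dir_deriv_integrable: "integrable lborel (dir_deriv g v)"
  unfolding dir_deriv_def using weak_gradientD(4) by (intro Bochner_Integration.integrable_sum integrable_scaleR_right)

lemma weak_gradient_dir:
  assumes \<phi>: "test_function \<Omega> \<phi>"
  shows "(LBINT x. frechet_derivative \<phi> (at x) v *\<^sub>R P x) = - (LBINT x. \<phi> x *\<^sub>R dir_deriv g v x)"
proof -
  note tf = test_functionD[OF \<phi>]
  have wgi: "(LBINT x. frechet_derivative \<phi> (at x) e *\<^sub>R P x) = - (LBINT x. \<phi> x *\<^sub>R g e x)" if "e \<in> Basis" for e
    by (rule wg[unfolded weak_gradient_def, THEN conjunct2, THEN conjunct2, THEN bspec, OF that,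
          THEN conjunct2, THEN conjunct2, THEN conjunct2, THEN spec, THEN mp, OF \<phi>])
  have ip: "integrable lborel (\<lambda>x. frechet_derivative \<phi> (at x) e *\<^sub>R P x)" for e
    by (rule integrable_compact_support[OF tf(5,3,7) weak_gradientD(1,2)])
  obtain B where B: "\<And>x. \<bar>\<phi> x\<bar> \<le> B" using continuous_compact_support_bounded[OF tf(1,3,6)] by blast
  have ig: "integrable lborel (\<lambda>x. \<phi> x *\<^sub>R g e x)" if "e \<in> Basis" for e
    using tf(1) B weak_gradientD(4)[OF that] by (intro integrable_bounded_mult) (auto intro: borel_measurable_continuous_onI)
  have "frechet_derivative \<phi> (at x) v *\<^sub>R P x = (\<Sum>e\<in>Basis. (v \<bullet> e) *\<^sub>R (frechet_derivative \<phi> (at x) e *\<^sub>R P x))" for x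
    using frechet_derivative_scaled_linear[OF tf(2), of x v] by (simp only: scaleR_sum_left scaleR_scaleR)
  then have "(LBINT x. frechet_derivative \<phi> (at x) v *\<^sub>R P x)
      = (LBINT x. (\<Sum>e\<in>Basis. (v \<bullet> e) *\<^sub>R (frechet_derivative \<phi> (at x) e *\<^sub>R P x)))"
    by (rule Bochner_Integration.integral_cong[OF refl])
  moreover have "\<dots> = (\<Sum>e\<in>Basis. (v \<bullet> e) *\<^sub>R (LBINT x. frechet_derivative \<phi> (at x) e *\<^sub>R P x))"
    using Bochner_Integration.integral_sum[of Basis lborel "\<lambda>e x. (v \<bullet> e) *\<^sub>R (frechet_derivative \<phi> (at x) e *\<^sub>R P x)", OF integrable_scaleR_right[OF ip]]
    by (simp only: integral_scaleR_right)
  moreover have "\<dots> = (\<Sum>e\<in>Basis. (v \<bullet> e) *\<^sub>R - (LBINT x. \<phi> x *\<^sub>R g e x))"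
    by (rule sum.cong[OF refl]) (simp only: wgi)
  moreover have "(LBINT x. (\<Sum>e\<in>Basis. (v \<bullet> e) *\<^sub>R (\<phi> x *\<^sub>R g e x)))
      = (\<Sum>e\<in>Basis. (v \<bullet> e) *\<^sub>R (LBINT x. \<phi> x *\<^sub>R g e x))"
    using Bochner_Integration.integral_sum[of Basis lborel "\<lambda>e x. (v \<bullet> e) *\<^sub>R (\<phi> x *\<^sub>R g e x)", OF integrable_scaleR_right[OF ig]]
    by (simp only: integral_scaleR_right)
  moreover have "(LBINT x. \<phi> x *\<^sub>R dir_deriv g v x) = (LBINT x. (\<Sum>e\<in>Basis. (v \<bullet> e) *\<^sub>R (\<phi> x *\<^sub>R g e x)))"
    by (simp add: dir_deriv_def scaleR_sum_right mult.commute)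
  ultimately show ?thesis by (simp only: scaleR_minus_right sum_negf)
qed

end

lemma bump_translate: "bump a b k (x - c) = bump (a + c) (b + c) k x"
  by (simp add: bump_def algebra_simps)

lemma bounded_segment_integrable:
  fixes h :: "'a::euclidean_space \<Rightarrow> 'b::euclidean_space" and f :: "'a \<Rightarrow> real"
  assumes f: "f \<in> borel_measurable borel" "\<And>x. \<bar>f x\<bar> \<le> B" and h: "integrable lborel h"
  shows "integrable (lborel \<Otimes>\<^sub>M lborel) (\<lambda>(s::real, x). f x *\<^sub>R indicator {0..1} s *\<^sub>R h (x + s *\<^sub>R v))"
proof (rule Bochner_Integration.integrable_bound)
  show "integrable (lborel \<Otimes>\<^sub>M lborel) (\<lambda>p. B *\<^sub>R (\<lambda>(s::real, x). indicator {0..1} s *\<^sub>R h (x + s *\<^sub>R v)) p)"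
    by (intro integrable_scaleR_right integrable_segment_average h)
  have [measurable]: "h \<in> borel_measurable borel" "f \<in> borel_measurable borel"
    using borel_measurable_integrable[OF h] f by simp_all
  show "(\<lambda>(s::real, x). f x *\<^sub>R indicator {0..1} s *\<^sub>R h (x + s *\<^sub>R v)) \<in> borel_measurable (lborel \<Otimes>\<^sub>M lborel)"
    by measurable
  have "\<bar>f x\<bar> * (\<bar>c\<bar> * norm y) \<le> \<bar>B\<bar> * (\<bar>c\<bar> * norm y)" for x c and y :: 'b
    using f(2)[of x] by (intro mult_right_mono) auto
  from this[of _ "indicator {0..1} _"]
  show "AE p in lborel \<Otimes>\<^sub>M lborel. norm (case p of (s::real, x) \<Rightarrow> f x *\<^sub>R indicator {0..1} s *\<^sub>R h (x + s *\<^sub>R v))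
    \<le> norm (B *\<^sub>R (case p of (s::real, x) \<Rightarrow> indicator {0..1} s *\<^sub>R h (x + s *\<^sub>R v)))"
    by (intro AE_I2) (simp add: abs_mult mult.assoc split_beta)
qed

lemma segment_average_swap:
  fixes h :: "'a::euclidean_space \<Rightarrow> 'b::euclidean_space" and f :: "'a \<Rightarrow> real"
  assumes f: "f \<in> borel_measurable borel" "\<And>x. \<bar>f x\<bar> \<le> B" and h: "integrable lborel h"
  shows "(LBINT x. f x *\<^sub>R segment_integral h v x)
    = (LBINT s. indicator {0..1::real} s *\<^sub>R (LBINT x. f x *\<^sub>R h (x + s *\<^sub>R v)))"
proof -
  have "(LBINT s. indicator {0..1::real} s *\<^sub>R (LBINT x. f x *\<^sub>R h (x + s *\<^sub>R v)))
    = (LBINT s. LINT x|lborel. f x *\<^sub>R indicator {0..1::real} s *\<^sub>R h (x + s *\<^sub>R v))"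
    by (simp only: scaleR_left_commute[of "f _"] integral_scaleR_right)
  then show ?thesis
    using lborel_pair.Fubini_integral[OF bounded_segment_integrable[OF f h, of v]] by (simp only: integral_scaleR_right)
qed

lemma segment_average_integrable:
  fixes h :: "'a::euclidean_space \<Rightarrow> 'b::euclidean_space"
  assumes h: "integrable lborel h"
  shows "integrable lborel (\<lambda>x. LINT s|lborel. indicator {0..1::real} s *\<^sub>R h (x + s *\<^sub>R v))"
  using lborel_pair.integrable_snd[OF integrable_segment_average[OF h, of v]] .

context
  fixes \<Omega> :: "'a::euclidean_space set" and P :: "'a \<Rightarrow> 'b::euclidean_space" and g
  assumes wg: "weak_gradient \<Omega> P g"
begin

lemmas P_meas = weak_gradientD(1)[OF wg]
lemmas P_bdd = weak_gradientD(2)[OF wg]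

text \<open>The weak fundamental theorem of calculus along \<open>v\<close>: move the translation
  onto the bump, write its increment as an integral over s of directional derivatives, integrate by
  parts for each s, and translate back.\<close>

lemma bump_difference_integral:
  assumes sub: "\<And>x s. x \<in> cbox a b \<Longrightarrow> 0 \<le> s \<Longrightarrow> s \<le> 1 \<Longrightarrow> x + s *\<^sub>R v \<in> \<Omega>"
  shows "(LBINT x. bump a b k x *\<^sub>R P (x + v)) - (LBINT x. bump a b k x *\<^sub>R P x)
    = (LBINT x. bump a b k x *\<^sub>R segment_integral (dir_deriv g v) v x)"
proof -
  note [measurable] = P_meas
  define \<phi> where "\<phi> = bump a b k"
  define d where "d x = frechet_derivative \<phi> (at x) v" for x
  \<comment> \<open>Smoothness and compact support of the bump are all that is read off here;
    membership of supports in \<Omega> is treated for each translate separately in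
    \<open>step\<close>.\<close>
  have tf: "test_function UNIV \<phi>" unfolding \<phi>_def by (rule test_function_bump) simp
  note tf = test_functionD[OF tf]
  have contd: "continuous_on UNIV d" unfolding d_def by (rule tf(5))
  have \<phi>m [measurable]: "\<phi> \<in> borel_measurable borel" using tf(1) by (rule borel_measurable_continuous_onI)
  have dm [measurable]: "d \<in> borel_measurable borel" using contd by (rule borel_measurable_continuous_onI)
  have \<phi>1: "\<bar>\<phi> x\<bar> \<le> 1" for x unfolding \<phi>_def using bump_nonneg bump_le_1 by (metis abs_of_nonneg)
  have dint: "integrable lborel d"
  proof -
    have "integrable lborel (\<lambda>x. d x *\<^sub>R (1::real))"
      by (rule integrable_compact_support[OF contd tf(3)]) (auto simp: d_def intro!: tf(7))
    then show ?thesis by simp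
  qed
  have der: "(\<phi> has_derivative frechet_derivative \<phi> (at x)) (at x)" for x
    using tf(2) frechet_derivative_works by blast
  have ftc: "\<phi> (x - v) - \<phi> x = - segment_integral d (- v) x" for x
  proof -
    have "((\<lambda>s. \<phi> (x + s *\<^sub>R (- v))) has_vector_derivative - d (x + s *\<^sub>R (- v))) (at s within {0..1})" for s :: real
    proof -
      have "((\<lambda>s. x + s *\<^sub>R (- v)) has_derivative (\<lambda>h. h *\<^sub>R (- v))) (at s within {0..1})"
        by (auto intro!: derivative_eq_intros)
      from has_derivative_compose[OF this der]
      have *: "((\<lambda>s. \<phi> (x + s *\<^sub>R (- v))) has_derivative (\<lambda>h. frechet_derivative \<phi> (at (x + s *\<^sub>R (- v))) (h *\<^sub>R (- v)))) (at s within {0..1})" .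
      have lin: "linear (frechet_derivative \<phi> (at y))" for y using tf(2) by (rule linear_frechet_derivative)
      show ?thesis using * unfolding has_vector_derivative_def linear_cmul[OF lin] linear_neg[OF lin] by (simp add: d_def)
    qed
    moreover have "continuous_on {0..1} (\<lambda>s::real. - d (x + s *\<^sub>R (- v)))"
      by (intro continuous_intros continuous_on_compose2[OF contd]) auto
    ultimately have "(LBINT s. indicator {0..1::real} s *\<^sub>R (- d (x + s *\<^sub>R (- v)))) = \<phi> (x + 1 *\<^sub>R (- v)) - \<phi> (x + 0 *\<^sub>R (- v))"
      by (intro integral_FTC_Icc) auto
    then show ?thesis by simp
  qed
  have step: "(LBINT x. d (x + s *\<^sub>R (- v)) *\<^sub>R P x) = - (LBINT x. \<phi> x *\<^sub>R dir_deriv g v (x + s *\<^sub>R v))"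
    if s: "0 \<le> s" "s \<le> 1" for s :: real
  proof -
    \<comment> \<open>A translate of a bump is the bump of the translated box, which lies in
      \<Omega> by \<open>sub\<close>.\<close>
    define \<psi> where "\<psi> = bump (a + s *\<^sub>R v) (b + s *\<^sub>R v) k"
    have \<psi>: "\<psi> x = \<phi> (x + s *\<^sub>R (- v))" for x using bump_translate[of a b k x "s *\<^sub>R v"] by (simp add: \<psi>_def \<phi>_def)
    have "cbox (a + s *\<^sub>R v) (b + s *\<^sub>R v) \<subseteq> \<Omega>"
    proof
      fix x assume "x \<in> cbox (a + s *\<^sub>R v) (b + s *\<^sub>R v)"
      then have "x - s *\<^sub>R v \<in> cbox a b" by (auto simp: mem_box inner_diff_left inner_add_left algebra_simps)
      from sub[OF this s] show "x \<in> \<Omega>" by simp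
    qed
    then have tf\<psi>: "test_function \<Omega> \<psi>" unfolding \<psi>_def by (rule test_function_bump)
    have "frechet_derivative \<psi> (at x) v = d (x + s *\<^sub>R (- v))" for x
    proof -
      have "((\<lambda>x. x + s *\<^sub>R (- v)) has_derivative (\<lambda>h. h)) (at x)" by (auto intro!: derivative_eq_intros)
      from has_derivative_compose[OF this der]
      have "(\<psi> has_derivative frechet_derivative \<phi> (at (x + s *\<^sub>R (- v)))) (at x)" by (simp add: \<psi>[abs_def])
      from frechet_derivative_at[OF this] show ?thesis by (simp add: d_def)
    qed
    then have "(LBINT x. d (x + s *\<^sub>R (- v)) *\<^sub>R P x) = - (LBINT x. \<psi> x *\<^sub>R dir_deriv g v x)"
      using weak_gradient_dir[OF wg tf\<psi>, of v] by simp
    also have "(LBINT x. \<psi> x *\<^sub>R dir_deriv g v x) = (LBINT x. \<psi> (x + s *\<^sub>R v) *\<^sub>R dir_deriv g v (x + s *\<^sub>R v))"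
      using dir_deriv_measurable[OF wg, of v]
      by (intro lborel_integral_translate[symmetric]) (auto simp: \<psi>[abs_def])
    finally show ?thesis by (simp add: \<psi>)
  qed
  obtain C where C: "\<And>x. norm (P x) \<le> C" using P_bdd by (auto simp: bounded_iff)
  have int1: "integrable lborel (\<lambda>x. \<phi> x *\<^sub>R P x)"
    by (rule integrable_compact_support[OF tf(1,3,6) P_meas P_bdd])
  have int2: "integrable lborel (\<lambda>x. \<phi> (x - v) *\<^sub>R P x)"
    using lborel_integrable_translate[OF integrable_compact_support[OF tf(1,3,6), of "\<lambda>x. P (x + v)"], of "- v"] P_bdd
    by (force simp: bounded_iff)
  have "(LBINT x. \<phi> x *\<^sub>R P (x + v)) = (LBINT x. \<phi> (x - v) *\<^sub>R P x)"
    using lborel_integral_translate[of "\<lambda>x. \<phi> x *\<^sub>R P (x + v)" "- v"] by simp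
  then have "(LBINT x. \<phi> x *\<^sub>R P (x + v)) - (LBINT x. \<phi> x *\<^sub>R P x)
      = (LBINT x. (\<phi> (x - v) - \<phi> x) *\<^sub>R P x)"
    using int1 int2 by (simp add: scaleR_diff_left)
  also have "\<dots> = - (LBINT x. segment_integral d (- v) x *\<^sub>R P x)"
    unfolding ftc by simp
  also have "(LBINT x. segment_integral d (- v) x *\<^sub>R P x)
      = (LBINT s. indicator {0..1::real} s *\<^sub>R (LBINT x. d (x + s *\<^sub>R (- v)) *\<^sub>R P x))"
  proof -
    let ?H = "\<lambda>(s::real) x. indicator {0..1} s *\<^sub>R d (x + s *\<^sub>R (- v))"
    have intH: "integrable (lborel \<Otimes>\<^sub>M lborel) (\<lambda>(s, x). ?H s x *\<^sub>R P x)"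
    proof (rule Bochner_Integration.integrable_bound)
      show "integrable (lborel \<Otimes>\<^sub>M lborel) (\<lambda>p. C * (case p of (s, x) \<Rightarrow> ?H s x))"
        using integrable_segment_average[OF dint, of "- v"] by (rule integrable_mult_right)
      show "(\<lambda>(s, x). ?H s x *\<^sub>R P x) \<in> borel_measurable (lborel \<Otimes>\<^sub>M lborel)" by measurable
      have "\<bar>y\<bar> * norm (P x) \<le> \<bar>C\<bar> * \<bar>y\<bar>" for x y
        using C[of x] by (subst mult.commute, intro mult_right_mono) auto
      then show "AE p in lborel \<Otimes>\<^sub>M lborel. norm (case p of (s, x) \<Rightarrow> ?H s x *\<^sub>R P x) \<le> norm (C * (case p of (s, x) \<Rightarrow> ?H s x))"
        by (intro AE_I2) (simp only: split_beta norm_scaleR norm_mult real_norm_def abs_mult)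
    qed
    have intS: "integrable lborel (\<lambda>s. ?H s x)" for x
      by (intro borel_integrable_compact continuous_intros continuous_on_compose2[OF contd]) auto
    have "(LBINT x. (LBINT s. ?H s x) *\<^sub>R P x) = (LBINT x. (LBINT s. ?H s x *\<^sub>R P x))"
      by (simp only: integral_scaleR_left[OF intS])
    also have "\<dots> = (LBINT s. (LBINT x. ?H s x *\<^sub>R P x))"
      by (rule lborel_pair.Fubini_integral[OF intH])
    also have "\<dots> = (LBINT s. indicator {0..1::real} s *\<^sub>R (LBINT x. d (x + s *\<^sub>R (- v)) *\<^sub>R P x))"
      by (simp only: real_scaleR_def scaleR_scaleR[symmetric] integral_scaleR_right)
    finally show ?thesis .
  qed
  also have "\<dots> = (LBINT s. indicator {0..1::real} s *\<^sub>R - (LBINT x. \<phi> x *\<^sub>R dir_deriv g v (x + s *\<^sub>R v)))"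
  proof (intro Bochner_Integration.integral_cong refl)
    fix s :: real
    show "indicator {0..1} s *\<^sub>R (LBINT x. d (x + s *\<^sub>R (- v)) *\<^sub>R P x)
      = indicator {0..1} s *\<^sub>R - (LBINT x. \<phi> x *\<^sub>R dir_deriv g v (x + s *\<^sub>R v))"
      using step[of s] by (cases "s \<in> {0..1}") simp_all
  qed
  also have "- \<dots> = (LBINT x. \<phi> x *\<^sub>R segment_integral (dir_deriv g v) v x)"
    using segment_average_swap[OF \<phi>m \<phi>1 dir_deriv_integrable[OF wg], of v v] by simp
  finally show ?thesis by (simp add: \<phi>_def)
qed

end

section \<open>Bounding increments by the gradient\<close>

lemma square_integrable_sum:
  fixes f :: "'i \<Rightarrow> 'a::euclidean_space \<Rightarrow> 'b::euclidean_space"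
  assumes "finite I" "\<And>i. i \<in> I \<Longrightarrow> f i \<in> borel_measurable borel"
    "\<And>i. i \<in> I \<Longrightarrow> integrable lborel (\<lambda>x. (norm (f i x))\<^sup>2)"
  shows "integrable lborel (\<lambda>x. (norm (\<Sum>i\<in>I. f i x))\<^sup>2)"
  using assms
proof (induction I)
  case (insert i I)
  have [measurable]: "f j \<in> borel_measurable borel" if "j \<in> insert i I" for j using insert.prems(1) that by blast
  show ?case
  proof (rule Bochner_Integration.integrable_bound)
    show "integrable lborel (\<lambda>x. 2 * (norm (f i x))\<^sup>2 + 2 * (norm (\<Sum>i\<in>I. f i x))\<^sup>2)"
      using insert by (intro Bochner_Integration.integrable_add integrable_mult_right) auto
    show "(\<lambda>x. (norm (\<Sum>i\<in>insert i I. f i x))\<^sup>2) \<in> borel_measurable lborel" by measurable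
    have "(norm (a + b))\<^sup>2 \<le> 2 * (norm a)\<^sup>2 + 2 * (norm b)\<^sup>2" for a b :: 'b
    proof -
      have "(norm (a + b))\<^sup>2 \<le> (norm a + norm b)\<^sup>2" by (intro power_mono norm_triangle_ineq) simp
      also have "\<dots> \<le> 2 * (norm a)\<^sup>2 + 2 * (norm b)\<^sup>2"
        using sum_squares_bound[of "norm a" "norm b"] by (simp add: power2_sum)
      finally show ?thesis .
    qed
    then show "AE x in lborel. norm ((norm (\<Sum>i\<in>insert i I. f i x))\<^sup>2) \<le> norm (2 * (norm (f i x))\<^sup>2 + 2 * (norm (\<Sum>i\<in>I. f i x))\<^sup>2)"
      using insert.hyps by simp
  qed
qed simp

context
  fixes \<Omega> :: "'a::euclidean_space set" and P :: "'a \<Rightarrow> 'b::euclidean_space" and g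
  assumes wg: "weak_gradient \<Omega> P g"
begin

lemma dir_deriv_scale: "dir_deriv g (c *\<^sub>R v) x = c *\<^sub>R dir_deriv g v x"
  by (simp add: dir_deriv_def scaleR_sum_right)

lemma dir_deriv_square_integrable: "integrable lborel (\<lambda>x. (norm (dir_deriv g v x))\<^sup>2)"
  unfolding dir_deriv_def
proof (rule square_integrable_sum)
  fix e :: 'a assume e: "e \<in> Basis"
  show "(\<lambda>x. (v \<bullet> e) *\<^sub>R g e x) \<in> borel_measurable borel"
    by (intro borel_measurable_scaleR borel_measurable_const weak_gradientD(3)[OF wg e])
  show "integrable lborel (\<lambda>x. (norm ((v \<bullet> e) *\<^sub>R g e x))\<^sup>2)"
    unfolding norm_scaleR power_mult_distrib using weak_gradientD(5)[OF wg e] by (rule integrable_mult_right)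
qed (rule finite_Basis)

text \<open>The difference of the two sides has vanishing integral against every bump by
  \<open>bump_difference_integral\<close>. The null set depends on \<open>v\<close>, which is fixed
  throughout.\<close>

lemma AE_increment:
  assumes V: "open V" and sub: "\<And>x s. x \<in> V \<Longrightarrow> 0 \<le> s \<Longrightarrow> s \<le> 1 \<Longrightarrow> x + s *\<^sub>R v \<in> \<Omega>"
  shows "AE x in lborel. x \<in> V \<longrightarrow>
    P (x + v) - P x = segment_integral (dir_deriv g v) v x"
proof -
  note [measurable] = weak_gradientD(1)[OF wg] dir_deriv_measurable[OF wg]
  define A where "A x = segment_integral (dir_deriv g v) v x" for x
  define f where "f x = P (x + v) - P x - A x" for x
  have A: "integrable lborel A" unfolding A_def by (rule segment_average_integrable[OF dir_deriv_integrable[OF wg]])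
  have [measurable]: "A \<in> borel_measurable borel" using borel_measurable_integrable[OF A] by simp
  obtain C where C: "\<And>x. norm (P x) \<le> C" using weak_gradientD(2)[OF wg] by (auto simp: bounded_iff)
  have bnd: "norm (P (x + v) - P x) \<le> 2 * C" for x
    using norm_triangle_ineq4[of "P (x + v)" "P x"] C[of x] C[of "x + v"] by simp
  have intB: "integrable lborel (\<lambda>x. \<phi> x *\<^sub>R (P (x + v) - P x))" "integrable lborel (\<lambda>x. \<phi> x *\<^sub>R A x)"
    if [measurable]: "\<phi> \<in> borel_measurable borel" and \<phi>: "\<And>x. \<bar>\<phi> x\<bar> \<le> indicator (cbox a b) x" for \<phi> a b
  proof -
    show "integrable lborel (\<lambda>x. \<phi> x *\<^sub>R (P (x + v) - P x))"
    proof (rule Bochner_Integration.integrable_bound)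
      show "integrable lborel (\<lambda>x. indicator (cbox a b) x * (2 * C))"
        by (intro integrable_mult_left integrable_real_indicator) (auto simp: emeasure_lborel_cbox_eq)
      show "AE x in lborel. norm (\<phi> x *\<^sub>R (P (x + v) - P x)) \<le> norm (indicator (cbox a b) x * (2 * C))"
      proof (rule AE_I2)
        fix x
        have "\<bar>\<phi> x\<bar> * norm (P (x + v) - P x) \<le> indicator (cbox a b) x * (2 * C)"
          by (intro mult_mono \<phi> bnd) auto
        also have "\<dots> \<le> \<bar>indicator (cbox a b) x * (2 * C)\<bar>" by (rule abs_ge_self)
        finally show "norm (\<phi> x *\<^sub>R (P (x + v) - P x)) \<le> norm (indicator (cbox a b) x * (2 * C))" by simp
      qed
    qed measurable
    show "integrable lborel (\<lambda>x. \<phi> x *\<^sub>R A x)"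
      using \<phi> A by (intro integrable_bounded_mult[where B = 1]) (auto intro: order_trans indicator_le_1)
  qed
  have "AE x in lborel. x \<in> V \<longrightarrow> f x = 0"
  proof (rule AE_zero_of_box_integrals[OF V])
    show "f \<in> borel_measurable borel" unfolding f_def by measurable
    fix a b :: 'a and k :: nat assume ab: "cbox a b \<subseteq> V"
    show "integrable lborel (\<lambda>x. indicator (cbox a b) x *\<^sub>R f x)"
      using intB[of "indicator (cbox a b)" a b] by (simp add: f_def scaleR_diff_right)
    have m: "bump a b k \<in> borel_measurable borel"
      using Ck_continuous[OF Ck_bump] by (rule borel_measurable_continuous_onI)
    have bl: "\<bar>bump a b k x\<bar> \<le> indicator (cbox a b) x" for x
      using bump_nonneg[of a b k x] bump_le_1[of a b k x] bump_outside[of x a b k] box_subset_cbox[of a b]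
      by (cases "x \<in> box a b") (auto simp: indicator_def)
    have i: "integrable lborel (\<lambda>x. bump a b k x *\<^sub>R P y x)" if "\<And>x. norm (P y x) \<le> C" "P y \<in> borel_measurable borel"
      for P :: "'a \<Rightarrow> 'a \<Rightarrow> 'b" and y
    proof (rule integrable_compact_support[OF Ck_continuous[OF Ck_bump] compact_cbox[of a b]])
      show "bump a b k x = 0" if "x \<notin> cbox a b" for x using bl[of x] that by simp
      show "bounded (range (P y))" using that(1) by (auto simp: bounded_iff)
    qed (rule that)
    have "(LBINT x. bump a b k x *\<^sub>R f x)
      = (LBINT x. bump a b k x *\<^sub>R (P (x + v) - P x)) - (LBINT x. bump a b k x *\<^sub>R A x)"
      using intB[OF m bl] by (simp add: f_def scaleR_diff_right)
    also have "(LBINT x. bump a b k x *\<^sub>R (P (x + v) - P x))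
      = (LBINT x. bump a b k x *\<^sub>R P (x + v)) - (LBINT x. bump a b k x *\<^sub>R P x)"
      using i[of "\<lambda>y x. P (x + y)" v] i[of "\<lambda>y x. P x" v] C by (simp add: scaleR_diff_right)
    also have "\<dots> = (LBINT x. bump a b k x *\<^sub>R A x)"
      unfolding A_def using ab sub by (intro bump_difference_integral[OF wg]) blast
    finally show "(LBINT x. bump a b k x *\<^sub>R f x) = 0" by simp
  qed
  then show ?thesis by (simp add: f_def A_def)
qed

lemma AE_increment_bound:
  assumes V: "open V" and sub: "\<And>x s. x \<in> V \<Longrightarrow> 0 \<le> s \<Longrightarrow> s \<le> 1 \<Longrightarrow> x + s *\<^sub>R v \<in> \<Omega>"
  shows "AE x in lborel. x \<in> V \<longrightarrow>
    ennreal (norm (P (x + v) - P x)) \<le> (\<integral>\<^sup>+s. indicator {0..1::real} s * ennreal (norm (dir_deriv g v (x + s *\<^sub>R v))) \<partial>lborel)"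
proof -
  have "AE x in lborel. x \<in> V \<longrightarrow>
    P (x + v) - P x = segment_integral (dir_deriv g v) v x"
    by (rule AE_increment[OF V]) (rule sub)
  then show ?thesis
  proof eventually_elim
    case (elim x)
    let ?f = "\<lambda>s::real. indicator {0..1::real} s *\<^sub>R dir_deriv g v (x + s *\<^sub>R v)"
    have "ennreal (norm (LBINT s. ?f s)) \<le> (\<integral>\<^sup>+s. ennreal (norm (?f s)) \<partial>lborel)"
    proof (cases "integrable lborel ?f")
      case True
      then show ?thesis by (rule integral_norm_bound_ennreal)
    next
      case False
      \<comment> \<open>A non-integrable function has Bochner integral 0, so the bound still
        holds.\<close>
      then have "(LBINT s. ?f s) = 0" by (rule not_integrable_integral_eq)
      then show ?thesis by simp
    qed
    also have "\<dots> = (\<integral>\<^sup>+s. indicator {0..1::real} s * ennreal (norm (dir_deriv g v (x + s *\<^sub>R v))) \<partial>lborel)"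
      by (intro nn_integral_cong) (auto simp: indicator_def)
    finally show ?case using elim by simp
  qed
qed

text \<open>Tonelli: each translate of \<open>h\<close> has the same integral, and s runs over an
  interval of length 1.\<close>

lemma nn_integral_segment_average:
  fixes h :: "'a \<Rightarrow> ennreal" and v :: 'a
  assumes [measurable]: "h \<in> borel_measurable borel"
  shows "(\<integral>\<^sup>+x. \<integral>\<^sup>+s. indicator {0..1::real} s * h (x + s *\<^sub>R v) \<partial>lborel \<partial>lborel) = (\<integral>\<^sup>+x. h x \<partial>lborel)"
proof -
  have "(\<integral>\<^sup>+x. \<integral>\<^sup>+s. indicator {0..1::real} s * h (x + s *\<^sub>R v) \<partial>lborel \<partial>lborel)
    = (\<integral>\<^sup>+s. \<integral>\<^sup>+x. indicator {0..1::real} s * h (x + s *\<^sub>R v) \<partial>lborel \<partial>lborel)"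
    by (rule lborel_pair.Fubini'[symmetric]) measurable
  also have "\<dots> = (\<integral>\<^sup>+s. (\<integral>\<^sup>+x. h x \<partial>lborel) * indicator {0..1::real} s \<partial>lborel)"
    by (simp add: nn_integral_cmult lborel_nn_integral_translate mult.commute)
  also have "\<dots> = (\<integral>\<^sup>+x. h x \<partial>lborel)" by (subst nn_integral_cmult_indicator) auto
  finally show ?thesis .
qed

text \<open>Cauchy-Schwarz along the unit parameter interval, followed by averaging over
  translates.\<close>

lemma increment_square_bound:
  assumes V: "open V" and sub: "\<And>x s. x \<in> V \<Longrightarrow> 0 \<le> s \<Longrightarrow> s \<le> 1 \<Longrightarrow> x + s *\<^sub>R v \<in> \<Omega>"
  shows "(\<integral>\<^sup>+x. indicator V x * ennreal ((norm (P (x + v) - P x))\<^sup>2) \<partial>lborel) \<le> (\<integral>\<^sup>+x. ennreal ((norm (dir_deriv g v x))\<^sup>2) \<partial>lborel)"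
proof -
  note [measurable] = weak_gradientD(1)[OF wg] dir_deriv_measurable[OF wg]
  have inc: "AE x in lborel. x \<in> V \<longrightarrow>
    ennreal (norm (P (x + v) - P x)) \<le> (\<integral>\<^sup>+s. indicator {0..1::real} s * ennreal (norm (dir_deriv g v (x + s *\<^sub>R v))) \<partial>lborel)"
    by (rule AE_increment_bound[OF V]) (rule sub)
  have "(\<integral>\<^sup>+x. indicator V x * ennreal ((norm (P (x + v) - P x))\<^sup>2) \<partial>lborel)
    \<le> (\<integral>\<^sup>+x. \<integral>\<^sup>+s. indicator {0..1::real} s * ennreal ((norm (dir_deriv g v (x + s *\<^sub>R v)))\<^sup>2) \<partial>lborel \<partial>lborel)"
  proof (rule nn_integral_mono_AE)
    show "AE x in lborel. indicator V x * ennreal ((norm (P (x + v) - P x))\<^sup>2)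
      \<le> (\<integral>\<^sup>+s. indicator {0..1::real} s * ennreal ((norm (dir_deriv g v (x + s *\<^sub>R v)))\<^sup>2) \<partial>lborel)"
      using inc
    proof eventually_elim
      case (elim x)
      \<comment> \<open>The indicator is doubled below so that Cauchy-Schwarz applies to the pair of
        the indicator and the restricted integrand; the first factor integrates to 1.\<close>
      let ?N = "\<lambda>s::real. ennreal (norm (dir_deriv g v (x + s *\<^sub>R v)))"
      have "(\<integral>\<^sup>+s. indicator {0..1::real} s * ?N s \<partial>lborel)\<^sup>2
        = (\<integral>\<^sup>+s. indicator {0..1::real} s * (indicator {0..1} s * ?N s) \<partial>lborel)\<^sup>2"
        by (intro arg_cong[where f = "\<lambda>x. x\<^sup>2"] nn_integral_cong) (auto simp: indicator_def)
      also have "\<dots> \<le> (\<integral>\<^sup>+s. (indicator {0..1::real} s)\<^sup>2 \<partial>lborel) * (\<integral>\<^sup>+s. (indicator {0..1::real} s * ?N s)\<^sup>2 \<partial>lborel)"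
        by (rule Cauchy_Schwarz_nn_integral) measurable
      also have "(\<integral>\<^sup>+s. (indicator {0..1::real} s)\<^sup>2 \<partial>lborel) = (\<integral>\<^sup>+s. indicator {0..1::real} s \<partial>lborel)"
        by (intro nn_integral_cong) (auto simp: indicator_def)
      also have "\<dots> = 1" by simp
      also have "1 * (\<integral>\<^sup>+s. (indicator {0..1::real} s * ?N s)\<^sup>2 \<partial>lborel)
        = (\<integral>\<^sup>+s. indicator {0..1::real} s * ennreal ((norm (dir_deriv g v (x + s *\<^sub>R v)))\<^sup>2) \<partial>lborel)"
        unfolding mult_1 by (intro nn_integral_cong) (auto simp: indicator_def ennreal_power)
      finally have "(\<integral>\<^sup>+s. indicator {0..1::real} s * ?N s \<partial>lborel)\<^sup>2 \<le> \<dots>" .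
      moreover have "ennreal ((norm (P (x + v) - P x))\<^sup>2) \<le> (\<integral>\<^sup>+s. indicator {0..1::real} s * ?N s \<partial>lborel)\<^sup>2" if "x \<in> V"
        using elim that by (simp add: ennreal_power[symmetric] power_mono)
      ultimately show ?case by (cases "x \<in> V") (auto intro: order_trans)
    qed
  qed
  also have "\<dots> = (\<integral>\<^sup>+x. ennreal ((norm (dir_deriv g v x))\<^sup>2) \<partial>lborel)"
    by (rule nn_integral_segment_average) measurable
  finally show ?thesis .
qed

text \<open>A truncated Chebyshev inequality: slopes of at most 1/(4t) contribute at most 1/4 to an
  increment over time t, so a jump of 1/2 draws at least 1/4 from larger slopes.\<close>

lemma large_increment_measure:
  assumes V: "open V" and sub: "\<And>x s. x \<in> V \<Longrightarrow> 0 \<le> s \<Longrightarrow> s \<le> 1 \<Longrightarrow> x + s *\<^sub>R (t *\<^sub>R v) \<in> \<Omega>" and t: "t > 0"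
  shows "emeasure lborel {x\<in>V. 1/2 \<le> norm (P (x + t *\<^sub>R v) - P x)}
    \<le> ennreal (16 * t\<^sup>2 * (LBINT x. indicator {x. norm (dir_deriv g v x) > 1 / (4 * t)} x * (norm (dir_deriv g v x))\<^sup>2))"
proof -
  note [measurable] = weak_gradientD(1)[OF wg] dir_deriv_measurable[OF wg]
  define G where "G x = norm (dir_deriv g v x)" for x
  define H where "H x = indicator {x. G x > 1 / (4 * t)} x * (G x)\<^sup>2" for x
  have [measurable]: "G \<in> borel_measurable borel" unfolding G_def by measurable
  have [measurable]: "H \<in> borel_measurable borel" unfolding H_def by measurable
  have H0: "0 \<le> H x" for x by (simp add: H_def)
  have Hint: "integrable lborel H"
  proof (rule Bochner_Integration.integrable_bound[OF dir_deriv_square_integrable[of v]])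
    show "AE x in lborel. norm (H x) \<le> norm ((norm (dir_deriv g v x))\<^sup>2)" by (auto simp: H_def G_def indicator_def)
  qed measurable
  have inc: "AE x in lborel. x \<in> V \<longrightarrow>
    ennreal (norm (P (x + t *\<^sub>R v) - P x))
      \<le> (\<integral>\<^sup>+s. indicator {0..1::real} s * ennreal (norm (dir_deriv g (t *\<^sub>R v) (x + s *\<^sub>R (t *\<^sub>R v)))) \<partial>lborel)"
    by (rule AE_increment_bound[OF V]) (rule sub)
  \<comment> \<open>Above the level 1/(4t) one has 1 \<le> 4 t G, so tG is at most 4 t^2 G^2; below
    it, tG is at most 1/4.\<close>
  have key: "t * G y \<le> 1/4 + 4 * t\<^sup>2 * H y" for y
  proof (cases "G y > 1 / (4 * t)")
    case True
    then have "1 \<le> 4 * t * G y" using t by (simp add: field_simps)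
    then have "t * G y * 1 \<le> t * G y * (4 * t * G y)" using t by (intro mult_left_mono) (auto simp: G_def)
    then show ?thesis using True by (simp add: H_def power2_eq_square mult_ac)
  next
    case False
    then show ?thesis using t by (simp add: H_def field_simps)
  qed
  have "{x\<in>V. 1/2 \<le> norm (P (x + t *\<^sub>R v) - P x)} \<in> sets lborel" using V by measurable
  then have "emeasure lborel {x\<in>V. 1/2 \<le> norm (P (x + t *\<^sub>R v) - P x)}
    = (\<integral>\<^sup>+x. indicator {x\<in>V. 1/2 \<le> norm (P (x + t *\<^sub>R v) - P x)} x \<partial>lborel)" by simp
  also have "\<dots> \<le> (\<integral>\<^sup>+x. \<integral>\<^sup>+s. indicator {0..1::real} s * ennreal (16 * t\<^sup>2 * H (x + s *\<^sub>R (t *\<^sub>R v))) \<partial>lborel \<partial>lborel)"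
  proof (rule nn_integral_mono_AE)
    show "AE x in lborel. indicator {x\<in>V. 1/2 \<le> norm (P (x + t *\<^sub>R v) - P x)} x
      \<le> (\<integral>\<^sup>+s. indicator {0..1::real} s * ennreal (16 * t\<^sup>2 * H (x + s *\<^sub>R (t *\<^sub>R v))) \<partial>lborel)"
      using inc
    proof eventually_elim
      case (elim x)
      let ?y = "\<lambda>s::real. x + s *\<^sub>R (t *\<^sub>R v)"
      have "1 \<le> (\<integral>\<^sup>+s. indicator {0..1::real} s * ennreal (16 * t\<^sup>2 * H (?y s)) \<partial>lborel)"
        if x: "x \<in> V" "1/2 \<le> norm (P (x + t *\<^sub>R v) - P x)"
      proof -
        have "ennreal (1/2) \<le> ennreal (norm (P (x + t *\<^sub>R v) - P x))" using x by (intro ennreal_leI)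
        also have "\<dots> \<le> (\<integral>\<^sup>+s. indicator {0..1::real} s * ennreal (norm (dir_deriv g (t *\<^sub>R v) (?y s))) \<partial>lborel)"
          using elim x by simp
        also have "\<dots> \<le> (\<integral>\<^sup>+s. ennreal (1/4) * indicator {0..1::real} s + ennreal (1/4) * (indicator {0..1::real} s * ennreal (16 * t\<^sup>2 * H (?y s))) \<partial>lborel)"
        proof (rule nn_integral_mono)
          fix s :: real
          have "ennreal (norm (dir_deriv g (t *\<^sub>R v) (?y s))) \<le> ennreal (1/4 + 4 * t\<^sup>2 * H (?y s))"
            using key[of "?y s"] t by (intro ennreal_leI) (simp add: dir_deriv_scale G_def)
          also have "\<dots> = ennreal (1/4) + ennreal (1/4) * ennreal (16 * t\<^sup>2 * H (?y s))"
            using H0[of "?y s"] by (subst ennreal_plus) (auto simp: ennreal_mult[symmetric])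
          finally show "indicator {0..1::real} s * ennreal (norm (dir_deriv g (t *\<^sub>R v) (?y s)))
            \<le> ennreal (1/4) * indicator {0..1::real} s + ennreal (1/4) * (indicator {0..1::real} s * ennreal (16 * t\<^sup>2 * H (?y s)))"
            by (cases "s \<in> {0..1}") simp_all
        qed
        also have "\<dots> = ennreal (1/4) + ennreal (1/4) * (\<integral>\<^sup>+s. indicator {0..1::real} s * ennreal (16 * t\<^sup>2 * H (?y s)) \<partial>lborel)"
          by (subst nn_integral_add) (auto simp: nn_integral_cmult)
        finally have *: "ennreal (1/2) \<le> ennreal (1/4) + ennreal (1/4) * (\<integral>\<^sup>+s. indicator {0..1::real} s * ennreal (16 * t\<^sup>2 * H (?y s)) \<partial>lborel)" .
        \<comment> \<open>From 1/2 \<le> 1/4 + r/4 follows 1 \<le> r; the constant 16 = 4 * 4 was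
          chosen for this. The case distinction covers an infinite integral.\<close>
        show ?thesis
        proof (cases "\<integral>\<^sup>+s. indicator {0..1::real} s * ennreal (16 * t\<^sup>2 * H (?y s)) \<partial>lborel")
          case (real r)
          have "ennreal (1/4) + ennreal (1/4) * ennreal r = ennreal (1/4 + 1/4 * r)"
            using real(1) by (subst ennreal_plus) (auto simp only: ennreal_mult)
          with * real have "ennreal (1/2) \<le> ennreal (1/4 + 1/4 * r)" by (simp only:)
          then have "1/2 \<le> 1/4 + 1/4 * r" using real(1) by (subst (asm) ennreal_le_iff) auto
          with real show ?thesis by simp
        qed simp
      qed
      then show ?case by (auto simp: indicator_def[of "{x\<in>V. _ x}"])
    qed
  qed
  also have "\<dots> = (\<integral>\<^sup>+x. ennreal (16 * t\<^sup>2 * H x) \<partial>lborel)"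
    by (rule nn_integral_segment_average) measurable
  also have "\<dots> = ennreal (16 * t\<^sup>2 * (LBINT x. H x))"
    using Hint H0 by (subst nn_integral_eq_integral) auto
  finally show ?thesis by (simp add: H_def G_def)
qed

text \<open>At each point the level 2^k/4 eventually exceeds the fixed slope, and the full square
  dominates. This improves O(4^-k) to o(4^-k).\<close>

lemma dir_deriv_tail_tendsto:
  "(\<lambda>k. LINT x|lborel. indicator {x. norm (dir_deriv g v x) > 1 / (4 * (1 / 2 ^ k))} x * (norm (dir_deriv g v x))\<^sup>2) \<longlonglongrightarrow> 0"
proof -
  note [measurable] = weak_gradientD(1)[OF wg] dir_deriv_measurable[OF wg]
  have "(\<lambda>k. LINT x|lborel. indicator {x. norm (dir_deriv g v x) > 1 / (4 * (1 / 2 ^ k))} x * (norm (dir_deriv g v x))\<^sup>2)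
    \<longlonglongrightarrow> (LBINT x::'a. 0::real)"
  proof (rule integral_dominated_convergence)
    show "integrable lborel (\<lambda>x. (norm (dir_deriv g v x))\<^sup>2)" by (rule dir_deriv_square_integrable)
    show "AE x in lborel. (\<lambda>k. indicator {x. norm (dir_deriv g v x) > 1 / (4 * (1 / 2 ^ k))} x * (norm (dir_deriv g v x))\<^sup>2) \<longlonglongrightarrow> 0"
    proof (rule AE_I2)
      fix x
      have "\<forall>\<^sub>F k in sequentially. 4 * norm (dir_deriv g v x) \<le> real k"
      proof -
        obtain N where N: "4 * norm (dir_deriv g v x) \<le> real N" using real_arch_simple by blast
        show ?thesis using eventually_ge_at_top[of N] by eventually_elim (use N in linarith)
      qed
      then have "\<forall>\<^sub>F k in sequentially. indicator {x. norm (dir_deriv g v x) > 1 / (4 * (1 / 2 ^ k))} x * (norm (dir_deriv g v x))\<^sup>2 = 0"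
      proof eventually_elim
        case (elim k)
        have "real k \<le> 2 ^ k" using of_nat_less_two_power[of k, where 'a = real] by simp
        then have "norm (dir_deriv g v x) \<le> 2 ^ k / 4" using elim by linarith
        then show ?case by (simp add: indicator_def)
      qed
      then show "(\<lambda>k. indicator {x. norm (dir_deriv g v x) > 1 / (4 * (1 / 2 ^ k))} x * (norm (dir_deriv g v x))\<^sup>2) \<longlonglongrightarrow> 0"
        by (rule tendsto_eventually)
    qed
    show "AE x in lborel. norm (indicator {x. norm (dir_deriv g v x) > 1 / (4 * (1 / 2 ^ k))} x * (norm (dir_deriv g v x))\<^sup>2) \<le> (norm (dir_deriv g v x))\<^sup>2" for k
      by (auto simp: indicator_def)
  qed measurable
  then show ?thesis by simp
qed

text \<open>With t = 2^-k the factor 4^k cancels t^2, leaving 16 times the tail of the gradient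
  energy.\<close>

lemma large_increment_dyadic:
  assumes U: "open U" "convex U" "U \<subseteq> \<Omega>"
  shows "(\<lambda>k. 4 ^ k * measure lborel {x\<in>U. x + (1 / 2 ^ k) *\<^sub>R v \<in> U \<and> 1/2 \<le> norm (P (x + (1 / 2 ^ k) *\<^sub>R v) - P x)}) \<longlonglongrightarrow> 0"
    and "emeasure lborel {x\<in>U. x + (1 / 2 ^ k) *\<^sub>R v \<in> U \<and> 1/2 \<le> norm (P (x + (1 / 2 ^ k) *\<^sub>R v) - P x)} < \<infinity>"
proof -
  let ?T = "\<lambda>k. LINT x|lborel. indicator {x. norm (dir_deriv g v x) > 1 / (4 * (1 / 2 ^ k))} x * (norm (dir_deriv g v x))\<^sup>2"
  let ?B = "\<lambda>k. {x\<in>U. x + (1 / 2 ^ k) *\<^sub>R v \<in> U \<and> 1/2 \<le> norm (P (x + (1 / 2 ^ k) *\<^sub>R v) - P x)}"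
  have *: "emeasure lborel (?B k) \<le> ennreal (16 * (1 / 2 ^ k)\<^sup>2 * ?T k)" for k
  proof -
    \<comment> \<open>Both end points lie in the convex \<open>U\<close>, hence so does the segment,
      as the increment formula demands.\<close>
    let ?V = "U \<inter> (\<lambda>x. x + (1 / 2 ^ k) *\<^sub>R v) -` U"
    have "open ?V" using U by (intro open_Int open_vimage continuous_intros)
    moreover have "x + s *\<^sub>R ((1 / 2 ^ k) *\<^sub>R v) \<in> \<Omega>" if "x \<in> ?V" "0 \<le> s" "s \<le> 1" for x s
    proof -
      have "(1 - s) *\<^sub>R x + s *\<^sub>R (x + (1 / 2 ^ k) *\<^sub>R v) \<in> U" using that U(2) by (intro convexD) auto
      then show ?thesis using U(3) by (auto simp: algebra_simps)
    qed
    ultimately have "emeasure lborel {x\<in>?V. 1/2 \<le> norm (P (x + (1 / 2 ^ k) *\<^sub>R v) - P x)} \<le> ennreal (16 * (1 / 2 ^ k)\<^sup>2 * ?T k)"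
      by (rule large_increment_measure) auto
    also have "{x\<in>?V. 1/2 \<le> norm (P (x + (1 / 2 ^ k) *\<^sub>R v) - P x)} = ?B k" by auto
    finally show ?thesis .
  qed
  show "emeasure lborel (?B k) < \<infinity>" using *[of k] by (rule le_less_trans) simp
  have T0: "0 \<le> ?T k" for k by (intro Bochner_Integration.integral_nonneg) auto
  have "4 ^ k * measure lborel (?B k) \<le> 16 * ?T k" for k
  proof -
    have "measure lborel (?B k) \<le> 16 * (1 / 2 ^ k)\<^sup>2 * ?T k"
      using *[of k] T0[of k] unfolding measure_def by (intro enn2real_leI) auto
    then have "4 ^ k * measure lborel (?B k) \<le> 4 ^ k * (16 * (1 / 2 ^ k)\<^sup>2 * ?T k)" by (intro mult_left_mono) auto
    also have "4 ^ k * (16 * (1 / 2 ^ k)\<^sup>2 * ?T k) = 16 * ?T k"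
      by (simp add: power_divide power_mult[symmetric] power2_eq_square power_mult_distrib[symmetric])
    finally show ?thesis .
  qed
  then have le: "\<forall>\<^sub>F k in sequentially. 4 ^ k * measure lborel (?B k) \<le> 16 * ?T k"
    by (intro always_eventually allI)
  have lim: "(\<lambda>k. 16 * ?T k) \<longlonglongrightarrow> 0" using tendsto_mult_left[OF dir_deriv_tail_tendsto, of 16] by simp
  have nn: "\<forall>\<^sub>F k in sequentially. 0 \<le> 4 ^ k * measure lborel (?B k)"
    by (intro always_eventually allI mult_nonneg_nonneg measure_nonneg zero_le_power) simp
  show "(\<lambda>k. 4 ^ k * measure lborel (?B k)) \<longlonglongrightarrow> 0"
    by (rule tendsto_sandwich[OF nn le tendsto_const lim])
qed

end

subsection \<open>Continuity of translations\<close>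

text \<open>Openness gives only one-sided convergence: a point of \<open>T\<close> stays in
  \<open>T\<close> under small shifts. This controls the loss, and since both indicators have the
  same integral, the gain equals the loss.\<close>

lemma indicator_open_translation:
  fixes T :: "'a::euclidean_space set" and c :: "nat \<Rightarrow> 'a"
  assumes T: "open T" "emeasure lborel T < \<infinity>" and c: "c \<longlonglongrightarrow> 0"
  shows "(\<lambda>n. LINT x|lborel. \<bar>indicator T (x + c n) - indicator T x :: real\<bar>) \<longlonglongrightarrow> 0"
proof -
  let ?i = "indicator T :: 'a \<Rightarrow> real"
  have int: "integrable lborel ?i" using T by (intro integrable_real_indicator) auto
  have intc: "integrable lborel (\<lambda>x. ?i (x + c n))" for n by (rule lborel_integrable_translate[OF int])
  have [measurable]: "T \<in> sets borel" using T by simp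
  have lim: "(\<lambda>n. LINT x|lborel. max 0 (?i x - ?i (x + c n))) \<longlonglongrightarrow> (LBINT x::'a. 0)"
  proof (rule integral_dominated_convergence[OF _ _ int])
    show "AE x in lborel. (\<lambda>n. max 0 (?i x - ?i (x + c n))) \<longlonglongrightarrow> 0"
    proof (rule AE_I2)
      fix x
      have "\<forall>\<^sub>F n in sequentially. max 0 (?i x - ?i (x + c n)) = 0"
      proof (cases "x \<in> T")
        case True
        have "(\<lambda>n. x + c n) \<longlonglongrightarrow> x" using tendsto_add[OF tendsto_const[of x] c] by simp
        then have "\<forall>\<^sub>F n in sequentially. x + c n \<in> T" using T(1) True by (rule topological_tendstoD)
        then show ?thesis by eventually_elim (use True in simp)
      qed (simp add: indicator_def)
      then show "(\<lambda>n. max 0 (?i x - ?i (x + c n))) \<longlonglongrightarrow> 0" by (rule tendsto_eventually)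
    qed
    show "AE x in lborel. norm (max 0 (?i x - ?i (x + c n))) \<le> ?i x" for n
      by (intro AE_I2) (auto simp: indicator_def)
  qed measurable
  have "(LBINT x. \<bar>?i (x + c n) - ?i x\<bar>) = 2 * (LBINT x. max 0 (?i x - ?i (x + c n)))" for n
  proof -
    have i: "integrable lborel (\<lambda>x. max 0 (?i x - ?i (x + c n)))" using int intc by (intro integrable_max) auto
    \<comment> \<open>Pointwise, |p - q| = 2 max(0, q - p) + (p - q), and the last term integrates
      to 0.\<close>
    have "(LBINT x. \<bar>?i (x + c n) - ?i x\<bar>) = (LBINT x. 2 * max 0 (?i x - ?i (x + c n)) + (?i (x + c n) - ?i x))"
      by (intro Bochner_Integration.integral_cong refl) (auto simp: indicator_def)
    also have "\<dots> = 2 * (LBINT x. max 0 (?i x - ?i (x + c n))) + ((LBINT x. ?i (x + c n)) - (LBINT x. ?i x))"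
      using i int intc[of n] by simp
    also have "(LBINT x. ?i (x + c n)) = (LBINT x. ?i x)" by (rule lborel_integral_translate) measurable
    finally show ?thesis by simp
  qed
  with tendsto_mult_left[OF lim, of 2] show ?thesis by simp
qed

text \<open>Induction over integrable functions. Outer regularity reduces indicators to those of
  open sets; sums and dominated limits follow from the triangle inequality.\<close>

lemma L1_translation:
  fixes f :: "'a::euclidean_space \<Rightarrow> 'b::euclidean_space" and c :: "nat \<Rightarrow> 'a"
  assumes f: "integrable lborel f" and c: "c \<longlonglongrightarrow> 0"
  shows "(\<lambda>n. LINT x|lborel. norm (f (x + c n) - f x)) \<longlonglongrightarrow> 0"
  using f
proof induction
  case (base A w)
  have "(\<lambda>n. LINT x|lborel. \<bar>indicator A (x + c n) - indicator A x :: real\<bar>) \<longlonglongrightarrow> 0"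
  proof (rule LIMSEQ_I)
    fix e :: real assume e: "e > 0"
    \<comment> \<open>The error set \<open>T - A\<close> enters twice, shifted and unshifted, each
      below e/4; the remaining e/2 goes to the open set.\<close>
    obtain T where T: "open T" "A \<subseteq> T" "emeasure lborel (T - A) < ennreal (e / 4)"
      using outer_regular_lborel[of A "e / 4"] base(1) e by auto
    have [measurable]: "A \<in> sets borel" "T \<in> sets borel" using base T by auto
    have "emeasure lborel T = emeasure lborel A + emeasure lborel (T - A)"
      using T(2) by (subst plus_emeasure) (auto simp: Un_absorb1)
    then have fin: "emeasure lborel T < \<infinity>" using base(2) T(3) by (auto simp: less_top[symmetric])
    define D where "D = T - A"
    have [measurable]: "D \<in> sets borel" by (auto simp: D_def)
    have fD: "emeasure lborel D < \<infinity>" using T(3) unfolding D_def by (rule less_trans) simp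
    have iD: "integrable lborel (indicator D :: 'a \<Rightarrow> real)" using fD by (intro integrable_real_indicator) auto
    have mD: "(LBINT x. indicator D x :: real) < e / 4"
    proof -
      have "ennreal (measure lborel D) < ennreal (e / 4)"
        using T(3) fD unfolding D_def[symmetric] by (subst emeasure_eq_ennreal_measure[symmetric]) auto
      then have "measure lborel D < e / 4" by (subst (asm) ennreal_less_iff) simp_all
      then show ?thesis by simp
    qed
    have iT: "integrable lborel (indicator T :: 'a \<Rightarrow> real)" using fin by (intro integrable_real_indicator) auto
    have iA: "integrable lborel (indicator A :: 'a \<Rightarrow> real)" using base by (intro integrable_real_indicator) auto
    from LIMSEQ_D[OF indicator_open_translation[OF T(1) fin c], of "e / 2"] e
    obtain N where N: "\<And>n. n \<ge> N \<Longrightarrow> (LBINT x. \<bar>indicator T (x + c n) - indicator T x :: real\<bar>) < e / 2"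
      by force
    have "(LBINT x. \<bar>indicator A (x + c n) - indicator A x :: real\<bar>) < e" if "n \<ge> N" for n
    proof -
      have "(LBINT x. \<bar>indicator A (x + c n) - indicator A x :: real\<bar>)
        \<le> (LBINT x. indicator D (x + c n) + indicator D x + \<bar>indicator T (x + c n) - indicator T x :: real\<bar>)"
      proof (rule integral_mono)
        show "\<bar>indicator A (x + c n) - indicator A x :: real\<bar>
          \<le> indicator D (x + c n) + indicator D x + \<bar>indicator T (x + c n) - indicator T x :: real\<bar>" for x
          using T(2) by (auto simp: D_def indicator_def)
      qed (intro integrable_abs Bochner_Integration.integrable_diff Bochner_Integration.integrable_add lborel_integrable_translate iA iD iT)+
      also have "\<dots> = (LBINT x. indicator D (x + c n)) + (LBINT x. indicator D x)
          + (LBINT x. \<bar>indicator T (x + c n) - indicator T x :: real\<bar>)"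
        using lborel_integrable_translate[OF iD, of "c n"] iD lborel_integrable_translate[OF iT, of "c n"] iT by simp
      also have "(LBINT x. indicator D (x + c n) :: real) = (LBINT x. indicator D x)"
        by (rule lborel_integral_translate) measurable
      finally show ?thesis using mD N[OF that] by simp
    qed
    then show "\<exists>N. \<forall>n\<ge>N. norm ((LBINT x. \<bar>indicator A (x + c n) - indicator A x :: real\<bar>) - 0) < e"
      by (intro exI[of _ N]) simp
  qed
  from tendsto_mult_right[OF this, of "norm w"]
  show ?case by (simp add: scaleR_diff_left[symmetric])
next
  case (add f g)
  have fi: "integrable lborel (\<lambda>x. norm (f (x + c n) - f x))" for n
    using add(1) by (intro integrable_norm Bochner_Integration.integrable_diff lborel_integrable_translate)
  have gi: "integrable lborel (\<lambda>x. norm (g (x + c n) - g x))" for n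
    using add(2) by (intro integrable_norm Bochner_Integration.integrable_diff lborel_integrable_translate)
  have le: "(LBINT x. norm (f (x + c n) + g (x + c n) - (f x + g x)))
      \<le> (LBINT x. norm (f (x + c n) - f x)) + (LBINT x. norm (g (x + c n) - g x))" for n
  proof -
    have "(LBINT x. norm (f (x + c n) + g (x + c n) - (f x + g x)))
      \<le> (LBINT x. norm (f (x + c n) - f x) + norm (g (x + c n) - g x))"
      using add(1,2)
      by (intro integral_mono integrable_norm Bochner_Integration.integrable_diff Bochner_Integration.integrable_add
          lborel_integrable_translate) (auto intro: norm_diff_triangle_ineq)
    also have "\<dots> = (LBINT x. norm (f (x + c n) - f x)) + (LBINT x. norm (g (x + c n) - g x))"
      using fi gi by (rule Bochner_Integration.integral_add)
    finally show ?thesis .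
  qed
  have lim: "(\<lambda>n. (LBINT x. norm (f (x + c n) - f x)) + (LBINT x. norm (g (x + c n) - g x))) \<longlonglongrightarrow> 0"
    using tendsto_add[OF add(3,4)] by simp
  show ?case
    by (rule tendsto_sandwich[OF _ _ tendsto_const lim]) (intro always_eventually allI le Bochner_Integration.integral_nonneg norm_ge_zero)+
next
  case (lim f s)
  have [measurable]: "f \<in> borel_measurable borel" "s i \<in> borel_measurable borel" for i
    using borel_measurable_integrable[OF lim(4)] borel_measurable_integrable[OF lim(1)[of i]] by simp_all
  have ap: "(\<lambda>i. LINT x|lborel. norm (s i x - f x)) \<longlonglongrightarrow> (LBINT x::'a. 0::real)"
  proof (rule integral_dominated_convergence)
    \<comment> \<open>The approximants of the induction satisfy norm (s i x) \<le> 2 * norm (f x),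
      hence the factor 3.\<close>
    show "integrable lborel (\<lambda>x. 3 * norm (f x))" using lim(4) by simp
    show "AE x in lborel. (\<lambda>i. norm (s i x - f x)) \<longlonglongrightarrow> 0"
      using lim(2) by (intro AE_I2) (simp add: tendsto_norm_zero LIM_zero)
    show "AE x in lborel. norm (norm (s i x - f x)) \<le> 3 * norm (f x)" for i
    proof (rule AE_I2)
      fix x show "norm (norm (s i x - f x)) \<le> 3 * norm (f x)"
        using norm_triangle_ineq4[of "s i x" "f x"] lim(3)[of x i] by simp
    qed
  qed measurable
  show ?case
  proof (rule LIMSEQ_I)
    fix e :: real assume e: "e > 0"
    from LIMSEQ_D[OF ap, of "e / 4"] e obtain i where "norm ((LBINT x. norm (s i x - f x)) - (LBINT x::'a. 0::real)) < e / 4"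
      by force
    then have i: "(LBINT x. norm (s i x - f x)) < e / 4" by simp
    from LIMSEQ_D[OF lim(5)[of i], of "e / 4"] e
    obtain N where N: "\<And>n. n \<ge> N \<Longrightarrow> (LBINT x. norm (s i (x + c n) - s i x)) < e / 4" by force
    have "(LBINT x. norm (f (x + c n) - f x)) < e" if "n \<ge> N" for n
    proof -
      have ii: "integrable lborel (\<lambda>x. norm (s i x - f x))" "integrable lborel (\<lambda>x. norm (s i (x + c n) - s i x))"
        by (intro integrable_norm Bochner_Integration.integrable_diff lim(1,4) lborel_integrable_translate[OF lim(1)])+
      have it: "integrable lborel (\<lambda>x. norm (s i (x + c n) - f (x + c n)))" by (rule lborel_integrable_translate[OF ii(1)])
      have "(LBINT x. norm (f (x + c n) - f x))
        \<le> (LBINT x. norm (s i (x + c n) - f (x + c n)) + norm (s i x - f x) + norm (s i (x + c n) - s i x))"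
      proof (rule integral_mono)
        show "integrable lborel (\<lambda>x. norm (f (x + c n) - f x))"
          using lim(4) by (intro integrable_norm Bochner_Integration.integrable_diff lborel_integrable_translate)
        show "integrable lborel (\<lambda>x. norm (s i (x + c n) - f (x + c n)) + norm (s i x - f x) + norm (s i (x + c n) - s i x))"
          by (intro Bochner_Integration.integrable_add it ii)
        show "norm (f (x + c n) - f x) \<le> norm (s i (x + c n) - f (x + c n)) + norm (s i x - f x) + norm (s i (x + c n) - s i x)" for x
        proof -
          have "f (x + c n) - f x = - (s i (x + c n) - f (x + c n)) + (s i x - f x) + (s i (x + c n) - s i x)" by simp
          also have "norm \<dots> \<le> norm (- (s i (x + c n) - f (x + c n))) + norm (s i x - f x) + norm (s i (x + c n) - s i x)"
            by (intro order_trans[OF norm_triangle_ineq] add_right_mono norm_triangle_ineq)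
          finally show ?thesis by (simp only: norm_minus_cancel)
        qed
      qed
      also have "\<dots> = (LBINT x. norm (s i (x + c n) - f (x + c n))) + (LBINT x. norm (s i x - f x))
          + (LBINT x. norm (s i (x + c n) - s i x))"
        using it ii by simp
      also have "(LBINT x. norm (s i (x + c n) - f (x + c n))) = (LBINT x. norm (s i x - f x))"
        by (rule lborel_integral_translate) measurable
      finally show ?thesis using i N[OF that] e by simp
    qed
    then show "\<exists>N. \<forall>n\<ge>N. norm ((LBINT x. norm (f (x + c n) - f x)) - 0) < e"
      by (intro exI[of _ N]) simp
  qed
qed

subsection \<open>Sign transport\<close>

text \<open>The last argument is a displacement and not an end point: the estimates fix it and let
  \<open>x\<close> vary.\<close>

definition dyadic_sign :: "('a::real_vector \<Rightarrow> 'c::real_inner) \<Rightarrow> nat \<Rightarrow> 'a \<Rightarrow> 'a \<Rightarrow> real" where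
  "dyadic_sign n k x v = chain (rel_sign n) (\<lambda>j. x + (real j / 2 ^ k) *\<^sub>R v) (2 ^ k)"

text \<open>The limit of \<open>dyadic_sign\<close> where it stabilises. Writing it as a countable
  condition keeps it jointly measurable, and the default -1 keeps its absolute value 1
  everywhere.\<close>

definition transport :: "('a::real_vector \<Rightarrow> 'c::real_inner) \<Rightarrow> 'a \<Rightarrow> 'a \<Rightarrow> real" where
  "transport n x v = (if \<exists>m. \<forall>k\<ge>m. dyadic_sign n k x v = 1 then 1 else - 1)"

lemma abs_transport [simp]: "\<bar>transport n x v\<bar> = 1" by (simp add: transport_def)

lemma measurable_rel_sign [measurable (raw)]:
  fixes n :: "'a::euclidean_space \<Rightarrow> 'c::euclidean_space"
  assumes [measurable]: "n \<in> borel_measurable borel" "f \<in> M \<rightarrow>\<^sub>M borel" "g \<in> M \<rightarrow>\<^sub>M borel"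
  shows "(\<lambda>x. rel_sign n (f x) (g x)) \<in> borel_measurable M"
  unfolding rel_sign_def by measurable

lemma measurable_dyadic_sign [measurable (raw)]:
  fixes n :: "'a::euclidean_space \<Rightarrow> 'c::euclidean_space"
  assumes [measurable]: "n \<in> borel_measurable borel" "f \<in> M \<rightarrow>\<^sub>M borel" "g \<in> M \<rightarrow>\<^sub>M borel"
  shows "(\<lambda>x. dyadic_sign n k (f x) (g x)) \<in> borel_measurable M"
  unfolding dyadic_sign_def chain_def by measurable

lemma measurable_transport [measurable (raw)]:
  fixes n :: "'a::euclidean_space \<Rightarrow> 'c::euclidean_space"
  assumes [measurable]: "n \<in> borel_measurable borel" "f \<in> M \<rightarrow>\<^sub>M borel" "g \<in> M \<rightarrow>\<^sub>M borel"
  shows "(\<lambda>x. transport n (f x) (g x)) \<in> borel_measurable M"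
  unfolding transport_def by measurable

lemma transport_eventually:
  assumes "\<forall>\<^sub>F k in sequentially. dyadic_sign n (Suc k) x v = dyadic_sign n k x v"
  shows "\<forall>\<^sub>F k in sequentially. dyadic_sign n k x v = transport n x v"
proof -
  obtain m where m: "\<And>k. k \<ge> m \<Longrightarrow> dyadic_sign n (Suc k) x v = dyadic_sign n k x v"
    using assms by (auto simp: eventually_sequentially)
  have c: "dyadic_sign n k x v = dyadic_sign n m x v" if "k \<ge> m" for k
    using that by (induction k rule: dec_induct) (simp_all only: m)
  have "\<bar>dyadic_sign n m x v\<bar> = 1" by (simp add: dyadic_sign_def)
  then consider "dyadic_sign n m x v = 1" | "dyadic_sign n m x v = -1" by (auto simp: abs_if split: if_splits)
  then have "dyadic_sign n m x v = transport n x v"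
  proof cases
    case 1
    then have "\<exists>m. \<forall>k\<ge>m. dyadic_sign n k x v = 1" using c by metis
    then show ?thesis using 1 unfolding transport_def by presburger
  next
    case 2
    then have "\<not> (\<exists>m'. \<forall>k\<ge>m'. dyadic_sign n k x v = 1)" using c by (metis nat_le_linear one_neq_neg_one)
    then show ?thesis using 2 unfolding transport_def by (simp only: if_False)
  qed
  then show ?thesis unfolding eventually_sequentially using c by metis
qed

lemma emeasure_lborel_translate:
  fixes S :: "'a::euclidean_space set"
  assumes [measurable]: "S \<in> sets borel"
  shows "emeasure lborel {x. x + c \<in> S} = emeasure lborel S"
proof -
  have "{x. x + c \<in> S} \<in> sets lborel" by measurable
  then have "emeasure lborel {x. x + c \<in> S} = (\<integral>\<^sup>+x. indicator {x. x + c \<in> S} x \<partial>lborel)" by simp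
  also have "\<dots> = (\<integral>\<^sup>+x. indicator S (x + c) \<partial>lborel)"
    by (intro nn_integral_cong) (simp add: indicator_def)
  also have "\<dots> = emeasure lborel S" by (subst lborel_nn_integral_translate) auto
  finally show ?thesis .
qed

text \<open>The union bound behind all counting arguments: one translate for each piece of a chain
  or grid.\<close>

lemma emeasure_translates_le:
  fixes S :: "'a::euclidean_space set"
  assumes [measurable]: "S \<in> sets borel" and J: "finite J"
  shows "emeasure lborel (\<Union>j\<in>J. {x. x + c j \<in> S}) \<le> of_nat (card J) * emeasure lborel S"
proof -
  have "emeasure lborel (\<Union>j\<in>J. {x. x + c j \<in> S}) \<le> (\<Sum>j\<in>J. emeasure lborel {x. x + c j \<in> S})"
    using J by (intro emeasure_subadditive_finite) auto
  also have "\<dots> = of_nat (card J) * emeasure lborel S" by (simp add: emeasure_lborel_translate)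
  finally show ?thesis .
qed

lemma AE_lborel_open_exists:
  fixes U :: "'a::euclidean_space set"
  assumes "AE x in lborel. Q x" "open U" "U \<noteq> {}"
  obtains x where "x \<in> U" "Q x"
proof -
  obtain N where N: "N \<in> null_sets lborel" "\<And>x. x \<notin> N \<Longrightarrow> Q x" using assms(1) by (auto simp: eventually_ae_filter)
  have "negligible N" using N(1) null_sets_completionI by (auto simp: negligible_iff_null_sets)
  then have "\<not> U \<subseteq> N" using open_not_negligible[OF assms(2,3)] negligible_subset by blast
  then show thesis using N(2) that by blast
qed

context
  fixes n :: "'a::euclidean_space \<Rightarrow> real^'m" and U :: "'a set"
  assumes n_unit: "\<And>x. norm (n x) = 1" and n_meas: "n \<in> borel_measurable borel"
    and U: "open U" "convex U"
begin

definition jump_set :: "nat \<Rightarrow> 'a \<Rightarrow> 'a set" where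
  "jump_set k v = {x\<in>U. x + (1 / 2 ^ k) *\<^sub>R v \<in> U \<and> \<not> close_to n x (x + (1 / 2 ^ k) *\<^sub>R v)}"

lemma measurable_tensor: "(\<lambda>x. n x \<otimes> n x) \<in> borel_measurable borel"
proof -
  have "continuous_on UNIV (\<lambda>a::real^'m. a \<otimes> a)"
    unfolding tensor_def by (intro continuous_on_vec_lambda continuous_intros)
  from borel_measurable_continuous_on[OF this n_meas] show ?thesis .
qed

lemma jump_set_sets: "jump_set k v \<in> sets borel"
proof -
  note [measurable] = measurable_tensor
  have [measurable]: "U \<in> sets borel" using U by simp
  show ?thesis unfolding jump_set_def close_to_def by measurable
qed

text \<open>Self-similarity: scale k for the displacement v/2^l is scale k + l for v. It supplies
  the decay in l of \<open>transport_rel_sign\<close>.\<close>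

lemma jump_set_scale: "jump_set k ((1 / 2 ^ l) *\<^sub>R v) = jump_set (k + l) v"
  by (simp add: jump_set_def power_add)

lemma segment_in_U: "x \<in> U \<Longrightarrow> x + v \<in> U \<Longrightarrow> 0 \<le> s \<Longrightarrow> s \<le> 1 \<Longrightarrow> x + s *\<^sub>R v \<in> U"
proof -
  assume "x \<in> U" "x + v \<in> U" "0 \<le> s" "s \<le> 1"
  then have "(1 - s) *\<^sub>R x + s *\<^sub>R (x + v) \<in> U" using U(2) by (intro convexD) auto
  then show ?thesis by (simp add: algebra_simps)
qed

text \<open>The point is reached by going the fraction b/a along the far edge, and from
  \<open>x\<close> the fraction a towards the point found there.\<close>

lemma triangle_in_U:
  assumes "x \<in> U" "x + v \<in> U" "x + v + w \<in> U" "0 \<le> b" "b \<le> a" "a \<le> 1"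
  shows "x + a *\<^sub>R v + b *\<^sub>R w \<in> U"
proof (cases "a = 0")
  case False
  have "(x + v) + (b / a) *\<^sub>R w \<in> U" using assms False by (intro segment_in_U) auto
  then have "x + (v + (b / a) *\<^sub>R w) \<in> U" by (simp add: add.assoc)
  then have "x + a *\<^sub>R (v + (b / a) *\<^sub>R w) \<in> U" using assms by (intro segment_in_U) auto
  then show ?thesis using False by (simp add: scaleR_right_distrib add.assoc)
qed (use assms in simp)

definition step_error :: "nat \<Rightarrow> 'a \<Rightarrow> 'a set" where
  "step_error k v = {x\<in>U. x + v \<in> U \<and> dyadic_sign n (Suc k) x v \<noteq> dyadic_sign n k x v}"

lemma step_error_sets: "step_error k v \<in> sets borel"
proof -
  note [measurable] = n_meas
  have [measurable]: "U \<in> sets borel" using U by simp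
  show ?thesis unfolding step_error_def by measurable
qed

text \<open>If all 2^(k+1) fine steps are close, \<open>chain_double\<close> identifies the two
  scales. So some fine step jumps, and the error set is covered by translates of one jump
  set.\<close>

lemma step_error_emeasure: "emeasure lborel (step_error k v) \<le> 2 ^ Suc k * emeasure lborel (jump_set (Suc k) v)"
proof -
  let ?c = "\<lambda>i::nat. (real i / 2 ^ Suc k) *\<^sub>R v"
  have "step_error k v \<subseteq> (\<Union>i\<in>{..<2 ^ Suc k}. {x. x + ?c i \<in> jump_set (Suc k) v})"
  proof
    fix x assume x: "x \<in> step_error k v"
    show "x \<in> (\<Union>i\<in>{..<2 ^ Suc k}. {x. x + ?c i \<in> jump_set (Suc k) v})"
    proof (rule ccontr)
      assume no: "x \<notin> (\<Union>i\<in>{..<2 ^ Suc k}. {x. x + ?c i \<in> jump_set (Suc k) v})"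
      have inU: "x + ?c i \<in> U" if "i \<le> 2 ^ Suc k" for i
      proof (rule segment_in_U)
        have "real i \<le> real (2 ^ Suc k)" using that by (rule of_nat_mono)
        then show "real i / 2 ^ Suc k \<le> 1" by simp
      qed (use x in \<open>simp_all add: step_error_def\<close>)
      have next_pt: "x + ?c i + (1 / 2 ^ Suc k) *\<^sub>R v = x + ?c (Suc i)" for i
        by (simp add: add.assoc scaleR_add_left[symmetric] add_divide_distrib[symmetric] add.commute)
      have "close_to n (x + ?c i) (x + ?c (Suc i))" if i: "i < 2 ^ Suc k" for i
      proof -
        have "x + ?c i \<notin> jump_set (Suc k) v" using no i by blast
        then show ?thesis using inU[OF less_imp_le[OF i]] inU[OF Suc_leI[OF i]]
          unfolding jump_set_def mem_Collect_eq next_pt by blast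
      qed
      then have "chain (rel_sign n) (\<lambda>j. x + ?c j) (2 * 2 ^ k) = chain (rel_sign n) (\<lambda>j. x + ?c (2 * j)) (2 ^ k)"
        by (intro chain_double[where G = "close_to n"] rel_sign_mult n_unit) auto
      then have "dyadic_sign n (Suc k) x v = dyadic_sign n k x v" by (simp add: dyadic_sign_def)
      then show False using x by (simp add: step_error_def)
    qed
  qed
  then have "emeasure lborel (step_error k v) \<le> emeasure lborel (\<Union>i\<in>{..<2 ^ Suc k}. {x. x + ?c i \<in> jump_set (Suc k) v})"
    using jump_set_sets by (intro emeasure_mono) auto
  also have "\<dots> \<le> of_nat (card {..<2 ^ Suc k :: nat}) * emeasure lborel (jump_set (Suc k) v)"
    by (intro emeasure_translates_le jump_set_sets) simp
  finally show ?thesis by simp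
qed

section \<open>Transport when jump sets have measure o(4^-k)\<close>

context
  assumes jump_set_fin: "\<And>k v. emeasure lborel (jump_set k v) < \<infinity>"
    and jump_set_lim: "\<And>v. (\<lambda>k. 4 ^ k * measure lborel (jump_set k v)) \<longlonglongrightarrow> 0"
begin

lemma jump_set_emeasure: "4 ^ k * measure lborel (jump_set k v) \<le> e \<Longrightarrow> emeasure lborel (jump_set k v) \<le> ennreal (e / 4 ^ k)"
  using jump_set_fin[of k v] by (subst emeasure_eq_ennreal_measure) (auto intro!: ennreal_leI simp: field_simps)

text \<open>The 2^(k+1) pieces leave half of the decay 4^-(k+1), which is summable. The constant
  \<open>e\<close> is free: a fixed bound gives convergence of the transport, a small one gives its
  rate.\<close>

lemma step_error_bound:
  assumes "4 ^ Suc k * measure lborel (jump_set (Suc k) v) \<le> e"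
  shows "emeasure lborel (step_error k v) \<le> ennreal (e * (1/2) ^ Suc k)"
proof -
  have e: "0 \<le> e" using assms by (rule order_trans[rotated]) simp
  have "emeasure lborel (step_error k v) \<le> 2 ^ Suc k * ennreal (e / 4 ^ Suc k)"
    by (rule order_trans[OF step_error_emeasure mult_left_mono[OF jump_set_emeasure[OF assms]]]) simp
  also have "\<dots> = ennreal (2 ^ Suc k * (e / 4 ^ Suc k))"
    using e by (subst ennreal_mult) (simp_all only: ennreal_power[symmetric] ennreal_numeral zero_le_numeral zero_le_power zero_le_divide_iff, simp_all)
  also have "2 ^ Suc k * (e / 4 ^ Suc k) = e * (1/2) ^ Suc k"
  proof -
    have "(4::real) ^ Suc k = 2 ^ Suc k * 2 ^ Suc k" by (simp only: power_mult_distrib[symmetric]) simp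
    then show ?thesis by (simp add: power_one_over)
  qed
  finally show ?thesis .
qed

text \<open>Borel-Cantelli: a bound on 4^k times the jump measure already makes the step errors
  summable.\<close>

lemma AE_transport:
  "AE x in lborel. x \<in> U \<and> x + v \<in> U \<longrightarrow> (\<forall>\<^sub>F k in sequentially. dyadic_sign n k x v = transport n x v)"
proof -
  have "Bseq (\<lambda>k. 4 ^ k * measure lborel (jump_set k v))" using jump_set_lim[of v] convergentI convergent_imp_Bseq by blast
  then obtain C where C: "\<And>k. 4 ^ k * measure lborel (jump_set k v) \<le> C"
    by (auto simp: Bseq_def abs_le_iff)
  then have le: "emeasure lborel (step_error k v) \<le> ennreal (C * (1/2) ^ Suc k)" for k by (rule step_error_bound)
  have C0: "0 \<le> C" using C[of 0] by (rule order_trans[rotated]) simp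
  have "AE x in lborel. \<forall>\<^sub>F k in sequentially. x \<in> space lborel - step_error k v"
  proof (rule borel_cantelli_AE1)
    show "step_error k v \<in> sets lborel" for k using step_error_sets by simp
    show "emeasure lborel (step_error k v) < \<infinity>" for k using le[of k] by (rule le_less_trans) simp
    have m: "measure lborel (step_error k v) \<le> C * (1/2) ^ Suc k" for k
      unfolding measure_def using le[of k] C0 by (intro enn2real_leI) auto
    have s: "summable (\<lambda>k. C * (1/2) ^ Suc k)"
      using power_half_series by (intro summable_mult) (rule sums_summable)
    show "summable (\<lambda>k. measure lborel (step_error k v))"
      by (rule summable_comparison_test'[OF s, of 0]) (use m in \<open>simp only: real_norm_def abs_of_nonneg[OF measure_nonneg]\<close>)
  qed
  then show ?thesis
  proof eventually_elim
    case (elim x)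
    show ?case
    proof (intro impI transport_eventually)
      assume x: "x \<in> U \<and> x + v \<in> U"
      show "\<forall>\<^sub>F k in sequentially. dyadic_sign n (Suc k) x v = dyadic_sign n k x v"
        using elim by eventually_elim (use x in \<open>auto simp: step_error_def\<close>)
    qed
  qed
qed

text \<open>At scale 0 the dyadic sign is the relative sign of the end points. A disagreement with
  the limit therefore forces a step error at some scale, and these errors sum to a geometric
  series.\<close>

lemma transport_rel_sign:
  "(\<lambda>l. 4 ^ l * measure lborel {x\<in>U. x + (1 / 2 ^ l) *\<^sub>R v \<in> U \<and>
      transport n x ((1 / 2 ^ l) *\<^sub>R v) \<noteq> rel_sign n x (x + (1 / 2 ^ l) *\<^sub>R v)}) \<longlonglongrightarrow> 0" (is "(\<lambda>l. 4 ^ l * measure lborel (?F l)) \<longlonglongrightarrow> 0")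
proof (rule LIMSEQ_I)
  fix e :: real assume e: "e > 0"
  from LIMSEQ_D[OF jump_set_lim[of v], of "e / 2"] e
  obtain L where L: "\<And>k. k \<ge> L \<Longrightarrow> 4 ^ k * measure lborel (jump_set k v) < e / 2" by force
  have "4 ^ l * measure lborel (?F l) \<le> e / 2" if l: "l \<ge> L" for l
  proof -
    let ?w = "(1 / 2 ^ l) *\<^sub>R v"
    note [measurable] = n_meas step_error_sets
    have [measurable]: "U \<in> sets borel" using U by simp
    have bound: "emeasure lborel (step_error k ?w) \<le> ennreal (e / 2 / 4 ^ l * (1/2) ^ Suc k)" for k
    proof (rule step_error_bound)
      \<comment> \<open>For the shortened displacement the jump sets live at scale
        \<open>Suc k + l\<close>, which gains the factor 4^-l.\<close>
      have "4 ^ l * (4 ^ Suc k * measure lborel (jump_set (Suc k) ?w)) \<le> e / 2"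
        using L[of "Suc k + l"] l unfolding jump_set_scale by (simp add: power_add mult_ac)
      then show "4 ^ Suc k * measure lborel (jump_set (Suc k) ?w) \<le> e / 2 / 4 ^ l" by (simp add: field_simps)
    qed
    have "emeasure lborel (?F l) \<le> emeasure lborel (\<Union>k. step_error k ?w)"
    proof (rule emeasure_mono_AE)
      show "AE x in lborel. x \<in> ?F l \<longrightarrow> x \<in> (\<Union>k. step_error k ?w)"
        using AE_transport[of ?w]
      proof eventually_elim
        case (elim x)
        show ?case
        proof (rule impI, rule ccontr)
          assume x: "x \<in> ?F l" and no: "x \<notin> (\<Union>k. step_error k ?w)"
          have "dyadic_sign n (Suc k) x ?w = dyadic_sign n k x ?w" for k using x no by (auto simp: step_error_def)
          then have c: "dyadic_sign n k x ?w = dyadic_sign n 0 x ?w" for k by (induction k) simp_all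
          have "\<forall>\<^sub>F k in sequentially. dyadic_sign n k x ?w = transport n x ?w" using elim x by blast
          then obtain k where "dyadic_sign n k x ?w = transport n x ?w" by (auto simp: eventually_sequentially)
          then have "transport n x ?w = dyadic_sign n 0 x ?w" using c by metis
          also have "\<dots> = rel_sign n x (x + ?w)" by (simp add: dyadic_sign_def chain_def)
          finally show False using x by blast
        qed
      qed
    qed measurable
    also have "\<dots> \<le> (\<Sum>k. emeasure lborel (step_error k ?w))"
      using step_error_sets by (intro emeasure_subadditive_countably) auto
    also have "\<dots> \<le> (\<Sum>k. ennreal (e / 2 / 4 ^ l * (1/2) ^ Suc k))"
      by (intro suminf_le bound) auto
    also have "\<dots> = ennreal (e / 2 / 4 ^ l)"
    proof (rule suminf_ennreal_eq)
      show "(\<lambda>k. e / 2 / 4 ^ l * (1/2) ^ Suc k) sums (e / 2 / 4 ^ l)"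
        using sums_mult[OF power_half_series, of "e / 2 / 4 ^ l"] by simp
    qed (use e in simp)
    finally have "measure lborel (?F l) \<le> e / 2 / 4 ^ l" using e by (simp add: measure_def enn2real_leI)
    then show ?thesis by (simp add: field_simps)
  qed
  then show "\<exists>N. \<forall>l\<ge>N. norm (4 ^ l * measure lborel (?F l) - 0) < e"
    using e by (intro exI[of _ L] allI impI) (force simp: abs_mult intro: le_less_trans)
qed

text \<open>At scale k, failure around the triangle forces a jump at one of at most (2^k + 1)^2
  \<le> 4 * 4^k grid points. The o(4^-k) bound makes this measure tend to 0 without a rate; this is
  enough, since a failure of the limits is a failure at all large scales.\<close>

lemma AE_transport_cocycle:
  "AE x in lborel. x \<in> U \<and> x + v \<in> U \<and> x + v + w \<in> U \<longrightarrow>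
     transport n x v * transport n (x + v) w = transport n x (v + w)"
proof -
  note [measurable] = n_meas
  have [measurable]: "U \<in> sets borel" using U by simp
  define E where "E k = {x\<in>U. x + v \<in> U \<and> x + v + w \<in> U \<and> dyadic_sign n k x v * dyadic_sign n k (x + v) w \<noteq> dyadic_sign n k x (v + w)}" for k
  have E[measurable]: "E k \<in> sets borel" for k unfolding E_def by measurable
  have bound: "emeasure lborel (E k) \<le> ennreal (4 * (4 ^ k * measure lborel (jump_set k v) + 4 ^ k * measure lborel (jump_set k w)))" for k
  proof -
    define N :: nat where "N = 2 ^ k"
    have N: "real N = 2 ^ k" "N > 0" by (simp_all add: N_def)
    let ?c = "\<lambda>(i, j). (real i / 2 ^ k) *\<^sub>R v + (real j / 2 ^ k) *\<^sub>R w"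
    \<comment> \<open>The whole square of indices overcounts the triangle; only its order 4^k
      matters.\<close>
    let ?J = "{..N} \<times> {..N}"
    have "E k \<subseteq> (\<Union>p\<in>?J. {x. x + ?c p \<in> jump_set k v}) \<union> (\<Union>p\<in>?J. {x. x + ?c p \<in> jump_set k w})"
    proof (rule subsetI, rule ccontr)
      fix x assume x: "x \<in> E k" and no: "x \<notin> (\<Union>p\<in>?J. {x. x + ?c p \<in> jump_set k v}) \<union> (\<Union>p\<in>?J. {x. x + ?c p \<in> jump_set k w})"
      define a where "a i j = x + (real i / 2 ^ k) *\<^sub>R v + (real j / 2 ^ k) *\<^sub>R w" for i j :: nat
      have aU: "a i j \<in> U" if "j \<le> i" "i \<le> N" for i j
        using x that N unfolding a_def E_def by (intro triangle_in_U) (auto simp: divide_right_mono)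
      have nb: "a i j \<notin> jump_set k v" "a i j \<notin> jump_set k w" if "j \<le> i" "i \<le> N" for i j
        using no that by (auto simp: a_def add.assoc)
      have sv: "a i j + (1 / 2 ^ k) *\<^sub>R v = a (Suc i) j" and sw: "a i j + (1 / 2 ^ k) *\<^sub>R w = a i (Suc j)" for i j
        by (simp_all add: a_def algebra_simps add_divide_distrib)
      have "chain (rel_sign n) (\<lambda>i. a i 0) N * chain (rel_sign n) (a N) N = chain (rel_sign n) (\<lambda>i. a i i) N"
      proof (rule chain_triangle[where G = "close_to n"])
        show "close_to n (a i j) (a (Suc i) j)" if "j \<le> i" "i < N" for i j
        proof -
          have "a i j \<notin> jump_set k v" "a i j \<in> U" "a (Suc i) j \<in> U" using that nb aU by simp_all
          then show ?thesis unfolding jump_set_def mem_Collect_eq sv by blast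
        qed
        show "close_to n (a i j) (a i (Suc j))" if "j < i" "i \<le> N" for i j
        proof -
          have "a i j \<notin> jump_set k w" "a i j \<in> U" "a i (Suc j) \<in> U" using that nb aU by simp_all
          then show ?thesis unfolding jump_set_def mem_Collect_eq sw by blast
        qed
      qed (intro rel_sign_mult n_unit)
      then have "dyadic_sign n k x v * dyadic_sign n k (x + v) w = dyadic_sign n k x (v + w)"
        by (simp add: dyadic_sign_def a_def[abs_def] N_def scaleR_add_right add.assoc)
      then show False using x by (simp add: E_def)
    qed
    then have "emeasure lborel (E k) \<le> emeasure lborel ((\<Union>p\<in>?J. {x. x + ?c p \<in> jump_set k v}) \<union> (\<Union>p\<in>?J. {x. x + ?c p \<in> jump_set k w}))"
      using jump_set_sets by (intro emeasure_mono) auto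
    also have "\<dots> \<le> emeasure lborel (\<Union>p\<in>?J. {x. x + ?c p \<in> jump_set k v}) + emeasure lborel (\<Union>p\<in>?J. {x. x + ?c p \<in> jump_set k w})"
      using jump_set_sets by (intro emeasure_subadditive) auto
    also have "\<dots> \<le> of_nat (card ?J) * emeasure lborel (jump_set k v) + of_nat (card ?J) * emeasure lborel (jump_set k w)"
      by (intro add_mono emeasure_translates_le jump_set_sets) auto
    also have "\<dots> = ennreal (real (card ?J) * (measure lborel (jump_set k v) + measure lborel (jump_set k w)))"
      using jump_set_fin[of k v] jump_set_fin[of k w]
      by (simp only: emeasure_eq_ennreal_measure[OF less_imp_neq[OF jump_set_fin[unfolded infinity_ennreal_def]]] ennreal_of_nat_eq_real_of_nat)
        (simp add: ennreal_mult ennreal_plus distrib_left)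
    also have "\<dots> \<le> ennreal (4 * (4 ^ k * measure lborel (jump_set k v) + 4 ^ k * measure lborel (jump_set k w)))"
    proof (intro ennreal_leI)
      have "real (card ?J) = (2 ^ k + 1) * (2 ^ k + 1)" by (simp add: N_def algebra_simps)
      also have "\<dots> \<le> (2 * 2 ^ k) * (2 * 2 ^ k :: real)" by (intro mult_mono) auto
      also have "\<dots> = 4 * 4 ^ k" by (simp add: power_mult_distrib[symmetric])
      finally have "real (card ?J) * (measure lborel (jump_set k v) + measure lborel (jump_set k w))
        \<le> 4 * 4 ^ k * (measure lborel (jump_set k v) + measure lborel (jump_set k w))" by (intro mult_right_mono) auto
      then show "real (card ?J) * (measure lborel (jump_set k v) + measure lborel (jump_set k w))
        \<le> 4 * (4 ^ k * measure lborel (jump_set k v) + 4 ^ k * measure lborel (jump_set k w))" by (simp add: algebra_simps)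
    qed
    finally show ?thesis .
  qed
  have lim: "(\<lambda>k. ennreal (4 * (4 ^ k * measure lborel (jump_set k v) + 4 ^ k * measure lborel (jump_set k w)))) \<longlonglongrightarrow> 0"
    using tendsto_ennrealI[OF tendsto_mult_left[OF tendsto_add[OF jump_set_lim[of v] jump_set_lim[of w]], of 4]] by simp
  have "AE x in lborel. \<not> (\<forall>k\<ge>m. x \<in> E k)" for m
  proof -
    \<comment> \<open>The intersection lies in every \<open>E k\<close> with k \<ge> m, and these
      have measure tending to 0.\<close>
    have "emeasure lborel (\<Inter>k\<in>{m..}. E k) \<le> 0"
    proof (rule tendsto_lowerbound[OF lim])
      show "\<forall>\<^sub>F k in sequentially. emeasure lborel (\<Inter>k\<in>{m..}. E k)
        \<le> ennreal (4 * (4 ^ k * measure lborel (jump_set k v) + 4 ^ k * measure lborel (jump_set k w)))"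
        using eventually_ge_at_top[of m]
      proof eventually_elim
        case (elim k)
        then have "emeasure lborel (\<Inter>k\<in>{m..}. E k) \<le> emeasure lborel (E k)" by (intro emeasure_mono) auto
        also note bound
        finally show ?case .
      qed
    qed simp
    then have "(\<Inter>k\<in>{m..}. E k) \<in> null_sets lborel" by (intro null_setsI) auto
    then show ?thesis by (rule AE_I') auto
  qed
  then have notev: "AE x in lborel. \<forall>m. \<not> (\<forall>k\<ge>m. x \<in> E k)" unfolding AE_all_countable by (rule allI)
  have "AE x in lborel. x + v \<in> U \<and> x + v + w \<in> U \<longrightarrow> (\<forall>\<^sub>F k in sequentially. dyadic_sign n k (x + v) w = transport n (x + v) w)"
    by (rule AE_lborel_translate[where c = v and Q = "\<lambda>x. x \<in> U \<and> x + w \<in> U \<longrightarrow> (\<forall>\<^sub>F k in sequentially. dyadic_sign n k x w = transport n x w)"])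
      (rule AE_transport)
  with notev AE_transport[of v] AE_transport[of "v + w"] show ?thesis
  proof eventually_elim
    case (elim x)
    show ?case
    proof (rule impI, rule ccontr)
      assume x: "x \<in> U \<and> x + v \<in> U \<and> x + v + w \<in> U"
        and neq: "transport n x v * transport n (x + v) w \<noteq> transport n x (v + w)"
      have "x + (v + w) \<in> U" using x by (simp only: add.assoc)
      then have "\<forall>\<^sub>F k in sequentially. dyadic_sign n k x v = transport n x v" "\<forall>\<^sub>F k in sequentially. dyadic_sign n k (x + v) w = transport n (x + v) w"
        "\<forall>\<^sub>F k in sequentially. dyadic_sign n k x (v + w) = transport n x (v + w)"
        using elim x by blast+
      then have "\<forall>\<^sub>F k in sequentially. x \<in> E k"
      proof eventually_elim
        case (elim k)
        then show ?case using x neq by (simp only: E_def mem_Collect_eq not_False_eq_True simp_thms)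
      qed
      then show False using elim(1) unfolding eventually_sequentially by blast
    qed
  qed
qed

text \<open>The lift on \<open>U\<close> is \<open>t y = transport n p (y - p)\<close> for a generic base point \<open>p\<close>.\<close>

lemma local_lift:
  assumes W: "countable W"
  obtains t :: "'a \<Rightarrow> real" where "t \<in> borel_measurable borel" "\<And>x. \<bar>t x\<bar> = 1"
    "\<And>w. w \<in> W \<Longrightarrow> AE y in lborel. y \<in> U \<and> y + w \<in> U \<longrightarrow> t y * transport n y w = t (y + w)"
    "AE y in lborel. AE z in lborel. y \<in> U \<and> z \<in> U \<longrightarrow> t y * transport n y (z - y) = t z"
proof (cases "U = {}")
  case True
  then show thesis by (intro that[of "\<lambda>_. 1"]) simp_all
next
  case False
  note [measurable] = n_meas
  have [measurable]: "U \<in> sets borel" using U by simp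
  define R where "R x v w \<longleftrightarrow> (x \<in> U \<and> x + v \<in> U \<and> x + v + w \<in> U \<longrightarrow>
     transport n x v * transport n (x + v) w = transport n x (v + w))" for x v w
  have AER: "AE x in lborel. R x v w" for v w unfolding R_def by (rule AE_transport_cocycle)
  \<comment> \<open>Fubini exchanges the quantifiers: from almost every x for each displacement, to
    almost every displacement for a generic x.\<close>
  have one: "AE x in lborel. AE v in lborel. R x v w" for w
  proof -
    have "{p \<in> space (lborel \<Otimes>\<^sub>M lborel). R (fst p) (snd p) w} \<in> sets (lborel \<Otimes>\<^sub>M lborel)"
      unfolding R_def by measurable
    from lborel_pair.AE_commute[OF this] show ?thesis using AER by simp
  qed
  \<comment> \<open>The same exchange with the pair (v, w) as a single variable, followed by
    splitting the pair.\<close>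
  have two: "AE x in lborel. AE v in lborel. AE w in lborel. R x v w"
  proof -
    have "{p \<in> space (lborel \<Otimes>\<^sub>M (lborel \<Otimes>\<^sub>M lborel)). R (fst p) (fst (snd p)) (snd (snd p))}
      \<in> sets (lborel \<Otimes>\<^sub>M (lborel \<Otimes>\<^sub>M lborel))"
      unfolding R_def by measurable
    then have "{p \<in> space (lborel \<Otimes>\<^sub>M (lborel :: ('a \<times> 'a) measure)). R (fst p) (fst (snd p)) (snd (snd p))}
      \<in> sets (lborel \<Otimes>\<^sub>M (lborel :: ('a \<times> 'a) measure))" by (simp only: lborel_prod)
    from lborel_pair.AE_commute[OF this]
    have "AE x in lborel. AE q in (lborel :: ('a \<times> 'a) measure). R x (fst q) (snd q)" using AER by simp
    then show ?thesis
    proof eventually_elim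
      case (elim x)
      then have "AE q in lborel \<Otimes>\<^sub>M lborel. R x (fst q) (snd q)" by (simp only: lborel_prod)
      from lborel_pair.AE_pair[OF this] show ?case by simp
    qed
  qed
  \<comment> \<open>The displacements in \<open>W\<close> are prescribed exactly, and statements for
    almost every w say nothing about a null set such as \<open>W\<close>. Countability lets one base
    point serve them all.\<close>
  have "AE x in lborel. \<forall>w\<in>W. AE v in lborel. R x v w"
    unfolding AE_ball_countable[OF W] by (intro ballI one)
  with two have "AE x in lborel. (AE v in lborel. AE w in lborel. R x v w) \<and> (\<forall>w\<in>W. AE v in lborel. R x v w)"
    by (rule AE_conjI)
  then obtain p where "p \<in> U" "(AE v in lborel. AE w in lborel. R p v w) \<and> (\<forall>w\<in>W. AE v in lborel. R p v w)"
    by (rule AE_lborel_open_exists[OF _ U(1) False])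
  then have p: "p \<in> U" "\<And>w. w \<in> W \<Longrightarrow> AE v in lborel. R p v w" "AE v in lborel. AE w in lborel. R p v w"
    by blast+
  define t where "t y = transport n p (y - p)" for y
  show thesis
  proof (rule that[of t])
    show "t \<in> borel_measurable borel" unfolding t_def by measurable
    show "\<bar>t x\<bar> = 1" for x by (simp add: t_def)
    fix w assume "w \<in> W"
    have "AE y in lborel. R p (y + - p) w"
      by (rule AE_lborel_translate[where Q = "\<lambda>v. R p v w"]) (rule p(2)[OF \<open>w \<in> W\<close>])
    then show "AE y in lborel. y \<in> U \<and> y + w \<in> U \<longrightarrow> t y * transport n y w = t (y + w)"
    proof eventually_elim
      case (elim y)
      have "p + (y + - p) = y" "y + - p = y - p" "y - p + w = y + w - p" by simp_all
      with elim p(1) show ?case unfolding R_def t_def by metis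
    qed
  next
    have "AE y in lborel. AE w in lborel. R p (y + - p) w"
      by (rule AE_lborel_translate[where Q = "\<lambda>v. AE w in lborel. R p v w"]) (rule p(3))
    then show "AE y in lborel. AE z in lborel. y \<in> U \<and> z \<in> U \<longrightarrow> t y * transport n y (z - y) = t z"
    proof eventually_elim
      case (elim y)
      have "AE z in lborel. R p (y + - p) (z + - y)"
        by (rule AE_lborel_translate[where Q = "R p (y + - p)"]) (rule elim)
      then show ?case
      proof eventually_elim
        case (elim z)
        have "p + (y + - p) = y" "y + - p = y - p" "z + - y = z - y" "y - p + (z - y) = z - p" "y + (z - y) = z" by simp_all
        with elim p(1) show ?case unfolding R_def t_def by metis
      qed
    qed
  qed
qed

text \<open>After correction by \<open>t\<close>, the sign changes along a step exactly when
  transport and relative sign disagree, up to null sets and zero inner products. That set has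
  measure o(4^-l), and 2^l \<le> 4^l.\<close>

lemma local_lift_sign_changes:
  assumes t: "t \<in> borel_measurable borel" "\<And>x. \<bar>t x\<bar> = (1::real)"
    and AEt: "\<And>l. AE y in lborel. y \<in> U \<and> y + (1 / 2 ^ l) *\<^sub>R e \<in> U \<longrightarrow> t y * transport n y ((1 / 2 ^ l) *\<^sub>R e) = t (y + (1 / 2 ^ l) *\<^sub>R e)"
    and bU: "bounded U"
  shows "(\<lambda>l. 2 ^ l * measure lborel {x\<in>U. x + (1 / 2 ^ l) *\<^sub>R e \<in> U \<and>
      (t x *\<^sub>R n x) \<bullet> (t (x + (1 / 2 ^ l) *\<^sub>R e) *\<^sub>R n (x + (1 / 2 ^ l) *\<^sub>R e)) < 0}) \<longlonglongrightarrow> 0" (is "(\<lambda>l. 2 ^ l * measure lborel (?S l)) \<longlonglongrightarrow> 0")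
proof -
  note [measurable] = n_meas t(1)
  have [measurable]: "U \<in> sets borel" using U by simp
  let ?F = "\<lambda>l. {x\<in>U. x + (1 / 2 ^ l) *\<^sub>R e \<in> U \<and>
      transport n x ((1 / 2 ^ l) *\<^sub>R e) \<noteq> rel_sign n x (x + (1 / 2 ^ l) *\<^sub>R e)}"
  have le: "2 ^ l * measure lborel (?S l) \<le> 4 ^ l * measure lborel (?F l)" for l
  proof -
    have fin: "emeasure lborel (?F l) < \<infinity>"
    proof -
      have "emeasure lborel (?F l) \<le> emeasure lborel U" by (intro emeasure_mono) auto
      also have "\<dots> < \<infinity>" using emeasure_bounded_finite[OF bU] by simp
      finally show ?thesis .
    qed
    have "emeasure lborel (?S l) \<le> emeasure lborel (?F l)"
    proof (rule emeasure_mono_AE)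
      show "AE x in lborel. x \<in> ?S l \<longrightarrow> x \<in> ?F l"
        using AEt[of l]
      proof eventually_elim
        case (elim x)
        let ?y = "x + (1 / 2 ^ l) *\<^sub>R e"
        show ?case
        proof (rule impI, rule ccontr)
          assume x: "x \<in> ?S l" and no: "x \<notin> ?F l"
          then have eq: "transport n x ((1 / 2 ^ l) *\<^sub>R e) = rel_sign n x ?y" by blast
          have "t ?y = t x * rel_sign n x ?y" using elim x eq by auto
          then have "(t x *\<^sub>R n x) \<bullet> (t ?y *\<^sub>R n ?y) = (t x * t x) * (rel_sign n x ?y * (n x \<bullet> n ?y))" by simp
          also have "\<dots> \<ge> 0" by (simp add: rel_sign_def)
          finally show False using x by simp
        qed
      qed
    qed measurable
    then have "measure lborel (?S l) \<le> measure lborel (?F l)"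
      using fin by (simp add: measure_def enn2real_mono)
    moreover have "(2::real) ^ l \<le> 4 ^ l" by (rule power_mono) auto
    ultimately show ?thesis by (intro mult_mono) auto
  qed
  show ?thesis
    by (rule tendsto_sandwich[OF _ _ tendsto_const transport_rel_sign[of e]])
      (intro always_eventually allI le mult_nonneg_nonneg measure_nonneg zero_le_power zero_le_numeral)+
qed

end
end

subsection \<open>Sign cocycles on simply connected sets\<close>

text \<open>The double cover is realised inside the product of the space with the bounded sequences:
  over x it has the two points \<plusminus>\<open>\<Phi> i x\<close>, where
  \<open>\<Phi> i x\<close> is the sequence \<open>\<epsilon> i j * d j x\<close>. The cutoffs
  \<open>d j\<close> make it continuous, and the cocycle rule makes it independent of i up to sign.
  A section of the cover chooses the signs \<open>c\<close>.\<close>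

lemma sign_cocycle_trivial:
  fixes B :: "nat \<Rightarrow> 'a::euclidean_space set" and \<epsilon> :: "nat \<Rightarrow> nat \<Rightarrow> real"
  assumes "simply_connected \<Omega>" "open \<Omega>" and cover: "(\<Union>i. B i) = \<Omega>"
    and B: "\<And>i. open (B i)" "\<And>i. connected (B i)" "\<And>i. bounded (B i)"
    and \<epsilon>1: "\<And>i j. \<bar>\<epsilon> i j\<bar> = 1" and \<epsilon>r: "\<And>i. \<epsilon> i i = 1"
    and \<epsilon>t: "\<And>i j k. B i \<inter> B j \<inter> B k \<noteq> {} \<Longrightarrow> \<epsilon> i j * \<epsilon> j k = \<epsilon> i k"
  obtains c :: "nat \<Rightarrow> real" where "\<And>i. \<bar>c i\<bar> = 1" "\<And>i j. B i \<inter> B j \<noteq> {} \<Longrightarrow> c i = \<epsilon> i j * c j"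
proof -
  have sq1: "s * s = 1" if "\<bar>s\<bar> = 1" for s :: real using that by (metis abs_mult_self_eq mult_1)
  have cont_eval: "continuous_on X (\<lambda>x. apply_bcontfun (h x) i)"
    if "continuous_on X h" for X and h :: "'z::topological_space \<Rightarrow> nat \<Rightarrow>\<^sub>C real" and i
  proof -
    have "continuous_on UNIV (\<lambda>f::nat \<Rightarrow>\<^sub>C real. apply_bcontfun f i)"
      unfolding continuous_on_iff using dist_bounded by (meson le_less_trans)
    then show ?thesis by (rule continuous_on_compose2[OF _ that]) auto
  qed
  \<comment> \<open>Truncation at 1 keeps the sequence bounded for an infinite cover; the Lipschitz
    constant 1, uniform in j, gives continuity in the supremum norm.\<close>
  define d where "d j x = min 1 (infdist x (- B j))" for j x
  \<comment> \<open>The distance to an empty set is 0 by convention, which would destroy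
    \<open>dpos\<close>; boundedness of \<open>B j\<close> excludes this.\<close>
  have ne: "- B j \<noteq> {}" for j using B(3)[of j] not_bounded_UNIV by (metis Compl_empty_eq double_compl)
  have d0: "d j x \<ge> 0" "d j x \<le> 1" for j x by (simp_all add: d_def infdist_nonneg)
  have dpos: "d j x > 0 \<longleftrightarrow> x \<in> B j" for j x
  proof -
    have "closed (- B j)" using B(1)[of j] by (simp add: closed_def)
    then have "x \<in> - B j \<longleftrightarrow> infdist x (- B j) = 0" using ne by (rule in_closed_iff_infdist_zero)
    then show ?thesis using infdist_nonneg[of x "- B j"] by (auto simp: d_def)
  qed
  have dlip: "\<bar>d j x - d j y\<bar> \<le> dist x y" for j x y
    using infdist_triangle_abs[of x "- B j" y] by (auto simp: d_def min_def)
  define \<Phi> :: "nat \<Rightarrow> 'a \<Rightarrow> nat \<Rightarrow>\<^sub>C real" where "\<Phi> i x = Bcontfun (\<lambda>j. \<epsilon> i j * d j x)" for i x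
  have app: "apply_bcontfun (\<Phi> i x) j = \<epsilon> i j * d j x" for i x j
  proof -
    have "norm (\<epsilon> i j * d j x) \<le> 1" for j using d0 by (simp add: abs_mult \<epsilon>1)
    then have "(\<lambda>j. \<epsilon> i j * d j x) \<in> bcontfun" by (intro bcontfun_normI[of _ 1]) (auto simp: continuous_on_discrete)
    then show ?thesis by (simp add: \<Phi>_def Bcontfun_inverse)
  qed
  have cont: "continuous_on UNIV (\<Phi> i)" for i
    unfolding continuous_on_iff
  proof (intro ballI allI impI)
    fix x :: 'a and e :: real assume e: "e > 0"
    have "dist (\<Phi> i y) (\<Phi> i x) \<le> dist y x" for y
    proof (rule dist_bound)
      fix j have "dist (\<Phi> i y j) (\<Phi> i x j) = \<bar>\<epsilon> i j * (d j y - d j x)\<bar>" by (simp add: app dist_real_def algebra_simps)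
      also have "\<dots> \<le> dist y x" using dlip by (simp add: abs_mult \<epsilon>1)
      finally show "dist (\<Phi> i y j) (\<Phi> i x j) \<le> dist y x" .
    qed
    with e show "\<exists>\<delta>>0. \<forall>y\<in>UNIV. dist y x < \<delta> \<longrightarrow> dist (\<Phi> i y) (\<Phi> i x) < e" by (meson le_less_trans)
  qed
  \<comment> \<open>In coordinates j with x in \<open>B j\<close> this is the cocycle rule on a
    triple intersection; the other coordinates vanish on both sides.\<close>
  have trans: "\<Phi> k x = \<epsilon> i k *\<^sub>R \<Phi> i x" if "x \<in> B i" "x \<in> B k" for i k x
  proof (rule bcontfun_eqI)
    fix j show "\<Phi> k x j = (\<epsilon> i k *\<^sub>R \<Phi> i x) j"
    proof (cases "x \<in> B j")
      case True
      then have "\<epsilon> i k * \<epsilon> k j = \<epsilon> i j" using that by (intro \<epsilon>t) auto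
      moreover have "\<epsilon> i k * \<epsilon> i k = 1" using \<epsilon>1[of i k] by (rule sq1)
      ultimately show ?thesis by (metis app mult.assoc mult_1 scaleR_bcontfun.rep_eq real_scaleR_def)
    next
      case False
      then have "d j x = 0" using dpos[of j x] d0(1)[of j x] by simp
      then show ?thesis by (simp add: app)
    qed
  qed
  define C where "C = {(x, s *\<^sub>R \<Phi> i x) | i x s. x \<in> B i \<and> \<bar>s\<bar> = (1::real)}"
  have C_at: "\<exists>s. \<bar>s\<bar> = 1 \<and> z = s *\<^sub>R \<Phi> i x" if "(x, z) \<in> C" "x \<in> B i" for i x z
  proof -
    obtain k s where ks: "z = s *\<^sub>R \<Phi> k x" "x \<in> B k" "\<bar>s\<bar> = 1" using \<open>(x,z) \<in> C\<close> unfolding C_def by auto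
    then have "z = (s * \<epsilon> i k) *\<^sub>R \<Phi> i x" using trans[OF that(2) ks(2)] by simp
    then show ?thesis using ks(3) \<epsilon>1 by (metis abs_mult mult_1)
  qed
  have cov: "covering_space C fst \<Omega>"
  proof (rule covering_spaceI)
    show "continuous_on C fst" by (intro continuous_intros)
    have "x \<in> fst ` C" if "x \<in> \<Omega>" for x
    proof -
      obtain i where "x \<in> B i" using \<open>x \<in> \<Omega>\<close> cover by auto
      then have "(x, 1 *\<^sub>R \<Phi> i x) \<in> C" unfolding C_def by (intro CollectI exI[of _ i] exI[of _ x] exI[of _ 1]) auto
      then show ?thesis by force
    qed
    moreover have "fst ` C \<subseteq> \<Omega>" using cover by (auto simp: C_def)
    ultimately show "fst ` C = \<Omega>" by auto
    fix x assume "x \<in> \<Omega>"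
    then obtain i where i: "x \<in> B i" using cover by auto
    define u where "u s = (\<lambda>x. (x, s *\<^sub>R \<Phi> i x)) ` B i" for s :: real
    \<comment> \<open>The coordinate i of a point over \<open>B i\<close> is its sign times a
      positive number, because \<open>\<epsilon> i i = 1\<close>. So a sheet is cut out by a
      continuous strict inequality and is open.\<close>
    have u_eq: "u s = C \<inter> {q. fst q \<in> B i \<and> 0 < s * apply_bcontfun (snd q) i}" if "\<bar>s\<bar> = 1" for s
    proof (intro equalityI subsetI)
      fix q assume "q \<in> u s"
      then obtain y where y: "y \<in> B i" "q = (y, s *\<^sub>R \<Phi> i y)" by (auto simp: u_def)
      have "s * s = 1" using that by (rule sq1)
      then have "s * (s * d i y) = d i y" by (simp flip: mult.assoc)
      moreover have "0 < d i y" using y dpos by simp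
      ultimately have "0 < s * (s * d i y)" by metis
      then show "q \<in> C \<inter> {q. fst q \<in> B i \<and> 0 < s * apply_bcontfun (snd q) i}"
        using y that by (auto simp: C_def app \<epsilon>r)
    next
      fix q assume q: "q \<in> C \<inter> {q. fst q \<in> B i \<and> 0 < s * apply_bcontfun (snd q) i}"
      then obtain s' where s': "\<bar>s'\<bar> = 1" "snd q = s' *\<^sub>R \<Phi> i (fst q)" using C_at[of "fst q" "snd q" i] by auto
      have "0 < s * (s' * d i (fst q))" using q s' by (auto simp: app \<epsilon>r)
      moreover have "0 < d i (fst q)" using q dpos by auto
      ultimately have "0 < s * s'" by (metis mult.assoc zero_less_mult_pos2)
      then have "s = s'" using that s'(1) by (auto simp: abs_if split: if_splits)
      then show "q \<in> u s" using q s' by (auto simp: u_def image_iff intro!: bexI[of _ "fst q"] prod_eqI)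
    qed
    show "\<exists>T. x \<in> T \<and> openin (top_of_set \<Omega>) T \<and> (\<exists>v. \<Union> v = C \<inter> fst -` T \<and> (\<forall>u\<in>v. openin (top_of_set C) u) \<and>
         pairwise disjnt v \<and> (\<forall>u\<in>v. \<exists>q. homeomorphism u T fst q))"
    proof (intro exI[of _ "B i"] conjI exI[of _ "{u 1, u (-1)}"] ballI)
      show "x \<in> B i" by (rule i)
      show "openin (top_of_set \<Omega>) (B i)" using B(1) cover \<open>open \<Omega>\<close> by (auto simp: openin_open_eq)
      have "C \<inter> fst -` B i \<subseteq> u 1 \<union> u (-1)"
      proof
        fix q assume "q \<in> C \<inter> fst -` B i"
        then show "q \<in> u 1 \<union> u (-1)"
          using C_at[of "fst q" "snd q" i] by (cases q) (auto simp: u_def abs_if split: if_splits)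
      qed
      moreover have "u 1 \<subseteq> C \<inter> fst -` B i" "u (-1) \<subseteq> C \<inter> fst -` B i" using u_eq[of 1] u_eq[of "-1"] by auto
      ultimately show "\<Union> {u 1, u (-1)} = C \<inter> fst -` B i" unfolding Union_insert Union_empty Un_empty_right by (intro equalityI Un_least)
      show "pairwise disjnt {u 1, u (-1)}"
        using u_eq[of 1] u_eq[of "-1"] by (auto simp: pairwise_insert disjnt_def)
      fix w assume "w \<in> {u 1, u (-1)}"
      then obtain s where s: "w = u s" "\<bar>s\<bar> = 1" by auto
      have "open (B i \<times> UNIV \<inter> {q. 0 < s * apply_bcontfun (snd q) i} :: ('a \<times> (nat \<Rightarrow>\<^sub>C real)) set)"
        by (intro open_Int open_Times B open_Collect_less continuous_intros cont_eval open_UNIV)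
      then have "openin (top_of_set C) (C \<inter> (B i \<times> UNIV \<inter> {q. 0 < s * apply_bcontfun (snd q) i}))" by blast
      also have "C \<inter> (B i \<times> UNIV \<inter> {q. 0 < s * apply_bcontfun (snd q) i}) = u s"
        unfolding u_eq[OF s(2)] by auto
      finally show "openin (top_of_set C) w" by (simp add: s)
      show "\<exists>q. homeomorphism w (B i) fst q" unfolding s u_def homeomorphism_def
        by (intro exI[of _ "\<lambda>x. (x, s *\<^sub>R \<Phi> i x)"])
          (auto intro!: continuous_intros continuous_on_subset[OF cont] simp: image_image)
    qed
  qed
  have lpc: "locally path_connected \<Omega>" using \<open>open \<Omega>\<close> by (rule open_imp_locally_path_connected)
  \<comment> \<open>Lifting the identity of the simply connected set through the cover yields a
    section.\<close>
  obtain g where g: "continuous_on \<Omega> g" "g \<in> \<Omega> \<rightarrow> C" "\<And>y. y \<in> \<Omega> \<Longrightarrow> fst (g y) = y"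
    using covering_space_lift[OF cov assms(1) lpc continuous_on_id] by auto
  define z where "z x = snd (g x)" for x
  have contz: "continuous_on \<Omega> z" unfolding z_def by (intro continuous_intros g)
  have zC: "(x, z x) \<in> C" if "x \<in> \<Omega>" for x using g that by (metis PiE prod.collapse z_def)
  have sheet: "\<exists>s. \<bar>s\<bar> = 1 \<and> (\<forall>x\<in>B i. z x = s *\<^sub>R \<Phi> i x)" for i
  proof -
    \<comment> \<open>Division by \<open>d i\<close> recovers the sign of the section relative to
      \<open>\<Phi> i\<close>. It is continuous with values \<plusminus>1, hence constant on the
      connected \<open>B i\<close>.\<close>
    define f where "f x = apply_bcontfun (z x) i / d i x" for x
    have f: "\<bar>f x\<bar> = 1" "z x = f x *\<^sub>R \<Phi> i x" if x: "x \<in> B i" for x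
    proof -
      have "x \<in> \<Omega>" using x cover by auto
      from C_at[OF zC[OF this] x] obtain s where s: "\<bar>s\<bar> = 1" "z x = s *\<^sub>R \<Phi> i x" by auto
      have "d i x > 0" using x dpos by auto
      then have "f x = s" using s by (simp add: f_def app \<epsilon>r)
      with s show "\<bar>f x\<bar> = 1" "z x = f x *\<^sub>R \<Phi> i x" by auto
    qed
    have contd: "continuous_on (B i) (d i)" unfolding d_def by (intro continuous_intros)
    have contf: "continuous_on (B i) f" unfolding f_def
      using dpos[of i] cover by (intro continuous_intros contd cont_eval continuous_on_subset[OF contz]) (auto simp: less_le)
    have "f constant_on B i"
    proof (rule continuous_finite_range_constant[OF B(2) contf])
      have "f ` B i \<subseteq> {1, -1}" using f by (force simp: abs_if split: if_splits)
      then show "finite (f ` B i)" by (rule finite_subset) simp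
    qed
    then obtain s where s: "\<And>x. x \<in> B i \<Longrightarrow> f x = s" by (auto simp: constant_on_def)
    show ?thesis
    proof (cases "B i = {}")
      case False
      then show ?thesis using f s by (intro exI[of _ s]) (metis all_not_in_conv)
    qed (auto intro!: exI[of _ 1])
  qed
  then obtain c where c: "\<And>i. \<bar>c i\<bar> = (1::real)" "\<And>i x. x \<in> B i \<Longrightarrow> z x = c i *\<^sub>R \<Phi> i x" by metis
  show thesis
  proof (rule that[of c])
    fix i j assume "B i \<inter> B j \<noteq> {}"
    then obtain x where x: "x \<in> B i" "x \<in> B j" by auto
    have "c i *\<^sub>R \<Phi> i x = (c j * \<epsilon> i j) *\<^sub>R \<Phi> i x" by (metis c(2) trans[OF x] x scaleR_scaleR)
    then have "apply_bcontfun (c i *\<^sub>R \<Phi> i x) i = apply_bcontfun ((c j * \<epsilon> i j) *\<^sub>R \<Phi> i x) i" by (rule arg_cong)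
    then have "c i * d i x = c j * \<epsilon> i j * d i x"
      unfolding scaleR_bcontfun.rep_eq app \<epsilon>r real_scaleR_def by simp
    moreover have "d i x > 0" using x dpos by auto
    ultimately show "c i = \<epsilon> i j * c j" by simp
  qed (rule c)
qed

subsection \<open>Difference quotients of a lift\<close>

lemma norm_matrix_vector_mult_le:
  fixes A :: "real^'k^'l" and x :: "real^'k"
  shows "norm (A *v x) \<le> norm A * norm x"
proof -
  have "norm (A *v x) = L2_set (\<lambda>i. norm ((A *v x) $ i)) UNIV" by (simp add: norm_vec_def)
  also have "\<dots> \<le> L2_set (\<lambda>i. norm (A $ i) * norm x) UNIV"
  proof (rule L2_set_mono)
    fix i
    have "(A *v x) $ i = A $ i \<bullet> x" by (simp add: matrix_vector_mult_def inner_vec_def)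
    then show "norm ((A *v x) $ i) \<le> norm (A $ i) * norm x" using Cauchy_Schwarz_ineq2 by simp
  qed simp
  also have "\<dots> = norm A * norm x" by (simp add: norm_vec_def[of A] L2_set_left_distrib)
  finally show ?thesis .
qed

lemma tensor_mult_vec: "(a \<otimes> b) *v x = (b \<bullet> x) *\<^sub>R a"
  by (simp add: tensor_def matrix_vector_mult_def vec_eq_iff inner_vec_def sum_distrib_left mult_ac)

text \<open>To first order, a unit field \<open>m\<close> obeys \<open>dm = (d(m \<otimes> m)) m\<close>.\<close>

lemma unit_increment:
  fixes a b :: "real^'k"
  assumes "norm a = 1" "norm b = 1"
  shows "b - a = (b \<otimes> b - a \<otimes> a) *v a + ((norm (b - a))\<^sup>2 / 2) *\<^sub>R b"
proof -
  \<comment> \<open>Since (b \<otimes> b - a \<otimes> a) a = (b \<bullet> a) b - a, the exact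
    remainder is (1 - b \<bullet> a) b.\<close>
  have "(norm (b - a))\<^sup>2 / 2 = 1 - b \<bullet> a" using norm_diff_sq_unit[OF assms(2,1)] by simp
  moreover have "a \<bullet> a = 1" using assms by (simp add: norm_eq_1)
  ultimately show ?thesis
    by (simp only: matrix_vector_mult_diff_rdistrib tensor_mult_vec scaleR_diff_left) simp
qed

lemma dir_deriv_Basis: "e \<in> Basis \<Longrightarrow> dir_deriv g e x = g e x"
proof -
  assume e: "e \<in> Basis"
  have "dir_deriv g e x = (\<Sum>e'\<in>Basis. if e' = e then g e x else 0)"
    unfolding dir_deriv_def using e by (intro sum.cong refl) (auto simp: inner_Basis)
  then show ?thesis using e by simp
qed

text \<open>Fubini bounds the norm of the average by the average over s of the L1 translation
  modulus \<open>T\<close>, which tends to 0 pointwise and is at most twice the L1 norm of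
  \<open>g\<close>.\<close>

lemma translation_average_tendsto:
  fixes g :: "'a::euclidean_space \<Rightarrow> 'b::euclidean_space" and h :: "nat \<Rightarrow> real"
  assumes g: "integrable lborel g" and h: "h \<longlonglongrightarrow> 0"
  shows "(\<lambda>l. LINT x|lborel. norm (LBINT s. indicator {0..1::real} s *\<^sub>R (g (x + s *\<^sub>R (h l *\<^sub>R e)) - g x))) \<longlonglongrightarrow> 0"
proof -
  have [measurable]: "g \<in> borel_measurable borel" using borel_measurable_integrable[OF g] by simp
  define T where "T r = (LBINT x. norm (g (x + r *\<^sub>R e) - g x))" for r
  have [measurable]: "T \<in> borel_measurable borel" unfolding T_def by measurable
  have T0: "0 \<le> T r" for r by (simp add: T_def)
  have Tb: "T r \<le> 2 * (LBINT x. norm (g x))" for r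
  proof -
    have "T r \<le> (LBINT x. norm (g (x + r *\<^sub>R e)) + norm (g x))"
      unfolding T_def using g
      by (intro integral_mono integrable_norm Bochner_Integration.integrable_diff Bochner_Integration.integrable_add
          lborel_integrable_translate norm_triangle_ineq4)
    also have "\<dots> = (LBINT x. norm (g (x + r *\<^sub>R e))) + (LBINT x. norm (g x))"
      using g by (intro Bochner_Integration.integral_add integrable_norm lborel_integrable_translate)
    also have "(LBINT x. norm (g (x + r *\<^sub>R e))) = (LBINT x. norm (g x))"
      by (rule lborel_integral_translate) measurable
    finally show ?thesis by simp
  qed
  have "(\<lambda>l. LINT s|lborel. indicator {0..1::real} s * T (s * h l)) \<longlonglongrightarrow> (LBINT s::real. (0::real))"
  proof (rule integral_dominated_convergence)
    show "integrable lborel (\<lambda>s::real. indicator {0..1} s * (2 * (LBINT x. norm (g x))))"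
      by (intro integrable_mult_left integrable_real_indicator) auto
    show "AE s::real in lborel. (\<lambda>l. indicator {0..1} s * T (s * h l)) \<longlonglongrightarrow> 0"
    proof (rule AE_I2)
      fix s :: real
      have "(\<lambda>l. (s * h l) *\<^sub>R e) \<longlonglongrightarrow> (s * 0) *\<^sub>R e" by (intro tendsto_intros h)
      then have "(\<lambda>l. (s * h l) *\<^sub>R e) \<longlonglongrightarrow> 0" by simp
      from L1_translation[OF g this] have "(\<lambda>l. T (s * h l)) \<longlonglongrightarrow> 0" by (simp only: T_def)
      from tendsto_mult_left[OF this, of "indicator {0..1} s"]
      show "(\<lambda>l. indicator {0..1} s * T (s * h l)) \<longlonglongrightarrow> 0" by simp
    qed
    show "AE s::real in lborel. norm (indicator {0..1} s * T (s * h l)) \<le> indicator {0..1} s * (2 * (LBINT x. norm (g x)))" for l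
      using T0 Tb by (intro AE_I2) (simp add: abs_mult mult_left_mono)
  qed measurable
  then have lim: "(\<lambda>l. LINT s|lborel. indicator {0..1::real} s * T (s * h l)) \<longlonglongrightarrow> 0" by simp
  have le: "(LBINT x. norm (LBINT s. indicator {0..1::real} s *\<^sub>R (g (x + s *\<^sub>R (h l *\<^sub>R e)) - g x)))
    \<le> (LBINT s. indicator {0..1::real} s * T (s * h l))" for l
  proof -
    let ?F = "\<lambda>(s::real) x. indicator {0..1::real} s *\<^sub>R (g (x + s *\<^sub>R (h l *\<^sub>R e)) - g x)"
    have F: "integrable (lborel \<Otimes>\<^sub>M lborel) (\<lambda>(s, x). ?F s x)"
      using Bochner_Integration.integrable_diff[OF integrable_segment_average[OF g, of "h l *\<^sub>R e"] integrable_segment_average[OF g, of 0]]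
      by (simp add: scaleR_diff_right case_prod_beta')
    then have nF: "integrable (lborel \<Otimes>\<^sub>M lborel) (\<lambda>(s, x). norm (?F s x))"
      using integrable_norm[OF F] by (simp add: case_prod_beta')
    have "(LBINT x. norm (LBINT s. ?F s x)) \<le> (LBINT x. LINT s|lborel. norm (?F s x))"
      by (intro integral_mono integrable_norm lborel_pair.integrable_snd[OF F] lborel_pair.integrable_snd[OF nF] integral_norm_bound)
    also have "\<dots> = (LBINT s. LINT x|lborel. norm (?F s x))" by (rule lborel_pair.Fubini_integral[OF nF])
    also have "\<dots> = (LBINT s. indicator {0..1::real} s * T (s * h l))"
      by (simp add: T_def)
    finally show ?thesis .
  qed
  show ?thesis
    by (rule tendsto_sandwich[OF _ _ tendsto_const lim]) (intro always_eventually allI le Bochner_Integration.integral_nonneg norm_ge_zero)+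
qed

lemma test_function_increment:
  assumes \<phi>: "test_function \<Omega> \<phi>" and h: "h > 0"
  obtains z where "0 < z" "z < h" "\<phi> x - \<phi> (x - h *\<^sub>R e) = h * frechet_derivative \<phi> (at (x - h *\<^sub>R e + z *\<^sub>R e)) e"
proof -
  note tf = test_functionD[OF \<phi>]
  have "((\<lambda>s. \<phi> (x - h *\<^sub>R e + s *\<^sub>R e)) has_real_derivative frechet_derivative \<phi> (at (x - h *\<^sub>R e + s *\<^sub>R e)) e) (at s)" for s :: real
  proof -
    have "((\<lambda>s. x - h *\<^sub>R e + s *\<^sub>R e) has_derivative (\<lambda>r. r *\<^sub>R e)) (at s)" by (auto intro!: derivative_eq_intros)
    moreover have "(\<phi> has_derivative frechet_derivative \<phi> (at y)) (at y)" for y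
      using tf(2) frechet_derivative_works by blast
    ultimately have "((\<lambda>s. \<phi> (x - h *\<^sub>R e + s *\<^sub>R e)) has_derivative (\<lambda>r. frechet_derivative \<phi> (at (x - h *\<^sub>R e + s *\<^sub>R e)) (r *\<^sub>R e))) (at s)"
      by (rule has_derivative_compose)
    then show ?thesis
      unfolding has_field_derivative_def linear_cmul[OF linear_frechet_derivative[OF tf(2)]] by (simp add: mult_commute_abs)
  qed
  from MVT2[OF h this] obtain z where "0 < z" "z < h" "\<phi> (x - h *\<^sub>R e + h *\<^sub>R e) - \<phi> (x - h *\<^sub>R e + 0 *\<^sub>R e) = (h - 0) * frechet_derivative \<phi> (at (x - h *\<^sub>R e + z *\<^sub>R e)) e"
    by blast
  then show thesis by (intro that) simp_all
qed

text \<open>By the mean value theorem the quotient is a value of the derivative at a nearby point.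
  This gives both the pointwise limit and a uniform bound for dominated convergence.\<close>

lemma test_function_quotient_tendsto:
  fixes m :: "'a::euclidean_space \<Rightarrow> 'b::euclidean_space"
  assumes \<phi>: "test_function \<Omega> \<phi>" and m: "m \<in> borel_measurable borel" "\<And>x. norm (m x) = 1" and e: "norm e = 1"
  shows "(\<lambda>l. LINT x|lborel. ((\<phi> x - \<phi> (x - (1 / 2 ^ l) *\<^sub>R e)) * 2 ^ l) *\<^sub>R m x) \<longlonglongrightarrow> (LBINT x. frechet_derivative \<phi> (at x) e *\<^sub>R m x)"
proof -
  note tf = test_functionD[OF \<phi>]
  define d where "d x = frechet_derivative \<phi> (at x) e" for x
  have contd: "continuous_on UNIV d" unfolding d_def by (rule tf(5))
  have [measurable]: "\<phi> \<in> borel_measurable borel" "d \<in> borel_measurable borel"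
    using tf(1) contd by (auto intro: borel_measurable_continuous_onI)
  note m(1) [measurable]
  define K where "K = closure {x. \<phi> x \<noteq> 0}"
  have K0: "\<phi> x = 0" "d x = 0" if "x \<notin> K" for x using tf(6,7) that unfolding K_def d_def by blast+
  obtain B where B: "B > 0" "\<And>x. \<bar>d x\<bar> \<le> B"
    using continuous_compact_support_bounded[OF contd tf(3)] K0(2) unfolding K_def by blast
  \<comment> \<open>All steps 2^-l have length at most 1, so the unit neighbourhood of the support
    contains the supports of all quotients.\<close>
  define S where "S = {x + y | x y. x \<in> K \<and> y \<in> cball (0::'a) 1}"
  have S: "compact S" unfolding S_def K_def by (intro compact_sums tf(3) compact_cball)
  define D where "D l x = (\<phi> x - \<phi> (x - (1 / 2 ^ l) *\<^sub>R e)) * 2 ^ l" for l x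
  have [measurable]: "D l \<in> borel_measurable borel" for l unfolding D_def by measurable
  have mvt: "\<exists>z. 0 < z \<and> z < 1 / 2 ^ l \<and> D l x = d (x - (1 / 2 ^ l) *\<^sub>R e + z *\<^sub>R e)" for x l
  proof -
    have "(0::real) < 1 / 2 ^ l" by simp
    from test_function_increment[OF \<phi> this, of x e] obtain z where
      "0 < z" "z < 1 / 2 ^ l" "\<phi> x - \<phi> (x - (1 / 2 ^ l) *\<^sub>R e) = (1 / 2 ^ l) * d (x - (1 / 2 ^ l) *\<^sub>R e + z *\<^sub>R e)"
      unfolding d_def by blast
    then show ?thesis by (intro exI[of _ z]) (simp add: D_def)
  qed
  have "(\<lambda>l. LINT x|lborel. D l x *\<^sub>R m x) \<longlonglongrightarrow> (LBINT x. d x *\<^sub>R m x)"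
  proof (rule integral_dominated_convergence)
    show "integrable lborel (\<lambda>x. B * indicator S x)"
      by (intro integrable_mult_right integrable_indicator_compact S)
    show "AE x in lborel. (\<lambda>l. D l x *\<^sub>R m x) \<longlonglongrightarrow> d x *\<^sub>R m x"
    proof (intro AE_I2 tendsto_scaleR tendsto_const)
      fix x
      have "\<forall>l. \<exists>z. 0 < z \<and> z < 1 / 2 ^ l \<and> D l x = d (x - (1 / 2 ^ l) *\<^sub>R e + z *\<^sub>R e)"
        using mvt by blast
      from choice[OF this] obtain z where
        z: "\<And>l. 0 < z l \<and> z l < 1 / 2 ^ l \<and> D l x = d (x - (1 / 2 ^ l) *\<^sub>R e + z l *\<^sub>R e)"
        by blast
      have h: "(\<lambda>l. 1 / 2 ^ l :: real) \<longlonglongrightarrow> 0" using LIMSEQ_realpow_zero[of "1/2::real"] by (simp add: power_one_over)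
      have "z \<longlonglongrightarrow> 0"
        by (rule tendsto_sandwich[OF _ _ tendsto_const h]) (use z in \<open>auto intro!: always_eventually less_imp_le\<close>)
      then have "(\<lambda>l. x - (1 / 2 ^ l) *\<^sub>R e + z l *\<^sub>R e) \<longlonglongrightarrow> x - 0 *\<^sub>R e + 0 *\<^sub>R e" by (intro tendsto_intros h)
      then have lx: "(\<lambda>l. x - (1 / 2 ^ l) *\<^sub>R e + z l *\<^sub>R e) \<longlonglongrightarrow> x" by simp
      have "isCont d x" using contd by (simp add: continuous_on_eq_continuous_at)
      from isCont_tendsto_compose[OF this lx] show "(\<lambda>l. D l x) \<longlonglongrightarrow> d x"
        using z by simp
    qed
    show "AE x in lborel. norm (D l x *\<^sub>R m x) \<le> B * indicator S x" for l
    proof (rule AE_I2)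
      fix x
      obtain z where z: "D l x = d (x - (1 / 2 ^ l) *\<^sub>R e + z *\<^sub>R e)" using mvt by metis
      show "norm (D l x *\<^sub>R m x) \<le> B * indicator S x"
      proof (cases "x \<in> S")
        case True
        then show ?thesis using B(2)[of "x - (1 / 2 ^ l) *\<^sub>R e + z *\<^sub>R e"] by (simp only: z norm_scaleR m(2)) simp
      next
        case False
        have "x \<notin> K"
        proof
          assume "x \<in> K" then have "x + 0 \<in> S" unfolding S_def by (intro CollectI exI[of _ x] exI[of _ 0]) simp
          with False show False by simp
        qed
        moreover have "x - (1 / 2 ^ l) *\<^sub>R e \<notin> K"
        proof
          assume "x - (1 / 2 ^ l) *\<^sub>R e \<in> K"
          moreover have "norm ((1 / 2 ^ l) *\<^sub>R e) \<le> 1" using e by simp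
          ultimately have "(x - (1 / 2 ^ l) *\<^sub>R e) + (1 / 2 ^ l) *\<^sub>R e \<in> S" unfolding S_def by (intro CollectI exI conjI refl) auto
          with False show False by simp
        qed
        ultimately show ?thesis using False K0(1) by (simp add: D_def)
      qed
    qed
  qed measurable
  then show ?thesis by (simp add: d_def D_def)
qed

lemma borel_measurable_matrix_vector_mult [measurable (raw)]:
  fixes A :: "'a \<Rightarrow> real^'k^'l" and x :: "'a \<Rightarrow> real^'k"
  assumes "A \<in> borel_measurable M" "x \<in> borel_measurable M"
  shows "(\<lambda>w. A w *v x w) \<in> borel_measurable M"
proof (rule borel_measurable_continuous_Pair[OF assms])
  show "continuous_on UNIV (\<lambda>p. fst p *v snd p :: real^'l)"
    unfolding matrix_vector_mult_def by (intro continuous_on_vec_lambda continuous_intros)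
qed

text \<open>Half of the distance margin of \<open>K\<close> makes an open neighbourhood
  \<open>V\<close>, the other half is left for the segment. \<open>V\<close> is open as the
  increment lemmas demand.\<close>

lemma compact_segment_margin:
  fixes K :: "'a::euclidean_space set"
  assumes K: "compact K" "open \<Omega>" "K \<subseteq> \<Omega>" and e: "norm e = 1"
  obtains V L where "open V" "K \<subseteq> V"
    "\<And>l x s. l \<ge> L \<Longrightarrow> x \<in> V \<Longrightarrow> 0 \<le> s \<Longrightarrow> s \<le> 1 \<Longrightarrow> x + s *\<^sub>R ((1 / 2 ^ l) *\<^sub>R e) \<in> \<Omega>"
proof -
  obtain r where r: "r > 0" "(\<Union>x\<in>K. ball x r) \<subseteq> \<Omega>" by (rule compact_subset_open_imp_ball_epsilon_subset[OF K])
  obtain L where L: "(1/2::real) ^ L < r / 2" using real_arch_pow_inv[of "r / 2" "1/2"] r(1) by auto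
  show thesis
  proof (rule that[of "\<Union>x\<in>K. ball x (r / 2)" L])
    show "open (\<Union>x\<in>K. ball x (r / 2))" by (intro open_UN ballI open_ball)
    show "K \<subseteq> (\<Union>x\<in>K. ball x (r / 2))" using r(1) by force
    fix l x and s :: real assume l: "l \<ge> L" and x: "x \<in> (\<Union>x\<in>K. ball x (r / 2))" and s: "0 \<le> s" "s \<le> 1"
    from x obtain y where y: "y \<in> K" "dist y x < r / 2" by auto
    have "(1/2::real) ^ l \<le> (1/2) ^ L" using l by (intro power_decreasing) auto
    then have h: "1 / 2 ^ l < r / 2" using L by (simp add: power_one_over)
    have "dist x (x + s *\<^sub>R ((1 / 2 ^ l) *\<^sub>R e)) = s * (1 / 2 ^ l)" using s e by (simp add: dist_norm)
    also have "\<dots> \<le> 1 * (1 / 2 ^ l)" using s by (intro mult_right_mono) auto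
    also have "\<dots> < r / 2" using h by simp
    finally have "dist y (x + s *\<^sub>R ((1 / 2 ^ l) *\<^sub>R e)) < r"
      using y(2) dist_triangle[of y "x + s *\<^sub>R ((1 / 2 ^ l) *\<^sub>R e)" x] by linarith
    then show "x + s *\<^sub>R ((1 / 2 ^ l) *\<^sub>R e) \<in> \<Omega>" using y(1) r(2) by (auto simp: subset_iff)
  qed
qed

lemma tendsto_half_power: "(\<lambda>l. 1 / 2 ^ l :: real) \<longlonglongrightarrow> 0"
  using LIMSEQ_realpow_zero[of "1/2::real"] by (simp add: power_one_over)

context
  fixes \<Omega> :: "'a::euclidean_space set" and m :: "'a \<Rightarrow> real^'k" and g and e :: 'a
  assumes wg: "weak_gradient \<Omega> (\<lambda>x. m x \<otimes> m x) g" and \<Omega>: "open \<Omega>" and e: "e \<in> Basis"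
    and m_unit: "\<And>x. norm (m x) = 1" and m_meas: "m \<in> borel_measurable borel"
begin

text \<open>By \<open>unit_increment\<close> the remainder splits into a linear part, governed by L1
  continuity of translations of \<open>g e\<close>, and a quadratic part. Where the sign is
  preserved the latter is bounded by the increment of the tensor square, of order h^2 in integral;
  the flips add o(h). Division by h leaves o(1).\<close>

lemma difference_quotient_remainder:
  assumes K: "compact K" "K \<subseteq> \<Omega>"
    and small: "(\<lambda>l. 2 ^ l * measure lborel {x\<in>K. m x \<bullet> m (x + (1 / 2 ^ l) *\<^sub>R e) < 0}) \<longlonglongrightarrow> 0"
  shows "(\<lambda>l. LINT x|lborel. indicator K x * norm (2 ^ l *\<^sub>R (m (x + (1 / 2 ^ l) *\<^sub>R e) - m x) - g e x *v m x)) \<longlonglongrightarrow> 0"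
proof -
  note [measurable] = m_meas weak_gradientD(1)[OF wg] weak_gradientD(3)[OF wg e]
  have ne: "norm e = 1" using e by simp
  have ig: "integrable lborel (g e)" by (rule weak_gradientD(4)[OF wg e])
  obtain V L where V: "open V" "K \<subseteq> V"
    and seg: "\<And>l x s. l \<ge> L \<Longrightarrow> x \<in> V \<Longrightarrow> 0 \<le> s \<Longrightarrow> s \<le> 1 \<Longrightarrow> x + s *\<^sub>R ((1 / 2 ^ l) *\<^sub>R e) \<in> \<Omega>"
    by (rule compact_segment_margin[OF K(1) \<Omega> K(2) ne]) blast
  have [measurable]: "K \<in> sets borel" using K by (simp add: compact_imp_closed)
  have [measurable]: "V \<in> sets borel" using V by simp
  define G where "G = (LBINT x. (norm (g e x))\<^sup>2)"
  define h :: "nat \<Rightarrow> real" where "h l = 1 / 2 ^ l" for l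
  have h: "h l > 0" "2 ^ l * h l = 1" for l by (simp_all add: h_def)
  \<comment> \<open>The error of replacing the gradient averaged over the step by its value at the
    starting point.\<close>
  define A where "A l x = (LBINT s. indicator {0..1::real} s *\<^sub>R (g e (x + s *\<^sub>R (h l *\<^sub>R e)) - g e x))" for l x
  define E where "E l = {x\<in>K. m x \<bullet> m (x + h l *\<^sub>R e) < 0}" for l
  define q where "q l x = indicator K x * (norm (m (x + h l *\<^sub>R e) - m x))\<^sup>2" for l x
  define Y where "Y l x = indicator K x * norm (2 ^ l *\<^sub>R (m (x + h l *\<^sub>R e) - m x) - g e x *v m x)" for l x
  have [measurable]: "E l \<in> sets borel" for l unfolding E_def by measurable
  have [measurable]: "q l \<in> borel_measurable borel" "Y l \<in> borel_measurable borel" for l unfolding q_def Y_def by measurable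
  have Kfin: "emeasure lborel K < \<infinity>" using emeasure_compact_finite[OF K(1)] by simp
  have Efin: "emeasure lborel (E l) < \<infinity>" for l
    using emeasure_mono[of "E l" K lborel] Kfin by (auto simp: E_def intro: le_less_trans)
  have iK: "integrable lborel (\<lambda>x. indicator K x * c :: real)" for c
    by (intro integrable_mult_left integrable_indicator_compact K)
  have dm: "norm (m y - m x) \<le> 2" for x y using norm_triangle_ineq4[of "m y" "m x"] m_unit by simp
  have iq: "integrable lborel (q l)" for l
  proof (rule Bochner_Integration.integrable_bound[OF iK[of 4]])
    have "(norm (m y - m x))\<^sup>2 \<le> 2\<^sup>2" for x y using dm by (intro power_mono) auto
    then show "AE x in lborel. norm (q l x) \<le> norm (indicator K x * (4::real))"
      by (intro AE_I2) (simp add: q_def indicator_def)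
  qed measurable
  have iA: "integrable lborel (\<lambda>x. norm (A l x))" for l
  proof -
    have "integrable (lborel \<Otimes>\<^sub>M lborel) (\<lambda>(s::real, x). indicator {0..1} s *\<^sub>R (g e (x + s *\<^sub>R (h l *\<^sub>R e)) - g e x))"
      using Bochner_Integration.integrable_diff[OF integrable_segment_average[OF ig, of "h l *\<^sub>R e"] integrable_segment_average[OF ig, of 0]]
      by (simp add: scaleR_diff_right case_prod_beta')
    from lborel_pair.integrable_snd[OF this] show ?thesis unfolding A_def by (rule integrable_norm)
  qed
  have YK: "norm (Y l x) \<le> norm (indicator K x * (2 ^ l * 2) + norm (g e x))" for l x
  proof -
    have "norm (2 ^ l *\<^sub>R (m (x + h l *\<^sub>R e) - m x)) \<le> 2 ^ l * 2"
      unfolding norm_scaleR using dm[of "x + h l *\<^sub>R e" x] by (intro mult_mono) auto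
    then have "norm (2 ^ l *\<^sub>R (m (x + h l *\<^sub>R e) - m x) - g e x *v m x) \<le> 2 ^ l * 2 + norm (g e x)"
      using norm_triangle_ineq4[of "2 ^ l *\<^sub>R (m (x + h l *\<^sub>R e) - m x)" "g e x *v m x"]
        norm_matrix_vector_mult_le[of "g e x" "m x"] unfolding m_unit mult_1_right by linarith
    then show ?thesis by (simp add: Y_def indicator_def)
  qed
  have iY: "integrable lborel (Y l)" for l
    by (rule Bochner_Integration.integrable_bound[OF Bochner_Integration.integrable_add[OF iK[of "2 ^ l * 2"] integrable_norm[OF ig]] _ AE_I2[OF YK]]) measurable
  \<comment> \<open>The factor 2^l/2 in front of the quadratic term turns h^2 G into hG/2 and the
    flip measure into 2 * 2^l times itself.\<close>
  have main: "(LBINT x. Y l x) \<le> (LBINT x. norm (A l x)) + (h l * G / 2 + 2 * (2 ^ l * measure lborel (E l)))" if l: "l \<ge> L" for l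
  proof -
    have sub: "x + s *\<^sub>R (h l *\<^sub>R e) \<in> \<Omega>" if "x \<in> V" "0 \<le> s" "s \<le> 1" for x s
      using seg[OF l that] by (simp only: h_def)
    have inc: "AE x in lborel. x \<in> V \<longrightarrow> m (x + h l *\<^sub>R e) \<otimes> m (x + h l *\<^sub>R e) - m x \<otimes> m x
      = segment_integral (dir_deriv g (h l *\<^sub>R e)) (h l *\<^sub>R e) x"
      by (rule AE_increment[OF wg V(1)]) (rule sub)
    have fub: "AE x in lborel. integrable lborel (\<lambda>s. indicator {0..1::real} s *\<^sub>R g e (x + s *\<^sub>R (h l *\<^sub>R e)))"
      by (rule lborel_pair.AE_integrable_snd[OF integrable_segment_average[OF ig]])
    have "(LBINT x. Y l x) \<le> (LBINT x. norm (A l x) + (2 ^ l / 2) * q l x)"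
    proof (rule integral_mono_AE)
      show "AE x in lborel. Y l x \<le> norm (A l x) + (2 ^ l / 2) * q l x"
        using inc fub
      proof eventually_elim
        case (elim x)
        show ?case
        proof (cases "x \<in> K")
          case True
          let ?y = "x + h l *\<^sub>R e"
          let ?D = "m ?y \<otimes> m ?y - m x \<otimes> m x"
          have "?D = segment_integral (dir_deriv g (h l *\<^sub>R e)) (h l *\<^sub>R e) x"
            using elim True V(2) by blast
          also have "\<dots> = (LBINT s. h l *\<^sub>R (indicator {0..1::real} s *\<^sub>R g e (x + s *\<^sub>R (h l *\<^sub>R e))))"
            by (simp only: dir_deriv_scale[OF wg] dir_deriv_Basis[OF e] scaleR_left_commute)
          also have "\<dots> = h l *\<^sub>R segment_integral (g e) (h l *\<^sub>R e) x"
            by (rule integral_scaleR_right)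
          finally have "2 ^ l *\<^sub>R ?D = segment_integral (g e) (h l *\<^sub>R e) x"
            using h(2)[of l] by simp
          moreover have "A l x = segment_integral (g e) (h l *\<^sub>R e) x - g e x"
          proof -
            have "A l x = segment_integral (g e) (h l *\<^sub>R e) x - (LBINT s. indicator {0..1::real} s *\<^sub>R g e x)"
              unfolding A_def scaleR_diff_right
              by (intro Bochner_Integration.integral_diff elim(2) integrable_scaleR_left integrable_real_indicator) auto
            also have "(LBINT s. indicator {0..1::real} s *\<^sub>R g e x) = g e x" by simp
            finally show ?thesis .
          qed
          ultimately have A: "2 ^ l *\<^sub>R ?D - g e x = A l x" by simp
          have "2 ^ l *\<^sub>R (m ?y - m x) - g e x *v m x
            = (2 ^ l *\<^sub>R ?D - g e x) *v m x + (2 ^ l * ((norm (m ?y - m x))\<^sup>2 / 2)) *\<^sub>R m ?y"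
            by (subst unit_increment[OF m_unit m_unit])
              (simp add: matrix_vector_mult_diff_rdistrib scaleR_right_distrib scaleR_matrix_vector_assoc algebra_simps)
          then have "norm (2 ^ l *\<^sub>R (m ?y - m x) - g e x *v m x)
            \<le> norm (A l x *v m x) + norm ((2 ^ l * ((norm (m ?y - m x))\<^sup>2 / 2)) *\<^sub>R m ?y)"
            unfolding A by (metis norm_triangle_ineq)
          also have "\<dots> \<le> norm (A l x) + 2 ^ l / 2 * (norm (m ?y - m x))\<^sup>2"
            using norm_matrix_vector_mult_le[of "A l x" "m x"] m_unit by simp
          finally show ?thesis using True by (simp add: Y_def q_def)
        next
          case False
          then show ?thesis by (simp add: Y_def q_def)
        qed
      qed
      show "integrable lborel (\<lambda>x. norm (A l x) + (2 ^ l / 2) * q l x)"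
        by (intro Bochner_Integration.integrable_add iA integrable_mult_right iq)
    qed (rule iY)
    also have "\<dots> = (LBINT x. norm (A l x)) + (2 ^ l / 2) * (LBINT x. q l x)"
      using iA iq by simp
    \<comment> \<open>Off \<open>E l\<close> the increment of \<open>m\<close> is at most that of
      its tensor square; on \<open>E l\<close> its square is at most 2^2 = 4.\<close>
    also have "(LBINT x. q l x) \<le> (h l)\<^sup>2 * G + 4 * measure lborel (E l)"
    proof (rule integral_real_bounded)
      have G0: "0 \<le> G" unfolding G_def by simp
      then show "0 \<le> (h l)\<^sup>2 * G + 4 * measure lborel (E l)" by simp
      have "(\<integral>\<^sup>+x. ennreal (q l x) \<partial>lborel)
        \<le> (\<integral>\<^sup>+x. indicator V x * ennreal ((norm (m (x + h l *\<^sub>R e) \<otimes> m (x + h l *\<^sub>R e) - m x \<otimes> m x))\<^sup>2) + ennreal 4 * indicator (E l) x \<partial>lborel)"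
      proof (rule nn_integral_mono)
        fix x
        let ?y = "x + h l *\<^sub>R e"
        show "ennreal (q l x) \<le> indicator V x * ennreal ((norm (m ?y \<otimes> m ?y - m x \<otimes> m x))\<^sup>2) + ennreal 4 * indicator (E l) x"
        proof (cases "x \<in> K")
          case True
          then have xV: "x \<in> V" using V(2) by blast
          show ?thesis
          proof (cases "m x \<bullet> m ?y < 0")
            case neg: True
            have "(norm (m ?y - m x))\<^sup>2 \<le> 2\<^sup>2" using dm by (intro power_mono) auto
            then have "ennreal (q l x) \<le> ennreal 4" using True by (intro ennreal_leI) (simp add: q_def)
            also have "\<dots> = ennreal 4 * indicator (E l) x" using True neg by (simp add: E_def)
            also have "\<dots> \<le> indicator V x * ennreal ((norm (m ?y \<otimes> m ?y - m x \<otimes> m x))\<^sup>2) + ennreal 4 * indicator (E l) x"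
              by (rule add_increasing) simp_all
            finally show ?thesis .
          next
            case False
            then have "norm (m ?y - m x) \<le> norm (m ?y \<otimes> m ?y - m x \<otimes> m x)"
              by (intro norm_diff_le_tensor m_unit) (simp add: inner_commute)
            then have "ennreal (q l x) \<le> ennreal ((norm (m ?y \<otimes> m ?y - m x \<otimes> m x))\<^sup>2)"
              using True by (intro ennreal_leI) (simp add: q_def power_mono)
            also have "\<dots> = indicator V x * ennreal ((norm (m ?y \<otimes> m ?y - m x \<otimes> m x))\<^sup>2)" using xV by simp
            also have "\<dots> \<le> \<dots> + ennreal 4 * indicator (E l) x" by (rule add_increasing2) simp_all
            finally show ?thesis .
          qed
        qed (simp add: q_def)
      qed
      also have "\<dots> = (\<integral>\<^sup>+x. indicator V x * ennreal ((norm (m (x + h l *\<^sub>R e) \<otimes> m (x + h l *\<^sub>R e) - m x \<otimes> m x))\<^sup>2) \<partial>lborel)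
          + ennreal 4 * emeasure lborel (E l)"
        by (subst nn_integral_add) (auto simp: nn_integral_cmult_indicator)
      also have "\<dots> \<le> (\<integral>\<^sup>+x. ennreal ((norm (dir_deriv g (h l *\<^sub>R e) x))\<^sup>2) \<partial>lborel) + ennreal 4 * emeasure lborel (E l)"
        by (intro add_right_mono increment_square_bound[OF wg V(1)] sub)
      also have "(\<integral>\<^sup>+x. ennreal ((norm (dir_deriv g (h l *\<^sub>R e) x))\<^sup>2) \<partial>lborel) = ennreal ((h l)\<^sup>2 * G)"
      proof -
        have "(\<integral>\<^sup>+x. ennreal ((norm (dir_deriv g (h l *\<^sub>R e) x))\<^sup>2) \<partial>lborel) = (\<integral>\<^sup>+x. ennreal ((h l)\<^sup>2 * (norm (g e x))\<^sup>2) \<partial>lborel)"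
          by (simp add: dir_deriv_scale[OF wg] dir_deriv_Basis[OF e] power_mult_distrib)
        also have "\<dots> = ennreal (LBINT x. (h l)\<^sup>2 * (norm (g e x))\<^sup>2)"
          using weak_gradientD(5)[OF wg e] by (intro nn_integral_eq_integral integrable_mult_right) auto
        also have "(LBINT x. (h l)\<^sup>2 * (norm (g e x))\<^sup>2) = (h l)\<^sup>2 * G" by (simp add: G_def)
        finally show ?thesis .
      qed
      also have "emeasure lborel (E l) = ennreal (measure lborel (E l))"
        using Efin[of l] by (intro emeasure_eq_ennreal_measure) auto
      also have "ennreal ((h l)\<^sup>2 * G) + ennreal 4 * ennreal (measure lborel (E l)) = ennreal ((h l)\<^sup>2 * G + 4 * measure lborel (E l))"
        using G0 by (subst ennreal_plus) (auto simp: ennreal_mult)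
      finally show "(\<integral>\<^sup>+x. ennreal (q l x) \<partial>lborel) \<le> ennreal ((h l)\<^sup>2 * G + 4 * measure lborel (E l))" .
    qed
    also have "2 ^ l / 2 * ((h l)\<^sup>2 * G + 4 * measure lborel (E l)) = (2 ^ l * h l) * h l * G / 2 + 2 * (2 ^ l * measure lborel (E l))"
      by (simp add: algebra_simps power2_eq_square)
    finally show ?thesis by (simp add: h(2))
  qed
  have lim: "(\<lambda>l. (LBINT x. norm (A l x)) + (h l * G / 2 + 2 * (2 ^ l * measure lborel (E l)))) \<longlonglongrightarrow> 0 + (0 * G / 2 + 2 * 0)"
    unfolding A_def
  proof (intro tendsto_add tendsto_mult tendsto_divide tendsto_const)
    show "h \<longlonglongrightarrow> 0" unfolding h_def by (rule tendsto_half_power)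
    then show "(\<lambda>l. LINT x|lborel. norm (LBINT s. indicator {0..1::real} s *\<^sub>R (g e (x + s *\<^sub>R (h l *\<^sub>R e)) - g e x))) \<longlonglongrightarrow> 0"
      by (rule translation_average_tendsto[OF ig])
    show "(\<lambda>l. 2 ^ l * measure lborel (E l)) \<longlonglongrightarrow> 0" using small by (simp only: E_def h_def)
  qed simp
  have "(\<lambda>l. LINT x|lborel. Y l x) \<longlonglongrightarrow> 0"
  proof (rule tendsto_sandwich[OF _ _ tendsto_const])
    show "\<forall>\<^sub>F l in sequentially. 0 \<le> (LBINT x. Y l x)"
      by (intro always_eventually allI Bochner_Integration.integral_nonneg) (simp add: Y_def)
    show "\<forall>\<^sub>F l in sequentially. (LBINT x. Y l x) \<le> (LBINT x. norm (A l x)) + (h l * G / 2 + 2 * (2 ^ l * measure lborel (E l)))"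
      using eventually_ge_at_top[of L] by eventually_elim (rule main)
    show "(\<lambda>l. (LBINT x. norm (A l x)) + (h l * G / 2 + 2 * (2 ^ l * measure lborel (E l)))) \<longlonglongrightarrow> 0"
      using lim by simp
  qed
  then show ?thesis by (simp only: Y_def h_def)
qed

text \<open>Summation by parts for difference quotients. The quotient of \<phi> converges by
  smoothness, that of \<open>m\<close> in L1 on the support of \<phi> by the previous lemma, and
  both limits are compared.\<close>

lemma weak_derivative_of_lift:
  assumes \<phi>: "test_function \<Omega> \<phi>"
    and small: "\<And>K. compact K \<Longrightarrow> K \<subseteq> \<Omega> \<Longrightarrow>
      (\<lambda>l. 2 ^ l * measure lborel {x\<in>K. m x \<bullet> m (x + (1 / 2 ^ l) *\<^sub>R e) < 0}) \<longlonglongrightarrow> 0"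
  shows "(LBINT x. frechet_derivative \<phi> (at x) e *\<^sub>R m x) = - (LBINT x. \<phi> x *\<^sub>R (g e x *v m x))"
proof -
  note tf = test_functionD[OF \<phi>]
  note [measurable] = m_meas weak_gradientD(1)[OF wg] weak_gradientD(3)[OF wg e]
  have m\<phi> [measurable]: "\<phi> \<in> borel_measurable borel" using tf(1) by (rule borel_measurable_continuous_onI)
  define K where "K = closure {x. \<phi> x \<noteq> 0}"
  have K: "compact K" "K \<subseteq> \<Omega>" using tf(3,4) unfolding K_def by blast+
  have [measurable]: "K \<in> sets borel" using K by (simp add: compact_imp_closed)
  have K0: "\<phi> x = 0" if "x \<notin> K" for x using tf(6) that unfolding K_def by blast
  obtain B where B: "B > 0" "\<And>x. \<bar>\<phi> x\<bar> \<le> B" by (rule continuous_compact_support_bounded[OF tf(1) K(1) K0]) blast+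
  define X where "X l x = 2 ^ l *\<^sub>R (m (x + (1 / 2 ^ l) *\<^sub>R e) - m x) - g e x *v m x" for l x
  have bm: "bounded (range (\<lambda>x. m (x + c)))" for c by (auto simp: bounded_iff m_unit intro!: exI[of _ 1])
  have imc: "integrable lborel (\<lambda>x. \<phi> x *\<^sub>R m (x + c))" for c
    by (rule integrable_compact_support[OF tf(1) K(1) K0 _ bm]) auto
  have im: "integrable lborel (\<lambda>x. \<phi> x *\<^sub>R m x)" using imc[of 0] by simp
  have igm: "integrable lborel (\<lambda>x. g e x *v m x)"
    by (rule Bochner_Integration.integrable_bound[OF weak_gradientD(4)[OF wg e]])
      (use norm_matrix_vector_mult_le[of "g e _" "m _"] m_unit in \<open>auto intro!: AE_I2\<close>)
  have igm\<phi>: "integrable lborel (\<lambda>x. \<phi> x *\<^sub>R (g e x *v m x))" using m\<phi> B(2) igm by (rule integrable_bounded_mult)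
  \<comment> \<open>The shift is moved from \<phi> to \<open>m\<close> by translation invariance;
    \<open>X l\<close> is the deviation of the quotient of \<open>m\<close> from its expected
    limit.\<close>
  have eq: "(LBINT x. ((\<phi> x - \<phi> (x - (1 / 2 ^ l) *\<^sub>R e)) * 2 ^ l) *\<^sub>R m x)
    = - (LBINT x. \<phi> x *\<^sub>R X l x) - (LBINT x. \<phi> x *\<^sub>R (g e x *v m x))" for l
  proof -
    let ?v = "(1 / 2 ^ l) *\<^sub>R e"
    have i2: "integrable lborel (\<lambda>x. \<phi> (x - ?v) *\<^sub>R m x)"
      using lborel_integrable_translate[OF imc[of ?v], of "- ?v"] by simp
    have t: "(LBINT x. \<phi> (x - ?v) *\<^sub>R m x) = (LBINT x. \<phi> x *\<^sub>R m (x + ?v))"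
      using lborel_integral_translate[of "\<lambda>x. \<phi> x *\<^sub>R m (x + ?v)" "- ?v"] by simp
    have "(LBINT x. ((\<phi> x - \<phi> (x - ?v)) * 2 ^ l) *\<^sub>R m x)
      = (LBINT x. 2 ^ l *\<^sub>R (\<phi> x *\<^sub>R m x - \<phi> (x - ?v) *\<^sub>R m x))"
      by (intro Bochner_Integration.integral_cong refl) (simp add: algebra_simps)
    also have "\<dots> = 2 ^ l *\<^sub>R ((LBINT x. \<phi> x *\<^sub>R m x) - (LBINT x. \<phi> x *\<^sub>R m (x + ?v)))"
      unfolding integral_scaleR_right t[symmetric] by (subst Bochner_Integration.integral_diff[OF im i2]) simp
    also have "\<dots> = - (LBINT x. 2 ^ l *\<^sub>R (\<phi> x *\<^sub>R m (x + ?v) - \<phi> x *\<^sub>R m x))"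
      unfolding integral_scaleR_right by (subst Bochner_Integration.integral_diff[OF imc im]) (simp add: algebra_simps)
    also have "(LBINT x. 2 ^ l *\<^sub>R (\<phi> x *\<^sub>R m (x + ?v) - \<phi> x *\<^sub>R m x))
      = (LBINT x. \<phi> x *\<^sub>R X l x + \<phi> x *\<^sub>R (g e x *v m x))"
      by (intro Bochner_Integration.integral_cong refl) (simp add: X_def algebra_simps)
    also have "\<dots> = (LBINT x. \<phi> x *\<^sub>R X l x) + (LBINT x. \<phi> x *\<^sub>R (g e x *v m x))"
    proof (rule Bochner_Integration.integral_add[OF _ igm\<phi>])
      have "integrable lborel (\<lambda>x. 2 ^ l *\<^sub>R (\<phi> x *\<^sub>R m (x + ?v) - \<phi> x *\<^sub>R m x) - \<phi> x *\<^sub>R (g e x *v m x))"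
        by (intro Bochner_Integration.integrable_diff integrable_scaleR_right imc im igm\<phi>)
      then show "integrable lborel (\<lambda>x. \<phi> x *\<^sub>R X l x)" by (simp add: X_def algebra_simps)
    qed
    finally show ?thesis by simp
  qed
  have le: "norm (LBINT x. \<phi> x *\<^sub>R X l x) \<le> B * (LBINT x. indicator K x * norm (X l x))" for l
  proof -
    have "norm (LBINT x. \<phi> x *\<^sub>R X l x) \<le> (LBINT x. norm (\<phi> x *\<^sub>R X l x))" by (rule integral_norm_bound)
    also have "\<dots> \<le> (LBINT x. B * (indicator K x * norm (X l x)))"
    proof (rule integral_mono')
      have "norm (\<phi> x *\<^sub>R X l x) \<le> B * (indicator K x * norm (X l x))" for x
        using B(2)[of x] K0[of x] by (cases "x \<in> K") (auto intro!: mult_right_mono)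
      then show "\<And>x. norm (\<phi> x *\<^sub>R X l x) \<le> B * (indicator K x * norm (X l x))" .
      have "integrable lborel (\<lambda>x. indicator K x *\<^sub>R m (x + c))" for c
        by (rule Bochner_Integration.integrable_bound[OF integrable_indicator_compact[OF K(1)]]) (auto simp: m_unit)
      note i1 = this
      have i2: "integrable lborel (\<lambda>x. indicator K x *\<^sub>R (g e x *v m x))"
        by (rule integrable_mult_indicator[OF _ igm]) simp
      have "integrable lborel (\<lambda>x. 2 ^ l *\<^sub>R (indicator K x *\<^sub>R m (x + (1 / 2 ^ l) *\<^sub>R e) - indicator K x *\<^sub>R m (x + 0)) - indicator K x *\<^sub>R (g e x *v m x))"
        by (intro Bochner_Integration.integrable_diff integrable_scaleR_right i1 i2)
      then have "integrable lborel (\<lambda>x. indicator K x *\<^sub>R X l x)" by (simp add: X_def algebra_simps)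
      from integrable_norm[OF this] show "integrable lborel (\<lambda>x. B * (indicator K x * norm (X l x)))"
        by (intro integrable_mult_right) simp
      show "\<And>x. 0 \<le> B * (indicator K x * norm (X l x))" using B(1) by simp
    qed
    finally show ?thesis by simp
  qed
  have "(\<lambda>l. B * (LBINT x. indicator K x * norm (X l x))) \<longlonglongrightarrow> B * 0"
    unfolding X_def by (intro tendsto_mult tendsto_const difference_quotient_remainder K small)
  then have "(\<lambda>l. LINT x|lborel. \<phi> x *\<^sub>R X l x) \<longlonglongrightarrow> 0"
    by (intro Lim_null_comparison[OF always_eventually[OF allI[OF le]]]) simp
  then have lim1: "(\<lambda>l. - (LBINT x. \<phi> x *\<^sub>R X l x) - (LBINT x. \<phi> x *\<^sub>R (g e x *v m x)))
    \<longlonglongrightarrow> - 0 - (LBINT x. \<phi> x *\<^sub>R (g e x *v m x))"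
    by (intro tendsto_diff tendsto_minus tendsto_const)
  have "norm e = 1" using e by simp
  from test_function_quotient_tendsto[OF \<phi> m_meas m_unit this]
  have lim2: "(\<lambda>l. - (LBINT x. \<phi> x *\<^sub>R X l x) - (LBINT x. \<phi> x *\<^sub>R (g e x *v m x)))
    \<longlonglongrightarrow> (LBINT x. frechet_derivative \<phi> (at x) e *\<^sub>R m x)" by (simp only: eq)
  show ?thesis using LIMSEQ_unique[OF lim2 lim1] by simp
qed

end

subsection \<open>Measurable representatives\<close>

lemma AE_lebesgue_on_iff:
  fixes \<Omega> :: "'a::euclidean_space set"
  assumes "open \<Omega>"
  shows "(AE x in lebesgue_on \<Omega>. Q x) \<longleftrightarrow> (AE x in lborel. x \<in> \<Omega> \<longrightarrow> Q x)"
proof -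
  have "(AE x in lebesgue_on \<Omega>. Q x) \<longleftrightarrow> (AE x in lebesgue. x \<in> \<Omega> \<longrightarrow> Q x)"
    using assms by (intro AE_restrict_space_iff) auto
  then show ?thesis by (simp add: AE_completion_iff)
qed

lemma borel_imp_lebesgue_on: "f \<in> borel_measurable borel \<Longrightarrow> f \<in> borel_measurable (lebesgue_on \<Omega>)"
  by (intro measurable_restrict_space1 measurable_completion) simp

lemma LINT_lebesgue_on_eq_lborel:
  fixes f F :: "'a::euclidean_space \<Rightarrow> 'b::euclidean_space"
  assumes \<Omega>: "open \<Omega>" and f: "f \<in> borel_measurable (lebesgue_on \<Omega>)" and F: "F \<in> borel_measurable borel"
    and eq: "AE x in lborel. x \<in> \<Omega> \<longrightarrow> f x = F x" and out: "\<And>x. x \<notin> \<Omega> \<Longrightarrow> F x = 0"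
  shows "(LINT x|lebesgue_on \<Omega>. f x) = (LBINT x. F x)"
proof -
  have "(LINT x|lebesgue_on \<Omega>. f x) = (LINT x|lebesgue_on \<Omega>. F x)"
    using eq by (intro integral_cong_AE f borel_imp_lebesgue_on F) (simp add: AE_lebesgue_on_iff[OF \<Omega>])
  also have "\<dots> = (LINT x|lebesgue. indicator \<Omega> x *\<^sub>R F x)"
    using \<Omega> by (intro integral_restrict_space) auto
  also have "\<dots> = (LINT x|lebesgue. F x)"
    by (intro Bochner_Integration.integral_cong refl) (auto simp: indicator_def out)
  also have "\<dots> = (LBINT x. F x)" using F by (intro integral_completion) simp
  finally show ?thesis .
qed

text \<open>A test function and its derivative vanish outside \<Omega>, so integrals over \<Omega>
  and over the whole space agree, whatever the representative does outside.\<close>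

lemma LINT_test_function:
  fixes f F :: "'a::euclidean_space \<Rightarrow> 'b::euclidean_space"
  assumes \<Omega>: "open \<Omega>" and \<phi>: "test_function \<Omega> \<phi>"
    and f: "f \<in> borel_measurable (lebesgue_on \<Omega>)" and F: "F \<in> borel_measurable borel"
    and eq: "AE x in lborel. x \<in> \<Omega> \<longrightarrow> f x = F x"
  shows "(LINT x|lebesgue_on \<Omega>. \<phi> x *\<^sub>R f x) = (LBINT x. \<phi> x *\<^sub>R F x)"
    and "(LINT x|lebesgue_on \<Omega>. frechet_derivative \<phi> (at x) e *\<^sub>R f x)
      = (LBINT x. frechet_derivative \<phi> (at x) e *\<^sub>R F x)"
proof -
  note tf = test_functionD[OF \<phi>]
  have *: "(LINT x|lebesgue_on \<Omega>. \<psi> x *\<^sub>R f x) = (LBINT x. \<psi> x *\<^sub>R F x)"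
    if \<psi>: "continuous_on UNIV \<psi>" "\<And>x. x \<notin> \<Omega> \<Longrightarrow> \<psi> x = 0" for \<psi> :: "'a \<Rightarrow> real"
  proof (rule LINT_lebesgue_on_eq_lborel[OF \<Omega>])
    have m: "\<psi> \<in> borel_measurable borel" using \<psi>(1) by (rule borel_measurable_continuous_onI)
    show "(\<lambda>x. \<psi> x *\<^sub>R f x) \<in> borel_measurable (lebesgue_on \<Omega>)"
      by (intro borel_measurable_scaleR f borel_imp_lebesgue_on m)
    show "(\<lambda>x. \<psi> x *\<^sub>R F x) \<in> borel_measurable borel" by (intro borel_measurable_scaleR F m)
    show "AE x in lborel. x \<in> \<Omega> \<longrightarrow> \<psi> x *\<^sub>R f x = \<psi> x *\<^sub>R F x" using eq by eventually_elim simp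
    show "\<psi> x *\<^sub>R F x = 0" if "x \<notin> \<Omega>" for x by (simp only: \<psi>(2)[OF that] scaleR_zero_left)
  qed
  have out: "x \<notin> closure {x. \<phi> x \<noteq> 0}" if "x \<notin> \<Omega>" for x using tf(4) that by blast
  show "(LINT x|lebesgue_on \<Omega>. \<phi> x *\<^sub>R f x) = (LBINT x. \<phi> x *\<^sub>R F x)"
    using tf(1) tf(6)[OF out] by (rule *)
  show "(LINT x|lebesgue_on \<Omega>. frechet_derivative \<phi> (at x) e *\<^sub>R f x)
      = (LBINT x. frechet_derivative \<phi> (at x) e *\<^sub>R F x)"
    using tf(5) tf(7)[OF out] by (rule *)
qed

lemma locally_integrable_borel:
  fixes h :: "'a::euclidean_space \<Rightarrow> 'b::euclidean_space"
  assumes "h \<in> borel_measurable borel" "\<And>K. compact K \<Longrightarrow> integrable lborel (\<lambda>x. indicator K x *\<^sub>R h x)"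
  shows "locally_integrable_on h \<Omega>"
  unfolding locally_integrable_on_def set_integrable_def
proof (intro allI impI)
  fix K assume K: "compact K \<and> K \<subseteq> \<Omega>"
  have "(\<lambda>x. indicator K x *\<^sub>R h x) \<in> borel_measurable lborel"
    using K assms(1) by (intro borel_measurable_scaleR borel_measurable_indicator) (auto simp: compact_imp_closed)
  from integrable_completion[OF this] assms(2) K show "integrable lebesgue (\<lambda>x. indicator K x *\<^sub>R h x)" by blast
qed

lemma integrable_lebesgue_on_iff_lborel:
  fixes f F :: "'a::euclidean_space \<Rightarrow> 'b::euclidean_space"
  assumes \<Omega>: "open \<Omega>" and f: "f \<in> borel_measurable (lebesgue_on \<Omega>)" and F: "F \<in> borel_measurable borel"
    and eq: "AE x in lborel. x \<in> \<Omega> \<longrightarrow> f x = F x" and out: "\<And>x. x \<notin> \<Omega> \<Longrightarrow> F x = 0"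
  shows "integrable (lebesgue_on \<Omega>) f \<longleftrightarrow> integrable lborel F"
proof -
  have "integrable (lebesgue_on \<Omega>) f \<longleftrightarrow> integrable (lebesgue_on \<Omega>) F"
    using eq by (intro integrable_cong_AE f borel_imp_lebesgue_on F) (simp add: AE_lebesgue_on_iff[OF \<Omega>])
  also have "\<dots> \<longleftrightarrow> integrable lebesgue (\<lambda>x. indicator \<Omega> x *\<^sub>R F x)"
    using \<Omega> by (intro integrable_restrict_space) auto
  also have "\<dots> \<longleftrightarrow> integrable lebesgue F"
    by (intro Bochner_Integration.integrable_cong refl) (auto simp: indicator_def out)
  also have "\<dots> \<longleftrightarrow> integrable lborel F" using F by (intro integrable_completion) simp
  finally show ?thesis .
qed

text \<open>A real function measurable for the completion has a Borel version; this is applied to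
  each coordinate.\<close>

lemma borel_representative:
  fixes f :: "'a::euclidean_space \<Rightarrow> 'b::euclidean_space"
  assumes \<Omega>: "open \<Omega>" and f: "f \<in> borel_measurable (lebesgue_on \<Omega>)"
  obtains f' where "f' \<in> borel_measurable borel" "AE x in lborel. x \<in> \<Omega> \<longrightarrow> f x = f' x" "\<And>x. x \<notin> \<Omega> \<Longrightarrow> f' x = 0"
proof -
  have F: "(\<lambda>x. if x \<in> \<Omega> then f x else 0) \<in> borel_measurable lebesgue"
    using f \<Omega> by (intro borel_measurable_if_I) auto
  have "\<exists>h\<in>borel_measurable lborel. AE x in lborel. (if x \<in> \<Omega> then f x else 0) \<bullet> b = h x" for b
    using F by (intro completion_ex_borel_measurable_real borel_measurable_inner) auto
  then have "\<forall>b. \<exists>h. h \<in> borel_measurable lborel \<and> (AE x in lborel. (if x \<in> \<Omega> then f x else 0) \<bullet> b = h x)" by blast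
  from choice[OF this] obtain h where h: "\<And>b. h b \<in> borel_measurable lborel" "\<And>b. AE x in lborel. (if x \<in> \<Omega> then f x else 0) \<bullet> b = h b x"
    by blast
  show thesis
  proof (rule that[of "\<lambda>x. indicator \<Omega> x *\<^sub>R (\<Sum>b\<in>Basis. h b x *\<^sub>R b)"])
    show "(\<lambda>x. indicator \<Omega> x *\<^sub>R (\<Sum>b\<in>Basis. h b x *\<^sub>R b)) \<in> borel_measurable borel"
      using h(1) \<Omega> by (intro borel_measurable_scaleR borel_measurable_sum borel_measurable_indicator) auto
    have "AE x in lborel. \<forall>b\<in>Basis. (if x \<in> \<Omega> then f x else 0) \<bullet> b = h b x"
      using h(2) by (intro AE_finite_allI finite_Basis)
    then show "AE x in lborel. x \<in> \<Omega> \<longrightarrow> f x = indicator \<Omega> x *\<^sub>R (\<Sum>b\<in>Basis. h b x *\<^sub>R b)"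
    proof eventually_elim
      case (elim x)
      show ?case
      proof
        assume x: "x \<in> \<Omega>"
        have "f x = (\<Sum>b\<in>Basis. (f x \<bullet> b) *\<^sub>R b)" by (rule euclidean_representation[symmetric])
        also have "\<dots> = (\<Sum>b\<in>Basis. h b x *\<^sub>R b)" using elim x by (intro sum.cong refl) simp
        finally show "f x = indicator \<Omega> x *\<^sub>R (\<Sum>b\<in>Basis. h b x *\<^sub>R b)" using x by simp
      qed
    qed
  qed simp
qed

lemma tensor_row: "(a \<otimes> b) $ i = (a $ i) *\<^sub>R b"
  by (simp add: tensor_def vec_eq_iff)

text \<open>A unit vector is recovered, up to its sign, as the first nonvanishing normalised row of \<open>a \<otimes> a\<close>;
  unlike \<open>n\<close> itself this choice is measurable.\<close>

lemma borel_unit_representative: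
  fixes n :: "'a::euclidean_space \<Rightarrow> real^3"
  assumes \<Omega>: "open \<Omega>" and n: "\<forall>x\<in>\<Omega>. n x \<in> sphere 0 1"
    and Q: "(\<lambda>x. n x \<otimes> n x) \<in> borel_measurable (lebesgue_on \<Omega>)"
  obtains n0 where "n0 \<in> borel_measurable borel" "\<And>x. norm (n0 x) = 1"
    "AE x in lborel. x \<in> \<Omega> \<longrightarrow> n x \<otimes> n x = n0 x \<otimes> n0 x"
proof -
  obtain Q' where Q': "Q' \<in> borel_measurable borel" "AE x in lborel. x \<in> \<Omega> \<longrightarrow> n x \<otimes> n x = Q' x"
    using borel_representative[OF \<Omega> Q] by blast
  \<comment> \<open>Row i of a \<otimes> a is the multiple of a by its coordinate i, so normalising
    a nonzero row returns \<plusminus>a.\<close>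
  define r :: "real^3^3 \<Rightarrow> real^3" where "r A = (if A $ 1 \<noteq> 0 then sgn (A $ 1) else if A $ 2 \<noteq> 0 then sgn (A $ 2) else sgn (A $ 3))" for A
  \<comment> \<open>The default \<open>axis 1 1\<close> keeps the field of unit length at points
    where \<open>Q'\<close> is not the square of a unit vector.\<close>
  define n0 where "n0 x = (if norm (r (Q' x)) = 1 then r (Q' x) else axis 1 1)" for x
  have row: "(\<lambda>x. Q' x $ i) \<in> borel_measurable borel" for i
  proof -
    have "continuous_on UNIV (\<lambda>A::real^3^3. A $ i)" by (intro continuous_intros)
    from borel_measurable_continuous_on[OF this Q'(1)] show ?thesis .
  qed
  have sg: "(\<lambda>x. sgn (Q' x $ i)) \<in> borel_measurable borel" for i
    unfolding sgn_div_norm using row by measurable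
  have rm: "(\<lambda>x. r (Q' x)) \<in> borel_measurable borel"
    unfolding r_def using row sg by measurable
  have r: "\<exists>s. \<bar>s\<bar> = 1 \<and> r (a \<otimes> a) = s *\<^sub>R a" if a: "norm a = 1" for a
  proof -
    have "a \<noteq> 0" using a by auto
    then obtain i where "a $ i \<noteq> 0" by (auto simp: vec_eq_iff)
    then have "a $ 1 \<noteq> 0 \<or> a $ 2 \<noteq> 0 \<or> a $ 3 \<noteq> 0" using exhaust_3[of i] by auto
    moreover have "a \<noteq> 0" using a by auto
    moreover have "sgn (c *\<^sub>R a) = sgn c *\<^sub>R a" for c using a by (simp add: sgn_scaleR sgn_div_norm)
    moreover have "\<bar>sgn c\<bar> = 1" if "c \<noteq> 0" for c :: real using that by (simp add: abs_sgn_eq)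
    ultimately show ?thesis unfolding r_def tensor_row by (metis scaleR_eq_0_iff)
  qed
  show thesis
  proof (rule that[of n0])
    show "n0 \<in> borel_measurable borel" unfolding n0_def using rm by measurable
    show "norm (n0 x) = 1" for x by (simp add: n0_def)
    show "AE x in lborel. x \<in> \<Omega> \<longrightarrow> n x \<otimes> n x = n0 x \<otimes> n0 x"
      using Q'(2)
    proof eventually_elim
      case (elim x)
      show ?case
      proof
        assume x: "x \<in> \<Omega>"
        have u: "norm (n x) = 1" using n x by simp
        obtain s where s: "\<bar>s\<bar> = 1" "r (n x \<otimes> n x) = s *\<^sub>R n x" using r[OF u] by blast
        have "r (Q' x) = s *\<^sub>R n x" using elim x s by simp
        then have "n0 x = s *\<^sub>R n x" using u s(1) by (simp add: n0_def)
        then show "n x \<otimes> n x = n0 x \<otimes> n0 x" using tensor_scale_sign[OF s(1), of "n x"] by simp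
      qed
    qed
  qed
qed

text \<open>Transfers the weak derivatives on \<Omega> to Borel functions extended by 0. Boundedness
  of \<Omega> turns square integrability into integrability.\<close>

lemma W12_weak_gradient:
  fixes \<Omega> :: "'a::euclidean_space set" and f P :: "'a \<Rightarrow> 'b::euclidean_space"
  assumes \<Omega>: "open \<Omega>" "bounded \<Omega>" and f: "f \<in> W12 \<Omega>"
    and P: "P \<in> borel_measurable borel" "bounded (range P)" "AE x in lborel. x \<in> \<Omega> \<longrightarrow> f x = P x"
  obtains g where "weak_gradient \<Omega> P g" "\<And>e x. e \<in> Basis \<Longrightarrow> x \<notin> \<Omega> \<Longrightarrow> g e x = 0"
proof -
  define wd where "wd e g \<longleftrightarrow> g \<in> borel_measurable borel \<and> integrable lborel g \<and> integrable lborel (\<lambda>x. (norm (g x))\<^sup>2) \<and>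
      (\<forall>x. x \<notin> \<Omega> \<longrightarrow> g x = 0) \<and>
      (\<forall>\<phi>. test_function \<Omega> \<phi> \<longrightarrow>
          (LBINT x. frechet_derivative \<phi> (at x) e *\<^sub>R P x) = - (LBINT x. \<phi> x *\<^sub>R g x))"
    for e :: 'a and g :: "'a \<Rightarrow> 'b"
  have ex: "\<exists>g. wd e g" if e: "e \<in> Basis" for e
  proof -
    obtain g0 where g0: "g0 \<in> L2 \<Omega>" "weak_partial \<Omega> e f g0" using f e unfolding W12_def by blast
    have g0m: "g0 \<in> borel_measurable (lebesgue_on \<Omega>)" and g0i: "integrable (lebesgue_on \<Omega>) (\<lambda>x. (norm (g0 x))\<^sup>2)"
      using g0(1) unfolding L2_def by blast+
    have fm: "f \<in> borel_measurable (lebesgue_on \<Omega>)" using f unfolding W12_def L2_def by blast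
    obtain g where g: "g \<in> borel_measurable borel" "AE x in lborel. x \<in> \<Omega> \<longrightarrow> g0 x = g x" "\<And>x. x \<notin> \<Omega> \<Longrightarrow> g x = 0"
      using borel_representative[OF \<Omega>(1) g0m] by blast
    note [measurable] = g(1)
    have sq: "integrable lborel (\<lambda>x. (norm (g x))\<^sup>2)"
    proof -
      have "integrable (lebesgue_on \<Omega>) (\<lambda>x. (norm (g0 x))\<^sup>2) \<longleftrightarrow> integrable lborel (\<lambda>x. (norm (g x))\<^sup>2)"
      proof (rule integrable_lebesgue_on_iff_lborel[OF \<Omega>(1)])
        show "(\<lambda>x. (norm (g0 x))\<^sup>2) \<in> borel_measurable (lebesgue_on \<Omega>)"
          using g0m by measurable
        show "AE x in lborel. x \<in> \<Omega> \<longrightarrow> (norm (g0 x))\<^sup>2 = (norm (g x))\<^sup>2" using g(2) by eventually_elim auto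
        show "(norm (g x))\<^sup>2 = 0" if "x \<notin> \<Omega>" for x using g(3)[OF that] by simp
      qed measurable
      with g0i show ?thesis by simp
    qed
    have int: "integrable lborel g"
    proof (rule Bochner_Integration.integrable_bound)
      show "integrable lborel (\<lambda>x. indicator \<Omega> x + (norm (g x))\<^sup>2 :: real)"
        using sq \<Omega> emeasure_bounded_finite[OF \<Omega>(2)]
        by (intro Bochner_Integration.integrable_add integrable_real_indicator) auto
      show "AE x in lborel. norm (g x) \<le> norm (indicator \<Omega> x + (norm (g x))\<^sup>2 :: real)"
      proof (rule AE_I2)
        fix x
        \<comment> \<open>The integrable majorant on \<Omega>, from the square of r - 1 being
          nonnegative.\<close>
        have "r \<le> 1 + r\<^sup>2" if "0 \<le> r" for r :: real
          using zero_le_power2[of "r - 1"] that unfolding power2_diff by simp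
        then show "norm (g x) \<le> norm (indicator \<Omega> x + (norm (g x))\<^sup>2 :: real)"
          using g(3)[of x] by (cases "x \<in> \<Omega>") auto
      qed
    qed measurable
    have wp: "(LBINT x. frechet_derivative \<phi> (at x) e *\<^sub>R P x) = - (LBINT x. \<phi> x *\<^sub>R g x)"
      if \<phi>: "test_function \<Omega> \<phi>" for \<phi>
      using g0(2)[unfolded weak_partial_def, THEN conjunct2, THEN conjunct2, THEN spec, THEN mp, OF \<phi>]
      by (simp only: LINT_test_function[OF \<Omega>(1) \<phi> fm P(1,3)] LINT_test_function[OF \<Omega>(1) \<phi> g0m g(1,2)])
    have "wd e g" unfolding wd_def by (intro conjI allI impI g(1,3) int sq wp)
    then show ?thesis by blast
  qed
  have "\<forall>e\<in>Basis. \<exists>g. wd e g" using ex by (rule ballI)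
  from bchoice[OF this] obtain g where "\<forall>e\<in>Basis. wd e (g e)" ..
  note g = bspec[OF this, unfolded wd_def]
  show thesis
  proof (rule that[of g])
    show "weak_gradient \<Omega> P g" unfolding weak_gradient_def
    proof (intro conjI ballI P(1,2))
      fix e :: 'a assume e: "e \<in> Basis"
      note ge = g[OF e]
      show "g e \<in> borel_measurable borel" by (rule ge[THEN conjunct1])
      show "integrable lborel (g e)" by (rule ge[THEN conjunct2, THEN conjunct1])
      show "integrable lborel (\<lambda>x. (norm (g e x))\<^sup>2)" by (rule ge[THEN conjunct2, THEN conjunct2, THEN conjunct1])
      show "\<forall>\<phi>. test_function \<Omega> \<phi> \<longrightarrow> (LBINT x. frechet_derivative \<phi> (at x) e *\<^sub>R P x) = - (LBINT x. \<phi> x *\<^sub>R g e x)"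
        by (rule ge[THEN conjunct2, THEN conjunct2, THEN conjunct2, THEN conjunct2])
    qed
    show "g e x = 0" if "e \<in> Basis" "x \<notin> \<Omega>" for e x
      by (rule g[OF that(1), THEN conjunct2, THEN conjunct2, THEN conjunct2, THEN conjunct1, THEN spec, THEN mp, OF that(2)])
  qed
qed

text \<open>The enumeration runs over \<open>insert {} D\<close>, which is never empty;
  \<open>box One 0\<close> stands for the added empty set.\<close>

lemma box_cover:
  fixes \<Omega> :: "'a::euclidean_space set"
  assumes "open \<Omega>"
  obtains a b :: "nat \<Rightarrow> 'a" where "(\<Union>i. box (a i) (b i)) = \<Omega>"
proof -
  obtain D where D: "countable D" "D \<subseteq> Pow \<Omega>" "\<And>X. X \<in> D \<Longrightarrow> \<exists>a b. X = box a b" "\<Union>D = \<Omega>"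
    using open_countable_Union_open_box[OF assms] by metis
  obtain i :: 'a where i: "i \<in> Basis" using nonempty_Basis by blast
  have emp: "box One 0 = ({}::'a set)"
    unfolding box_eq_empty by (rule bexI[OF _ i]) (simp add: i)
  let ?B = "from_nat_into (insert {} D)"
  have r: "range ?B = insert {} D" using D(1) by (intro range_from_nat_into) auto
  have "\<exists>a b. ?B i = box a b" for i
  proof -
    have "?B i \<in> insert {} D" using r by blast
    then show ?thesis using D(3) emp by (metis insertE)
  qed
  then obtain a b where ab: "\<And>i. ?B i = box (a i) (b i)" by metis
  have "(\<Union>i. box (a i) (b i)) = \<Union>(range ?B)" by (simp add: ab)
  also have "\<dots> = \<Omega>" using D(4) unfolding r by simp
  finally show thesis by (rule that)
qed

subsection \<open>Gluing the local lifts\<close>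

lemma jump_set_vanishing:
  fixes n :: "'a::euclidean_space \<Rightarrow> real^'m"
  assumes unit: "\<And>x. norm (n x) = 1" and meas: "n \<in> borel_measurable borel"
    and wg: "weak_gradient \<Omega> (\<lambda>x. n x \<otimes> n x) g" and U: "open U" "convex U" "U \<subseteq> \<Omega>"
  shows "emeasure lborel (jump_set n U k v) < \<infinity>" "(\<lambda>k. 4 ^ k * measure lborel (jump_set n U k v)) \<longlonglongrightarrow> 0"
proof -
  have eq: "jump_set n U k v = {x\<in>U. x + (1 / 2 ^ k) *\<^sub>R v \<in> U \<and>
      1/2 \<le> norm (n (x + (1 / 2 ^ k) *\<^sub>R v) \<otimes> n (x + (1 / 2 ^ k) *\<^sub>R v) - n x \<otimes> n x)}" for k
    unfolding jump_set_def[OF unit meas U(1,2)] close_to_def by (auto simp: not_less norm_minus_commute)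
  show "emeasure lborel (jump_set n U k v) < \<infinity>" unfolding eq by (rule large_increment_dyadic(2)[OF wg U])
  show "(\<lambda>k. 4 ^ k * measure lborel (jump_set n U k v)) \<longlonglongrightarrow> 0" unfolding eq by (rule large_increment_dyadic(1)[OF wg U])
qed

text \<open>Two local lifts are transported from a common generic point by the same signs, so their
  ratio is constant on the whole intersection of two boxes. The ratios form the cocycle that is
  trivialised.\<close>

lemma global_lift:
  fixes n :: "'a::euclidean_space \<Rightarrow> real^'m"
  assumes unit: "\<And>x. norm (n x) = 1" and meas: "n \<in> borel_measurable borel"
    and wg: "weak_gradient \<Omega> (\<lambda>x. n x \<otimes> n x) g" and \<Omega>: "open \<Omega>" "simply_connected \<Omega>"
  obtains \<tau> :: "'a \<Rightarrow> real" where "\<tau> \<in> borel_measurable borel" "\<And>x. \<bar>\<tau> x\<bar> = 1"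
    "\<And>e K. e \<in> Basis \<Longrightarrow> compact K \<Longrightarrow> K \<subseteq> \<Omega> \<Longrightarrow>
      (\<lambda>l. 2 ^ l * measure lborel {x\<in>K. (\<tau> x *\<^sub>R n x) \<bullet> (\<tau> (x + (1 / 2 ^ l) *\<^sub>R e) *\<^sub>R n (x + (1 / 2 ^ l) *\<^sub>R e)) < 0}) \<longlonglongrightarrow> 0"
proof -
  obtain a b :: "nat \<Rightarrow> 'a" where ab: "(\<Union>i. box (a i) (b i)) = \<Omega>" by (rule box_cover[OF \<Omega>(1)])
  define B where "B i = box (a i) (b i)" for i
  have cover: "(\<Union>i. B i) = \<Omega>" using ab by (simp add: B_def)
  have B: "open (B i)" "convex (B i)" "bounded (B i)" "connected (B i)" "B i \<subseteq> \<Omega>" for i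
    using cover convex_connected[of "B i"] by (auto simp: B_def open_box convex_box)
  \<comment> \<open>The displacements at which sign changes are later counted: dyadic multiples of
    the coordinate vectors.\<close>
  define W :: "'a set" where "W = (\<lambda>p::nat \<times> 'a. (1 / 2 ^ fst p) *\<^sub>R snd p) ` (UNIV \<times> Basis)"
  have W: "countable W"
    unfolding W_def by (intro countable_image countable_SIGMA countableI_type countable_finite[OF finite_Basis])
  define lift where "lift i t \<longleftrightarrow> t \<in> borel_measurable borel \<and> (\<forall>x. \<bar>t x\<bar> = 1) \<and>
    (\<forall>w\<in>W. AE y in lborel. y \<in> B i \<and> y + w \<in> B i \<longrightarrow> t y * transport n y w = t (y + w)) \<and>
    (AE y in lborel. AE z in lborel. y \<in> B i \<and> z \<in> B i \<longrightarrow> t y * transport n y (z - y) = t z)" for i and t :: "'a \<Rightarrow> real"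
  have "\<exists>t. lift i t" for i
  proof -
    obtain t where t: "t \<in> borel_measurable borel" "\<And>x. \<bar>t x\<bar> = 1"
      "\<And>w. w \<in> W \<Longrightarrow> AE y in lborel. y \<in> B i \<and> y + w \<in> B i \<longrightarrow> t y * transport n y w = t (y + w)"
      "AE y in lborel. AE z in lborel. y \<in> B i \<and> z \<in> B i \<longrightarrow> t y * transport n y (z - y) = t z"
      by (rule local_lift[OF unit meas B(1)[of i] B(2) jump_set_vanishing[OF unit meas wg B(1,2,5)] W]) blast
    have "lift i t" unfolding lift_def by (intro conjI allI ballI t)
    then show ?thesis by blast
  qed
  then have "\<forall>i. \<exists>t. lift i t" by blast
  from choice[OF this] obtain t where "\<forall>i. lift i (t i)" ..
  note t' = spec[OF this, unfolded lift_def]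
  have tm [measurable]: "t i \<in> borel_measurable borel" for i by (rule t'[THEN conjunct1])
  have t1: "\<bar>t i x\<bar> = 1" for i x by (rule t'[THEN conjunct2, THEN conjunct1, THEN spec])
  have tW: "AE y in lborel. y \<in> B i \<and> y + w \<in> B i \<longrightarrow> t i y * transport n y w = t i (y + w)" if "w \<in> W" for i w
    by (rule t'[THEN conjunct2, THEN conjunct2, THEN conjunct1, THEN bspec, OF that])
  have tT: "AE y in lborel. AE z in lborel. y \<in> B i \<and> z \<in> B i \<longrightarrow> t i y * transport n y (z - y) = t i z" for i
    by (rule t'[THEN conjunct2, THEN conjunct2, THEN conjunct2])
  have sq: "s * s = 1" if "\<bar>s\<bar> = 1" for s :: real using that by (metis abs_mult_self_eq mult_1)
  \<comment> \<open>Defined by almost everywhere equality and not through a chosen point, so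
    \<open>\<epsilon> i i = 1\<close> is immediate; empty intersections get the value 1.\<close>
  define \<epsilon> :: "nat \<Rightarrow> nat \<Rightarrow> real" where "\<epsilon> i j = (if AE z in lborel. z \<in> B i \<inter> B j \<longrightarrow> t i z = t j z then 1 else - 1)" for i j
  have \<epsilon>1: "\<bar>\<epsilon> i j\<bar> = 1" for i j by (simp add: \<epsilon>_def)
  have \<epsilon>r: "\<epsilon> i i = 1" for i by (simp add: \<epsilon>_def)
  have \<epsilon>: "AE z in lborel. z \<in> B i \<inter> B j \<longrightarrow> t i z = \<epsilon> i j * t j z" for i j
  proof (cases "AE z in lborel. z \<in> B i \<inter> B j \<longrightarrow> t i z = t j z")
    case True
    then show ?thesis by (simp add: \<epsilon>_def)
  next
    case False
    have ne: "B i \<inter> B j \<noteq> {}"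
    proof
      assume "B i \<inter> B j = {}"
      then have "AE z in lborel. z \<in> B i \<inter> B j \<longrightarrow> t i z = t j z" by simp
      with False show False ..
    qed
    have op: "open (B i \<inter> B j)" using B(1) by (intro open_Int)
    \<comment> \<open>A point generic for both lifts. Its transport to z is the same number in both
      relations, which leaves only the ratio at y.\<close>
    have "AE y in lborel. (AE z in lborel. y \<in> B i \<and> z \<in> B i \<longrightarrow> t i y * transport n y (z - y) = t i z) \<and>
        (AE z in lborel. y \<in> B j \<and> z \<in> B j \<longrightarrow> t j y * transport n y (z - y) = t j z)"
      by (rule AE_conjI[OF tT tT])
    then obtain y where y: "y \<in> B i \<inter> B j" and
      yy: "(AE z in lborel. y \<in> B i \<and> z \<in> B i \<longrightarrow> t i y * transport n y (z - y) = t i z) \<and>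
        (AE z in lborel. y \<in> B j \<and> z \<in> B j \<longrightarrow> t j y * transport n y (z - y) = t j z)"
      by (rule AE_lborel_open_exists[OF _ op ne])
    define c where "c = t i y * t j y"
    have AEc: "AE z in lborel. z \<in> B i \<inter> B j \<longrightarrow> t i z = c * t j z"
      using yy[THEN conjunct1] yy[THEN conjunct2]
    proof eventually_elim
      case (elim z)
      show ?case
      proof
        assume z: "z \<in> B i \<inter> B j"
        have "t i z = t i y * transport n y (z - y)" "t j z = t j y * transport n y (z - y)" using elim y z by auto
        then have "c * t j z = t i y * (t j y * t j y) * transport n y (z - y)" by (simp add: c_def)
        also have "\<dots> = t i z" using \<open>t i z = _\<close> sq[OF t1[of j y]] by simp
        finally show "t i z = c * t j z" ..
      qed
    qed
    have "\<bar>c\<bar> = 1" by (simp add: c_def abs_mult t1)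
    moreover have "c \<noteq> 1"
    proof
      assume "c = 1"
      with AEc have "AE z in lborel. z \<in> B i \<inter> B j \<longrightarrow> t i z = t j z" by simp
      with False show False ..
    qed
    ultimately have "c = \<epsilon> i j" using False by (auto simp: \<epsilon>_def)
    with AEc show ?thesis by simp
  qed
  have \<epsilon>t: "\<epsilon> i j * \<epsilon> j k = \<epsilon> i k" if ne: "B i \<inter> B j \<inter> B k \<noteq> {}" for i j k
  proof -
    \<comment> \<open>A nonempty open triple intersection contains a point where all three relations
      hold; the cocycle rule is read off there.\<close>
    have "AE z in lborel. (z \<in> B i \<inter> B j \<longrightarrow> t i z = \<epsilon> i j * t j z) \<and> (z \<in> B j \<inter> B k \<longrightarrow> t j z = \<epsilon> j k * t k z)
      \<and> (z \<in> B i \<inter> B k \<longrightarrow> t i z = \<epsilon> i k * t k z)"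
      by (intro AE_conjI \<epsilon>)
    moreover have "open (B i \<inter> B j \<inter> B k)" using B(1) by (intro open_Int)
    ultimately obtain z where z: "z \<in> B i \<inter> B j \<inter> B k" "(z \<in> B i \<inter> B j \<longrightarrow> t i z = \<epsilon> i j * t j z) \<and> (z \<in> B j \<inter> B k \<longrightarrow> t j z = \<epsilon> j k * t k z)
      \<and> (z \<in> B i \<inter> B k \<longrightarrow> t i z = \<epsilon> i k * t k z)"
      by (rule AE_lborel_open_exists[OF _ _ ne])
    then have "t i z = \<epsilon> i j * t j z" "t j z = \<epsilon> j k * t k z" "t i z = \<epsilon> i k * t k z" by blast+
    then have "\<epsilon> i j * \<epsilon> j k * t k z = \<epsilon> i k * t k z" by (metis mult.assoc)
    moreover have "t k z \<noteq> 0" using t1[of k z] by auto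
    ultimately show ?thesis by simp
  qed
  obtain c where c: "\<And>i. \<bar>c i\<bar> = (1::real)" "\<And>i j. B i \<inter> B j \<noteq> {} \<Longrightarrow> c i = \<epsilon> i j * c j"
    by (rule sign_cocycle_trivial[of \<Omega> B \<epsilon>, OF \<Omega>(2,1) cover B(1,4,3) \<epsilon>1 \<epsilon>r \<epsilon>t]) blast+
  have [measurable]: "B i \<in> sets borel" for i using B(1) by simp
  \<comment> \<open>A measurable choice of box. Other choices give the same \<tau> almost everywhere
    on \<Omega>, by the relation between \<open>c\<close> and \<epsilon>.\<close>
  define idx where "idx z = (LEAST i. z \<in> B i)" for z
  define \<tau> where "\<tau> z = c (idx z) * t (idx z) z" for z
  have idx [measurable]: "idx \<in> borel \<rightarrow>\<^sub>M count_space UNIV" unfolding idx_def by measurable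
  have \<tau>m: "\<tau> \<in> borel_measurable borel"
    unfolding \<tau>_def by (rule measurable_compose_countable[where f = "\<lambda>i z. c i * t i z", OF _ idx]) measurable
  note [measurable] = \<tau>m meas
  have \<tau>1: "\<bar>\<tau> x\<bar> = 1" for x by (simp add: \<tau>_def abs_mult c t1)
  have \<tau>B: "AE z in lborel. z \<in> B j \<longrightarrow> \<tau> z = c j * t j z" for j
  proof -
    have "AE z in lborel. \<forall>i. z \<in> B i \<inter> B j \<longrightarrow> t i z = \<epsilon> i j * t j z" unfolding AE_all_countable by (intro allI \<epsilon>)
    then show ?thesis
    proof eventually_elim
      case (elim z)
      show ?case
      proof
        assume z: "z \<in> B j"
        then have zi: "z \<in> B (idx z)" unfolding idx_def by (rule LeastI)
        then have "t (idx z) z = \<epsilon> (idx z) j * t j z" using elim z by blast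
        moreover have "c (idx z) = \<epsilon> (idx z) j * c j" using z zi by (intro c(2)) blast
        ultimately have "\<tau> z = (\<epsilon> (idx z) j * \<epsilon> (idx z) j) * (c j * t j z)" by (simp add: \<tau>_def)
        then show "\<tau> z = c j * t j z" using sq[OF \<epsilon>1[of "idx z" j]] by simp
      qed
    qed
  qed
  show thesis
  proof (rule that[OF \<tau>m \<tau>1])
    fix e :: 'a and K :: "'a set" assume e: "e \<in> Basis" and K: "compact K" "K \<subseteq> \<Omega>"
    let ?h = "\<lambda>l. (1 / 2 ^ l) *\<^sub>R e :: 'a"
    define S where "S i l = {x\<in>B i. x + ?h l \<in> B i \<and> (t i x *\<^sub>R n x) \<bullet> (t i (x + ?h l) *\<^sub>R n (x + ?h l)) < 0}" for i l
    define F where "F l = {x\<in>K. (\<tau> x *\<^sub>R n x) \<bullet> (\<tau> (x + ?h l) *\<^sub>R n (x + ?h l)) < 0}" for l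
    have [measurable]: "K \<in> sets borel" using K by (simp add: compact_imp_closed)
    have [measurable]: "S i l \<in> sets borel" "F l \<in> sets borel" for i l unfolding S_def F_def by measurable
    have S0: "(\<lambda>l. 2 ^ l * measure lborel (S i l)) \<longlonglongrightarrow> 0" for i
    proof -
      have hW: "?h l \<in> W" for l unfolding W_def using e by (intro image_eqI[of _ _ "(l, e)"]) auto
      show ?thesis unfolding S_def
        by (rule local_lift_sign_changes[OF unit meas B(1,2) jump_set_vanishing[OF unit meas wg B(1,2,5)] tm t1 tW[OF hW] B(3)])
    qed
    have Sfin: "emeasure lborel (S i l) < \<infinity>" for i l
    proof -
      have "emeasure lborel (S i l) \<le> emeasure lborel (B i)" by (intro emeasure_mono) (auto simp: S_def)
      also have "\<dots> < \<infinity>" using emeasure_bounded_finite[OF B(3)] by simp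
      finally show ?thesis .
    qed
    obtain I where I: "finite I" "K \<subseteq> (\<Union>i\<in>I. B i)"
    proof -
      have "K \<subseteq> (\<Union>i\<in>UNIV. B i)" using K(2) cover by simp
      from compactE_image[OF K(1) _ this] B(1) that show thesis by metis
    qed
    \<comment> \<open>A Lebesgue number of the finite cover of \<open>K\<close>: once 2^-l is below
      r, both ends of a step starting in \<open>K\<close> lie in one box.\<close>
    obtain r where r: "r > 0" "\<And>x. x \<in> K \<Longrightarrow> \<exists>G\<in>B ` I. ball x r \<subseteq> G"
      using Heine_Borel_lemma[OF K(1) I(2)] B(1) by (metis (no_types, lifting) imageE)
    obtain L where L: "(1/2::real) ^ L < r" using real_arch_pow_inv[of r "1/2"] r(1) by auto
    have le: "2 ^ l * measure lborel (F l) \<le> (\<Sum>i\<in>I. 2 ^ l * measure lborel (S i l))" if l: "l \<ge> L" for l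
    proof -
      have "(1/2::real) ^ l \<le> (1/2) ^ L" using l by (intro power_decreasing) auto
      then have hr: "norm (?h l) < r" using L e by (simp add: power_one_over)
      have AE1: "AE x in lborel. \<forall>i. x \<in> B i \<longrightarrow> \<tau> x = c i * t i x"
        unfolding AE_all_countable by (intro allI \<tau>B)
      have AE2: "AE x in lborel. \<forall>i. x + ?h l \<in> B i \<longrightarrow> \<tau> (x + ?h l) = c i * t i (x + ?h l)"
        by (rule AE_lborel_translate[where Q = "\<lambda>x. \<forall>i. x \<in> B i \<longrightarrow> \<tau> x = c i * t i x"]) (rule AE1)
      have "emeasure lborel (F l) \<le> emeasure lborel (\<Union>i\<in>I. S i l)"
      proof (rule emeasure_mono_AE)
        show "AE x in lborel. x \<in> F l \<longrightarrow> x \<in> (\<Union>i\<in>I. S i l)"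
          using AE1 AE2
        proof eventually_elim
          case (elim x)
          show ?case
          proof
            assume x: "x \<in> F l"
            then have "x \<in> K" by (simp add: F_def)
            then obtain i where i: "i \<in> I" "ball x r \<subseteq> B i" using r(2) by blast
            have "x \<in> ball x r" "x + ?h l \<in> ball x r" using r(1) hr by (simp_all add: dist_norm)
            then have xB: "x \<in> B i" "x + ?h l \<in> B i" using i(2) by blast+
            then have "\<tau> x = c i * t i x" "\<tau> (x + ?h l) = c i * t i (x + ?h l)" using elim by blast+
            \<comment> \<open>Within one box the constant \<open>c i\<close> occurs twice and
              cancels, so a flip of the global field is a flip of the local one.\<close>
            then have "(\<tau> x *\<^sub>R n x) \<bullet> (\<tau> (x + ?h l) *\<^sub>R n (x + ?h l)) = (c i * c i) * ((t i x *\<^sub>R n x) \<bullet> (t i (x + ?h l) *\<^sub>R n (x + ?h l)))"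
              by simp
            also have "\<dots> = (t i x *\<^sub>R n x) \<bullet> (t i (x + ?h l) *\<^sub>R n (x + ?h l))" using sq[OF c(1)] by simp
            finally have "x \<in> S i l" using x xB unfolding F_def S_def mem_Collect_eq by (simp only: simp_thms)
            then show "x \<in> (\<Union>i\<in>I. S i l)" using i(1) by blast
          qed
        qed
      qed (use I in auto)
      also have "\<dots> \<le> (\<Sum>i\<in>I. emeasure lborel (S i l))"
        using I(1) by (intro emeasure_subadditive_finite) auto
      also have "\<dots> = (\<Sum>i\<in>I. ennreal (measure lborel (S i l)))"
        using Sfin by (intro sum.cong refl emeasure_eq_ennreal_measure) (simp add: less_top)
      also have "\<dots> = ennreal (\<Sum>i\<in>I. measure lborel (S i l))" by (rule sum_ennreal) simp
      finally have "measure lborel (F l) \<le> (\<Sum>i\<in>I. measure lborel (S i l))"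
        unfolding measure_def[of lborel "F l"] by (intro enn2real_leI sum_nonneg measure_nonneg)
      then have "2 ^ l * measure lborel (F l) \<le> 2 ^ l * (\<Sum>i\<in>I. measure lborel (S i l))" by (intro mult_left_mono) auto
      then show ?thesis by (simp only: sum_distrib_left)
    qed
    have lim: "(\<lambda>l. \<Sum>i\<in>I. 2 ^ l * measure lborel (S i l)) \<longlonglongrightarrow> 0"
      using tendsto_sum[of I "\<lambda>i l. 2 ^ l * measure lborel (S i l)" "\<lambda>_. 0" sequentially] S0 by simp
    have "(\<lambda>l. 2 ^ l * measure lborel (F l)) \<longlonglongrightarrow> 0"
    proof (rule tendsto_sandwich[OF _ _ tendsto_const lim])
      show "\<forall>\<^sub>F l in sequentially. 2 ^ l * measure lborel (F l) \<le> (\<Sum>i\<in>I. 2 ^ l * measure lborel (S i l))"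
        using eventually_ge_at_top[of L] by eventually_elim (rule le)
    qed (simp add: always_eventually)
    then show "(\<lambda>l. 2 ^ l * measure lborel {x\<in>K. (\<tau> x *\<^sub>R n x) \<bullet> (\<tau> (x + (1 / 2 ^ l) *\<^sub>R e) *\<^sub>R n (x + (1 / 2 ^ l) *\<^sub>R e)) < 0}) \<longlonglongrightarrow> 0"
      by (simp only: F_def)
  qed
qed

theorem proposition5p2:
  fixes \<Omega> :: "(real^'d) set" and n :: "real^'d \<Rightarrow> real^3"
  assumes "CARD('d) \<in> {2, 3}"
    and "open \<Omega>" and "bounded \<Omega>" and "simply_connected \<Omega>"
    and "\<forall>x\<in>\<Omega>. n x \<in> sphere 0 1"
    and "(\<lambda>x. n x \<otimes> n x) \<in> W12 \<Omega>"
  shows "\<exists>m \<in> W12_into \<Omega> (sphere 0 1). AE x in lebesgue_on \<Omega>. m x \<otimes> m x = n x \<otimes> n x"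
proof -
  note \<Omega> = assms(2,3,4)
  have Qm: "(\<lambda>x. n x \<otimes> n x) \<in> borel_measurable (lebesgue_on \<Omega>)" using assms(6) unfolding W12_def L2_def by blast
  obtain n0 where n0: "n0 \<in> borel_measurable borel" "\<And>x. norm (n0 x) = 1"
    "AE x in lborel. x \<in> \<Omega> \<longrightarrow> n x \<otimes> n x = n0 x \<otimes> n0 x"
    using borel_unit_representative[OF \<Omega>(1) assms(5) Qm] by blast
  \<comment> \<open>The measurability lemma comes from the context of an open convex set; the whole
    space is one.\<close>
  have Pm: "(\<lambda>x. n0 x \<otimes> n0 x) \<in> borel_measurable borel"
    by (rule measurable_tensor[OF n0(2,1) open_UNIV convex_UNIV])
  have tensor_norm: "norm (u \<otimes> u) = 1" if "norm u = 1" for u :: "real^3"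
    using that by (simp add: norm_eq_1 inner_tensor)
  have "bounded (range (\<lambda>x. n0 x \<otimes> n0 x))"
    by (auto simp: bounded_iff tensor_norm[OF n0(2)] intro!: exI[of _ 1])
  from W12_weak_gradient[OF \<Omega>(1,2) assms(6) Pm this n0(3)]
  obtain g where wg: "weak_gradient \<Omega> (\<lambda>x. n0 x \<otimes> n0 x) g" and g0: "\<And>e x. e \<in> Basis \<Longrightarrow> x \<notin> \<Omega> \<Longrightarrow> g e x = 0"
    by blast
  obtain \<tau> where \<tau>: "\<tau> \<in> borel_measurable borel" "\<And>x. \<bar>\<tau> x\<bar> = 1"
    and small: "\<And>e K. e \<in> Basis \<Longrightarrow> compact K \<Longrightarrow> K \<subseteq> \<Omega> \<Longrightarrow>
      (\<lambda>l. 2 ^ l * measure lborel {x\<in>K. (\<tau> x *\<^sub>R n0 x) \<bullet> (\<tau> (x + (1 / 2 ^ l) *\<^sub>R e) *\<^sub>R n0 (x + (1 / 2 ^ l) *\<^sub>R e)) < 0}) \<longlonglongrightarrow> 0"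
    using global_lift[OF n0(2,1) wg \<Omega>(1,3)] by blast
  define m where "m x = \<tau> x *\<^sub>R n0 x" for x
  have mm [measurable]: "m \<in> borel_measurable borel" unfolding m_def by (intro borel_measurable_scaleR \<tau> n0)
  have m1: "norm (m x) = 1" for x by (simp add: m_def \<tau> n0)
  have mt: "m x \<otimes> m x = n0 x \<otimes> n0 x" for x unfolding m_def by (rule tensor_scale_sign[OF \<tau>(2)])
  \<comment> \<open>Signs drop out of the tensor square, so the gradient of the original data serves
    for \<open>m\<close> too.\<close>
  have wgm: "weak_gradient \<Omega> (\<lambda>x. m x \<otimes> m x) g" using wg by (simp only: mt)
  have fin: "emeasure lborel \<Omega> < \<infinity>" using emeasure_bounded_finite[OF \<Omega>(2)] by simp
  have mL2: "m \<in> L2 \<Omega>"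
  proof -
    have "integrable (lebesgue_on \<Omega>) (\<lambda>x. (norm (m x))\<^sup>2) \<longleftrightarrow> integrable lborel (indicator \<Omega> :: real^'d \<Rightarrow> real)"
      using \<Omega>(1) by (intro integrable_lebesgue_on_iff_lborel borel_imp_lebesgue_on) (auto simp: m1)
    also have "\<dots>" using \<Omega>(1) fin by (intro integrable_real_indicator) auto
    finally show ?thesis unfolding L2_def by (intro CollectI conjI borel_imp_lebesgue_on mm)
  qed
  have "\<exists>G\<in>L2 \<Omega>. weak_partial \<Omega> e m G" if e: "e \<in> Basis" for e
  proof -
    \<comment> \<open>The weak derivative of \<open>m\<close>, by the first order relation for unit
      fields; since \<open>m\<close> has length 1, it is bounded by \<open>g e\<close> and inherits
      square integrability.\<close>
    define G where "G x = g e x *v m x" for x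
    note gm [measurable] = weak_gradientD(3)[OF wg e]
    have Gm [measurable]: "G \<in> borel_measurable borel" unfolding G_def by measurable
    have Gn: "norm (G x) \<le> norm (g e x)" for x
      using norm_matrix_vector_mult_le[of "g e x" "m x"] by (simp add: G_def m1)
    have Gout: "G x = 0" if "x \<notin> \<Omega>" for x using g0[OF e that] by (simp add: G_def)
    have Gi: "integrable lborel G"
      by (rule Bochner_Integration.integrable_bound[OF weak_gradientD(4)[OF wg e]]) (use Gn in auto)
    have G2: "integrable lborel (\<lambda>x. (norm (G x))\<^sup>2)"
      by (rule Bochner_Integration.integrable_bound[OF weak_gradientD(5)[OF wg e]]) (use Gn in \<open>auto intro: power_mono\<close>)
    have GL2: "G \<in> L2 \<Omega>"
    proof -
      have "integrable (lebesgue_on \<Omega>) (\<lambda>x. (norm (G x))\<^sup>2) \<longleftrightarrow> integrable lborel (\<lambda>x. (norm (G x))\<^sup>2)"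
        by (intro integrable_lebesgue_on_iff_lborel borel_imp_lebesgue_on \<Omega>(1)) (auto simp: Gout)
      with G2 show ?thesis unfolding L2_def by (intro CollectI conjI borel_imp_lebesgue_on Gm) simp
    qed
    have "integrable lborel (\<lambda>x. indicator K x *\<^sub>R m x)" if "compact K" for K
      by (rule Bochner_Integration.integrable_bound[OF integrable_indicator_compact[OF that]])
        (use that in \<open>auto intro!: borel_measurable_scaleR borel_measurable_indicator simp: m1 compact_imp_closed\<close>)
    then have locm: "locally_integrable_on m \<Omega>" by (rule locally_integrable_borel[OF mm])
    have "integrable lborel (\<lambda>x. indicator K x *\<^sub>R G x)" if "compact K" for K
      using that by (intro integrable_mult_indicator Gi) (auto simp: compact_imp_closed)
    then have locG: "locally_integrable_on G \<Omega>" by (rule locally_integrable_borel[OF Gm])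
    have "(LINT x|lebesgue_on \<Omega>. frechet_derivative \<phi> (at x) e *\<^sub>R m x) = - (LINT x|lebesgue_on \<Omega>. \<phi> x *\<^sub>R G x)"
      if \<phi>: "test_function \<Omega> \<phi>" for \<phi>
    proof -
      have "(LBINT x. frechet_derivative \<phi> (at x) e *\<^sub>R m x) = - (LBINT x. \<phi> x *\<^sub>R G x)"
        unfolding G_def by (rule weak_derivative_of_lift[OF wgm \<Omega>(1) e m1 mm \<phi>]) (unfold m_def, rule small[OF e])
      then show ?thesis
        by (simp only: LINT_test_function[OF \<Omega>(1) \<phi> borel_imp_lebesgue_on[OF mm] mm AE_I2[OF impI[OF refl]]]
            LINT_test_function[OF \<Omega>(1) \<phi> borel_imp_lebesgue_on[OF Gm] Gm AE_I2[OF impI[OF refl]]])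
    qed
    then have "weak_partial \<Omega> e m G" unfolding weak_partial_def by (intro conjI locm locG allI impI)
    with GL2 show ?thesis by blast
  qed
  then have "m \<in> W12 \<Omega>" unfolding W12_def using mL2 by blast
  then have "m \<in> W12_into \<Omega> (sphere 0 1)" unfolding W12_into_def by (simp add: m1)
  moreover have "AE x in lebesgue_on \<Omega>. m x \<otimes> m x = n x \<otimes> n x"
    unfolding AE_lebesgue_on_iff[OF \<Omega>(1)] using n0(3) by eventually_elim (simp add: mt)
  ultimately show ?thesis by blast
qed

end
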